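(* Let $n \ge 2$ and let $K \subset \mathbb{R}^{2n}$ be a strongly convex body with smooth boundary. Then all outer billiard trajectories of $K$ are planar if and only if $K$ is a ball up to an affine symplectomorphism, i.e. there is an affine symplectomorphism of $\mathbb{R}^{2n}$ mapping $K$ onto a Euclidean ball $\{x : |x|\le r\}$ for some $r>0$.
   Context: $\mathbb{R}^{2n}$ has coordinates $(p_1,\dots,p_n,q_1,\dots,q_n)$, the standard Euclidean inner product, and the standard symplectic form $\omega=\sum_{i=1}^n dp_i\wedge dq_i$. $J$ is the standard complex structure on $\mathbb{R}^{2n}\cong\mathbb{C}^n$ (linear, $J^2=-1$). A convex body is a compact convex set with nonempty interior. "Smooth" means that the boundary is a $C^\infty$ hypersurface. A convex body with smooth boundary is strongly convex if the second fundamental form of its boundary is positive definite at every boundary point. For $z\in\partial K$ let $\nu(z)$ be the outer unit normal to $\partial K$ at $z$, and let $v(z)=J\nu(z)$; it is a unit vector spanning the characteristic direction $\ker\left(\omega|_{T_z\partial K}\right)$. Outer billiard map: for every point $x\in\mathbb{R}^{2n}\setminus K$ there are a unique $z\in\partial K$ and a unique $t>0$ with $x=z-t\,v(z)$ (a known fact for strictly convex smooth bodies). The outer billiard map sends $x$ to $y=z+t\,v(z)$, so that the line $xy$ is tangent to $K$ at $z$ in the characteristic direction and $z$ is the midpoint of $x$ and $y$. An outer billiard trajectory of $K$ is the sequence of iterates $z_1,z_2,z_3,\dots$ of a point $z_1\in\mathbb{R}^{2n}\setminus K$ under this map. A trajectory is planar if it lies in some affine $2$-dimensional plane of $\mathbb{R}^{2n}$.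 An affine symplectomorphism is an affine bijection $\mathbb{R}^{2n}\to\mathbb{R}^{2n}$ whose linear part preserves $\omega$. *)

theory Defs
  imports "HOL-Analysis.Analysis"
begin

text \<open>A point of \<open>\<real>\<^sup>2\<^sup>n\<close> is a pair \<open>(p, q)\<close> of vectors in \<open>real ^ 'n\<close>, where \<open>n = CARD('n)\<close>;
  the inner product and norm of the product type are the standard Euclidean ones.\<close>

type_synonym 'n phase_space = "(real ^ 'n) \<times> (real ^ 'n)"

definition symplectic_form :: "'n::finite phase_space \<Rightarrow> 'n phase_space \<Rightarrow> real" where
  "symplectic_form u w = (\<Sum>i\<in>UNIV. fst u $ i * snd w $ i - snd u $ i * fst w $ i)"

text \<open>Multiplication by the imaginary unit under the identification \<open>(p, q) \<mapsto> p + i q\<close>.\<close>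

definition complex_structure :: "'n::finite phase_space \<Rightarrow> 'n phase_space" where
  "complex_structure u = (- snd u, fst u)"

definition convex_body :: "'a::euclidean_space set \<Rightarrow> bool" where
  "convex_body K \<longleftrightarrow> compact K \<and> convex K \<and> interior K \<noteq> {}"

text \<open>The class \<open>C\<^sup>k\<close> on an open set \<open>U\<close>, by iterating directional derivatives.\<close>

primrec Ck_on :: "nat \<Rightarrow> ('a::euclidean_space \<Rightarrow> 'b::euclidean_space) \<Rightarrow> 'a set \<Rightarrow> bool" where
  "Ck_on 0 f U \<longleftrightarrow> continuous_on U f"
| "Ck_on (Suc k) f U \<longleftrightarrow> (\<forall>x\<in>U. f differentiable (at x)) \<and>
     (\<forall>h. Ck_on k (\<lambda>x. frechet_derivative f (at x) h) U)"

definition smooth_on :: "'a::euclidean_space set \<Rightarrow> ('a \<Rightarrow> 'b::euclidean_space) \<Rightarrow> bool" where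
  "smooth_on U f \<longleftrightarrow> (\<forall>k. Ck_on k f U)"

definition smooth_hypersurface :: "'a::euclidean_space set \<Rightarrow> bool" where
  "smooth_hypersurface S \<longleftrightarrow>
     (\<forall>z\<in>S. \<exists>U (f :: 'a \<Rightarrow> real). open U \<and> z \<in> U \<and> smooth_on U f \<and>
        (\<forall>x\<in>U. frechet_derivative f (at x) \<noteq> (\<lambda>h. 0)) \<and> S \<inter> U = {x \<in> U. f x = 0})"

text \<open>Velocities of curves in \<open>S\<close> through \<open>z\<close>. Differentiability of the curve at time \<open>0\<close> suffices:
  for a smooth hypersurface, smooth curves yield the same set of velocities.\<close>

definition tangent_space :: "'a::euclidean_space set \<Rightarrow> 'a \<Rightarrow> 'a set" where
  "tangent_space S z = {u. \<exists>\<gamma> :: real \<Rightarrow> 'a. \<exists>e>0. \<gamma> 0 = z \<and> (\<forall>t. \<bar>t\<bar> < e \<longrightarrow> \<gamma> t \<in> S) \<and>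
     (\<gamma> has_vector_derivative u) (at 0)}"

definition outer_normal :: "'a::euclidean_space set \<Rightarrow> 'a \<Rightarrow> 'a" where
  "outer_normal K z = (THE \<nu>. norm \<nu> = 1 \<and> (\<forall>u\<in>tangent_space (frontier K) z. \<nu> \<bullet> u = 0) \<and>
     (\<exists>e>0. \<forall>s. 0 < s \<and> s < e \<longrightarrow> z + s *\<^sub>R \<nu> \<notin> K))"

text \<open>The sign is that of the outer normal, so that round spheres have positive second fundamental
  form. The derivative of the Gauss map within the boundary is only determined on vectors tangent
  to the boundary; the form is used for such vectors only.\<close>

definition second_fundamental_form :: "'a::euclidean_space set \<Rightarrow> 'a \<Rightarrow> 'a \<Rightarrow> 'a \<Rightarrow> real" where
  "second_fundamental_form K z u w =
     frechet_derivative (outer_normal K) (at z within frontier K) u \<bullet> w"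

text \<open>To be read for a convex body with smooth boundary.\<close>

definition strongly_convex :: "'a::euclidean_space set \<Rightarrow> bool" where
  "strongly_convex K \<longleftrightarrow>
     (\<forall>z\<in>frontier K. \<forall>u\<in>tangent_space (frontier K) z.
        u \<noteq> 0 \<longrightarrow> second_fundamental_form K z u u > 0)"

definition characteristic_vector :: "'n::finite phase_space set \<Rightarrow> 'n phase_space \<Rightarrow> 'n phase_space" where
  "characteristic_vector K z = complex_structure (outer_normal K z)"

text \<open>Only meaningful for points outside \<open>K\<close>.\<close>

definition outer_billiard_map :: "'n::finite phase_space set \<Rightarrow> 'n phase_space \<Rightarrow> 'n phase_space" where
  "outer_billiard_map K x = (THE y. \<exists>z\<in>frontier K. \<exists>t>0.
     x = z - t *\<^sub>R characteristic_vector K z \<and> y = z + t *\<^sub>R characteristic_vector K z)"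

definition outer_billiard_trajectory ::
    "'n::finite phase_space set \<Rightarrow> 'n phase_space \<Rightarrow> nat \<Rightarrow> 'n phase_space" where
  "outer_billiard_trajectory K x k = (outer_billiard_map K ^^ k) x"

definition planar :: "(nat \<Rightarrow> 'a::euclidean_space) \<Rightarrow> bool" where
  "planar s \<longleftrightarrow> (\<exists>P. affine P \<and> aff_dim P = 2 \<and> range s \<subseteq> P)"

definition affine_symplectomorphism :: "('n::finite phase_space \<Rightarrow> 'n phase_space) \<Rightarrow> bool" where
  "affine_symplectomorphism \<phi> \<longleftrightarrow> bij \<phi> \<and>
     (\<exists>L b. linear L \<and> (\<forall>x. \<phi> x = L x + b) \<and>
        (\<forall>u w. symplectic_form (L u) (L w) = symplectic_form u w))"

end

theory Submission
  imports Defs "HOL-Complex_Analysis.Cauchy_Integral_Formula"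
begin

text \<open>For \<open>u \<noteq> 0\<close> let \<open>z(u)\<close> be the point of \<open>K\<close> at which \<open>u\<close> is an outer normal. A point outside \<open>K\<close>
  is \<open>z(u) - J u\<close> for exactly one \<open>u\<close>, and the billiard map sends it to \<open>z(u) + J u\<close>. Trajectories
  can therefore be followed by their normals \<open>u\<close>.

  \<^emph>\<open>Invariant planes.\<close> Start at \<open>z(u) - R J u\<close> with \<open>R\<close> large. After division by \<open>R\<close>, every second
  normal of the trajectory moves by almost an Euler step of length \<open>2 / R\<close> for the vector field
  \<open>n(u) = - J (z(u) - z(- u))\<close>, which is the Hamiltonian field of the width function \<open>H\<close> of \<open>K\<close>. The
  plane of the trajectory converges for \<open>R \<rightarrow> \<infinity>\<close>, and so the tangency points that correspond to an orbit
  of \<open>n\<close> lie in one plane. The result is \<open>plane_invariance\<close>: for \<open>N(u) = span {u, n(u)}\<close> all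
  points \<open>z(w)\<close> with \<open>w \<in> N(u)\<close> lie in the affine plane \<open>z(u) + J N(u)\<close>.

  \<^emph>\<open>The width.\<close> Let \<open>Y = H n\<close>, the Hamiltonian field of \<open>G = H\<^sup>2 / 2\<close>. It is homogeneous of degree 1
  and preserves the symplectic planes \<open>N(u)\<close>. Moving \<open>u\<close> transversally to \<open>N(u)\<close> and using the symmetry
  of the Hessian of \<open>G\<close> on the symplectic complement of \<open>N(u)\<close>, which is not zero in real dimension at least 4,
  gives a quadratic relation on \<open>N(u)\<close>. It forces \<open>G\<close> to be a quadratic form on each plane
  (\<open>linear_on_plane\<close>), with all orbits of \<open>Y\<close> having the same period (\<open>frequency_constant\<close>), and
  also \<open>DY(u)\<^sup>2 = - k\<close> (\<open>S_squared\<close>). Thus \<open>DY(u) / \<surd>k\<close> is an almost complex structure. The partial Legendre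
  transform \<open>(p, q) \<mapsto> (p, - (\<partial>G/\<partial>q) / \<surd>k)\<close> is a global holomorphic chart for it with values in \<open>\<complex>\<^sup>n\<close>. Its
  inverse is homogeneous of degree 1, so on complex lines that avoid the origin it is entire of linear
  growth, hence affine by Liouville. Therefore \<open>Y\<close> is linear (\<open>linear_Y\<close>) and \<open>G\<close> is a quadratic form.

  \<^emph>\<open>The centre.\<close> It remains to show that \<open>c(u) = (z(u) + z(- u)) / 2\<close> is constant. The same transversal
  variation, together with \<open>c(- u) = c(u)\<close>, shows that \<open>c\<close> is constant on the planes \<open>N(u)\<close>. By
  symmetry of its derivative it is then antiholomorphic for the complex structure \<open>Y / \<surd>k\<close>, and it is
  bounded, so Liouville's theorem on complex lines applies again (\<open>constant_off_origin\<close>). Hence \<open>K\<close> is an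
  ellipsoid whose Hamiltonian field squares to a scalar, and a unitary basis for
  \<open>Y / \<surd>k\<close> provides the affine symplectomorphism onto a ball.

  \<^emph>\<open>The converse.\<close> Affine symplectomorphisms carry characteristic directions to characteristic directions,
  and for a ball about the origin the trajectory of \<open>x\<close> stays in the plane \<open>span {x, J x}\<close>.\<close>

section \<open>Symplectic linear algebra\<close>

abbreviation J :: "'n::finite phase_space \<Rightarrow> 'n phase_space" where
  "J \<equiv> complex_structure"

abbreviation omega :: "'n::finite phase_space \<Rightarrow> 'n phase_space \<Rightarrow> real" where
  "omega \<equiv> symplectic_form"

lemma symplectic_form_eq_inner: "omega u w = J u \<bullet> w"
  by (simp add: symplectic_form_def complex_structure_def inner_prod_def inner_vec_def
      sum_subtractf sum_negf)

lemma linear_J: "linear J"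
  by (rule linearI) (auto simp: complex_structure_def prod_eq_iff)

lemma bounded_linear_J: "bounded_linear J"
  using linear_J linear_conv_bounded_linear by blast

lemmas J_add = linear_add[OF linear_J] and J_diff = linear_diff[OF linear_J]
  and J_scale = linear_scale[OF linear_J] and J_minus = linear_neg[OF linear_J]
  and J_zero = linear_0[OF linear_J]

lemma J_J [simp]: "J (J u) = - u"
  by (simp add: complex_structure_def prod_eq_iff)

lemma J_inner_J [simp]: "J u \<bullet> J w = u \<bullet> w"
  by (simp add: complex_structure_def inner_prod_def)

lemma norm_J [simp]: "norm (J u) = norm u"
  by (simp add: norm_eq_sqrt_inner)

lemma J_eq_0_iff [simp]: "J u = 0 \<longleftrightarrow> u = 0"
  by (metis norm_J norm_eq_zero)

lemma J_inner_self [simp]: "J u \<bullet> u = 0" "u \<bullet> J u = 0"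
  by (simp_all add: complex_structure_def inner_prod_def inner_commute)

lemma inner_J: "u \<bullet> J w = - (J u \<bullet> w)"
  using J_inner_J[of u "J w"] by simp

lemma bounded_bilinear_symplectic: "bounded_bilinear (omega :: 'n::finite phase_space \<Rightarrow> _)"
proof -
  have eq: "(omega :: 'n phase_space \<Rightarrow> _) = (\<lambda>u w. J u \<bullet> w)"
    by (intro ext) (simp add: symplectic_form_eq_inner)
  show ?thesis unfolding eq
    by (rule bounded_bilinear.comp1[OF bounded_bilinear_inner bounded_linear_J])
qed

interpretation symplectic: bounded_bilinear symplectic_form
  by (rule bounded_bilinear_symplectic)

lemma symplectic_skew: "omega u w = - omega w u"
  using inner_J[of w u] by (simp add: symplectic_form_eq_inner inner_commute)

lemma symplectic_self [simp]: "omega u u = 0"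
  by (simp add: symplectic_form_eq_inner)

lemmas symplectic_simps = symplectic.add_left symplectic.add_right symplectic.diff_left
  symplectic.diff_right symplectic.scaleR_left symplectic.scaleR_right symplectic.minus_left
  symplectic.minus_right symplectic.zero_left symplectic.zero_right

lemma symplectic_nondegenerate: "(\<And>w. omega u w = 0) \<Longrightarrow> u = 0"
  by (metis J_eq_0_iff inner_eq_zero_iff symplectic_form_eq_inner)

lemma span_pair: "x \<in> span {u, v} \<longleftrightarrow> (\<exists>a b. x = a *\<^sub>R u + b *\<^sub>R v)"
  for u v :: "'a::real_vector"
proof -
  have "x \<in> span {u, v} \<longleftrightarrow> (\<exists>a b. x - a *\<^sub>R u = b *\<^sub>R v)"
    by (auto simp: span_insert span_singleton)
  then show ?thesis by (metis add.commute diff_add_cancel add_diff_cancel_left')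
qed

text \<open>The plane spanned by \<open>u\<close> and \<open>v\<close> is symplectic, so the space is the direct sum of this plane and its
  symplectic complement.\<close>

lemma symplectic_decomposition:
  assumes "omega u v \<noteq> 0"
  obtains a b y where "x = a *\<^sub>R u + b *\<^sub>R v + y" "omega u y = 0" "omega v y = 0"
proof
  let ?a = "omega x v / omega u v" and ?b = "omega u x / omega u v"
  let ?y = "x - ?a *\<^sub>R u - ?b *\<^sub>R v"
  show "x = ?a *\<^sub>R u + ?b *\<^sub>R v + ?y" by simp
  show "omega u ?y = 0" "omega v ?y = 0"
    using assms symplectic_skew[of v x] symplectic_skew[of v u] by (simp_all add: symplectic_simps)
qed

lemma symplectic_combination_nonzero:
  assumes "omega u v \<noteq> 0" "(a, b) \<noteq> (0, 0)"
  shows "a *\<^sub>R u + b *\<^sub>R v \<noteq> 0"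
proof
  assume *: "a *\<^sub>R u + b *\<^sub>R v = 0"
  have "omega (a *\<^sub>R u + b *\<^sub>R v) v = a * omega u v"
    and "omega u (a *\<^sub>R u + b *\<^sub>R v) = b * omega u v" by (simp_all add: symplectic_simps)
  then have "a * omega u v = 0" "b * omega u v = 0"
    unfolding * by (simp_all only: symplectic_simps)
  then show False using assms by simp
qed

lemma symplectic_complement_nondegenerate:
  assumes "omega u v \<noteq> 0" "omega u x = 0" "omega v x = 0"
    and "\<And>y. omega u y = 0 \<Longrightarrow> omega v y = 0 \<Longrightarrow> omega x y = 0"
  shows "x = 0"
proof (rule symplectic_nondegenerate)
  fix w
  obtain a b y where w: "w = a *\<^sub>R u + b *\<^sub>R v + y" "omega u y = 0" "omega v y = 0"
    using symplectic_decomposition[OF assms(1)] by metis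
  show "omega x w = 0"
    using assms(2,3) assms(4)[OF w(2,3)] symplectic_skew[of x u] symplectic_skew[of x v]
    by (simp add: w(1) symplectic_simps)
qed

lemma DIM_phase_space: "DIM('n::finite phase_space) = 2 * CARD('n)"
  by simp

text \<open>In real dimension at least 4 the symplectic complement of a symplectic plane is a non-zero symplectic
  space. This is how the assumption \<open>n \<ge> 2\<close> enters the variational arguments.\<close>

lemma symplectic_complement_pair:
  fixes u v :: "'n::finite phase_space"
  assumes "CARD('n) \<ge> 2" "omega u v \<noteq> 0"
  obtains x y where "omega u x = 0" "omega v x = 0" "omega u y = 0" "omega v y = 0" "omega x y \<noteq> 0"
proof -
  have "dim {J u, J v} \<le> card {J u, J v}" by (rule dim_le_card') simp
  also have "\<dots> \<le> 2" by (simp add: card_insert_if)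
  also have "\<dots> < DIM('n phase_space)" using assms(1) by simp
  finally have "dim {J u, J v} < DIM('n phase_space)" .
  then obtain x where x: "x \<noteq> 0" "\<And>y. y \<in> span {J u, J v} \<Longrightarrow> orthogonal x y"
    using orthogonal_to_subspace_exists by blast
  have ux: "omega u x = 0" "omega v x = 0"
    using x(2)[of "J u"] x(2)[of "J v"]
    by (simp_all add: span_base symplectic_form_eq_inner orthogonal_def inner_commute)
  have "\<exists>y. omega u y = 0 \<and> omega v y = 0 \<and> omega x y \<noteq> 0"
    using symplectic_complement_nondegenerate[OF assms(2) ux] x(1) by blast
  then show ?thesis using that ux by blast
qed

text \<open>If \<open>D\<close> moves inside a moving symplectic plane, its velocity modulo that plane is determined by its
  coordinates in the plane: the derivatives of the coordinates do not contribute.\<close>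

lemma variation_in_moving_plane:
  fixes p q D :: "real \<Rightarrow> 'n::finite phase_space"
  assumes p: "(p has_vector_derivative p') (at 0)" and q: "(q has_vector_derivative q') (at 0)"
    and D: "(D has_vector_derivative D') (at 0)"
    and pq: "omega (p 0) (q 0) \<noteq> 0"
    and mem: "\<And>t. D t \<in> span {p t, q t}" and D0: "D 0 = a *\<^sub>R p 0 + b *\<^sub>R q 0"
    and y: "omega (p 0) y = 0" "omega (q 0) y = 0"
  shows "omega D' y = a * omega p' y + b * omega q' y"
proof -
  \<comment> \<open>Cramer's rule without division. It holds for all \<open>t\<close>, and at \<open>t = 0\<close> the factors \<open>omega (p t) y\<close>,
    \<open>omega (q t) y\<close> and \<open>omega (D t) y\<close> vanish, so that few terms survive differentiation.\<close>
  have id: "omega (D t) y * omega (p t) (q t)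
      = omega (D t) (q t) * omega (p t) y + omega (p t) (D t) * omega (q t) y" for t
  proof -
    obtain c d where "D t = c *\<^sub>R p t + d *\<^sub>R q t" using mem span_pair by blast
    then show ?thesis by (simp add: symplectic_simps algebra_simps)
  qed
  note hv = symplectic.has_vector_derivative has_vector_derivative_mult has_vector_derivative_const
    has_vector_derivative_add p q D
  have l: "((\<lambda>t. omega (D t) y * omega (p t) (q t)) has_vector_derivative
      omega (D 0) y * (omega (p 0) q' + omega p' (q 0)) + (omega (D 0) 0 + omega D' y) * omega (p 0) (q 0)) (at 0)"
    by (intro hv)
  have r: "((\<lambda>t. omega (D t) (q t) * omega (p t) y + omega (p t) (D t) * omega (q t) y) has_vector_derivative
      (omega (D 0) (q 0) * (omega (p 0) 0 + omega p' y) + (omega (D 0) q' + omega D' (q 0)) * omega (p 0) y)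
      + (omega (p 0) (D 0) * (omega (q 0) 0 + omega q' y) + (omega (p 0) D' + omega p' (D 0)) * omega (q 0) y)) (at 0)"
    by (intro hv)
  have "omega (D 0) y * (omega (p 0) q' + omega p' (q 0)) + (omega (D 0) 0 + omega D' y) * omega (p 0) (q 0)
     = (omega (D 0) (q 0) * (omega (p 0) 0 + omega p' y) + (omega (D 0) q' + omega D' (q 0)) * omega (p 0) y)
      + (omega (p 0) (D 0) * (omega (q 0) 0 + omega q' y) + (omega (p 0) D' + omega p' (D 0)) * omega (q 0) y)"
    using vector_derivative_unique_at[OF l[unfolded id] r] .
  then have "omega D' y * omega (p 0) (q 0)
      = (a * omega p' y + b * omega q' y) * omega (p 0) (q 0)"
    by (simp add: D0 y symplectic_simps algebra_simps)
  then show ?thesis using pq by simp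
qed

lemma mem_span_pair_iff_symplectic:
  assumes "omega u v \<noteq> 0"
  shows "x \<in> span {u, v} \<longleftrightarrow> (\<forall>y. omega u y = 0 \<longrightarrow> omega v y = 0 \<longrightarrow> omega x y = 0)"
proof (intro iffI allI impI)
  fix y assume "x \<in> span {u, v}" "omega u y = 0" "omega v y = 0"
  then show "omega x y = 0" by (auto simp: span_pair symplectic_simps)
next
  assume *: "\<forall>y. omega u y = 0 \<longrightarrow> omega v y = 0 \<longrightarrow> omega x y = 0"
  obtain a b z where x: "x = a *\<^sub>R u + b *\<^sub>R v + z" and z: "omega u z = 0" "omega v z = 0"
    using symplectic_decomposition[OF assms] by metis
  have "omega z y = 0" if "omega u y = 0" "omega v y = 0" for y
    using *[rule_format, OF that] that by (simp add: x symplectic_simps)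
  then have "z = 0" using symplectic_complement_nondegenerate[OF assms z] by blast
  then show "x \<in> span {u, v}" using x by (auto simp: span_pair)
qed

lemma has_vector_derivative_compose:
  assumes "(p has_vector_derivative p') (at t)" "(f has_derivative f') (at (p t))"
  shows "((\<lambda>t. f (p t)) has_vector_derivative f' p') (at t)"
proof -
  have "(f \<circ> p has_derivative f' \<circ> (\<lambda>x. x *\<^sub>R p')) (at t)"
    using assms by (intro diff_chain_at) (auto simp: has_vector_derivative_def)
  moreover have "f' \<circ> (\<lambda>x. x *\<^sub>R p') = (\<lambda>x. x *\<^sub>R f' p')"
    using has_derivative_bounded_linear[OF assms(2)] by (auto simp: linear_scale bounded_linear.linear)
  ultimately show ?thesis by (simp add: has_vector_derivative_def o_def)
qed

lemma has_vector_derivative_line: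
  "((\<lambda>t. u + t *\<^sub>R v) has_vector_derivative v) (at t)"
  by (auto intro!: derivative_eq_intros simp: has_vector_derivative_def)

lemma vector_derivative_in_plane:
  fixes f :: "real \<Rightarrow> 'n::finite phase_space"
  assumes "omega u v \<noteq> 0" "(f has_vector_derivative f') (at t)" "\<And>t. f t \<in> span {u, v}"
  shows "f' \<in> span {u, v}"
proof -
  have "omega f' y = 0" if "omega u y = 0" "omega v y = 0" for y
  proof -
    have "((\<lambda>t. omega (f t) y) has_vector_derivative omega (f t) 0 + omega f' y) (at t)"
      by (intro symplectic.has_vector_derivative assms(2) has_vector_derivative_const)
    moreover have "(\<lambda>t. omega (f t) y) = (\<lambda>t. 0)"
      using assms(3) that unfolding mem_span_pair_iff_symplectic[OF assms(1)] by blast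
    ultimately have "((\<lambda>t. 0) has_vector_derivative omega f' y) (at t)"
      by (simp add: symplectic_simps)
    then show ?thesis
      using vector_derivative_unique_at has_vector_derivative_const by blast
  qed
  then show ?thesis unfolding mem_span_pair_iff_symplectic[OF assms(1)] by blast
qed

text \<open>Any three vectors of a plane satisfy this linear relation. As it is a closed condition, it turns
  membership in a plane into something that passes to limits.\<close>

lemma span_pair_symplectic_identity:
  assumes "x \<in> span {u, v}" "y \<in> span {u, v}" "w \<in> span {u, v}"
  shows "omega x y *\<^sub>R w = omega w y *\<^sub>R x + omega x w *\<^sub>R y"
proof -
  obtain x1 x2 where x: "x = x1 *\<^sub>R u + x2 *\<^sub>R v" using assms(1) span_pair by blast
  obtain y1 y2 where y: "y = y1 *\<^sub>R u + y2 *\<^sub>R v" using assms(2) span_pair by blast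
  obtain w1 w2 where w: "w = w1 *\<^sub>R u + w2 *\<^sub>R v" using assms(3) span_pair by blast
  have vu: "omega v u = - omega u v" by (rule symplectic_skew)
  have "omega x y = (x1 * y2 - x2 * y1) * omega u v" "omega w y = (w1 * y2 - w2 * y1) * omega u v"
    "omega x w = (x1 * w2 - x2 * w1) * omega u v"
    by (simp_all add: x y w symplectic_simps vu algebra_simps)
  then show ?thesis by (simp only:) (simp add: x y w algebra_simps)
qed

lemma span_pair_rebase:
  assumes "x \<in> span {u, v}" "y \<in> span {u, v}" "w \<in> span {u, v}" "omega x y \<noteq> 0"
  shows "w = (omega w y / omega x y) *\<^sub>R x + (omega x w / omega x y) *\<^sub>R y"
proof -
  have "w = (1 / omega x y) *\<^sub>R (omega x y *\<^sub>R w)" using assms(4) by simp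
  also have "\<dots> = (omega w y / omega x y) *\<^sub>R x + (omega x w / omega x y) *\<^sub>R y"
    unfolding span_pair_symplectic_identity[OF assms(1-3)] by (simp add: scaleR_add_right)
  finally show ?thesis .
qed

lemma span_pair_limit:
  assumes x: "\<And>n::nat. x n \<in> span {u, v n}" and lim: "x \<longlonglongrightarrow> x0" "v \<longlonglongrightarrow> v0"
    and uv: "omega u v0 \<noteq> 0"
  shows "x0 \<in> span {u, v0}"
proof -
  have eq: "omega u (v n) *\<^sub>R x n = omega (x n) (v n) *\<^sub>R u + omega u (x n) *\<^sub>R v n" for n
    by (rule span_pair_symplectic_identity[OF _ _ x]) (auto simp: span_base)
  have "(\<lambda>n. omega u (v n) *\<^sub>R x n) \<longlonglongrightarrow> omega u v0 *\<^sub>R x0"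
    by (intro tendsto_intros symplectic.tendsto lim)
  moreover have "(\<lambda>n. omega u (v n) *\<^sub>R x n) \<longlonglongrightarrow> omega x0 v0 *\<^sub>R u + omega u x0 *\<^sub>R v0"
    unfolding eq by (intro tendsto_intros symplectic.tendsto lim)
  ultimately have e: "omega u v0 *\<^sub>R x0 = omega x0 v0 *\<^sub>R u + omega u x0 *\<^sub>R v0"
    by (rule LIMSEQ_unique)
  have "x0 = (1 / omega u v0) *\<^sub>R (omega u v0 *\<^sub>R x0)" using uv by simp
  also have "\<dots> \<in> span {u, v0}" unfolding e by (intro span_scale span_add span_base) auto
  finally show ?thesis .
qed

section \<open>Hamiltonian vector fields with planar orbits\<close>

text \<open>Used to extend statements about ellipses and circles in a plane to the whole plane by homogeneity.\<close>

lemma polar_coordinates: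
  fixes a b :: real
  assumes "(a, b) \<noteq> (0, 0)"
  obtains s t where "s > 0" "a = s * cos t" "b = s * sin t"
proof -
  define s where "s = sqrt (a\<^sup>2 + b\<^sup>2)"
  have "a\<^sup>2 + b\<^sup>2 > 0" using assms by (auto simp: sum_power2_gt_zero_iff)
  then have s: "s > 0" "s\<^sup>2 = a\<^sup>2 + b\<^sup>2"
    unfolding s_def by (rule real_sqrt_gt_zero, rule real_sqrt_pow2[OF less_imp_le])
  have "(a / s)\<^sup>2 + (b / s)\<^sup>2 = s\<^sup>2 / s\<^sup>2"
    by (simp only: s(2) power_divide add_divide_distrib)
  then have "(a / s)\<^sup>2 + (b / s)\<^sup>2 = 1" using s(1) by simp
  then obtain t where "a / s = cos t" "b / s = sin t" using sincos_total_2pi by metis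
  then show ?thesis using that[of s t] s(1) by (simp add: field_simps)
qed

text \<open>The situation of the Hamiltonian field \<open>Y\<close> of a strictly convex function \<open>G\<close> that is even and homogeneous of degree 2, with
  \<open>omega (Y u) u = 2 G(u)\<close>. That \<open>S u = DY(u)\<close> is skew for the symplectic form is the symmetry of the
  Hessian of \<open>G\<close>; \<open>monotone\<close> is strict convexity. The decisive assumption is the last one: for each
  \<open>u\<close> the plane \<open>span {u, Y u}\<close> is mapped into itself.\<close>

locale planar_hamiltonian_field =
  fixes Y :: "'n::finite phase_space \<Rightarrow> 'n phase_space"
    and S :: "'n phase_space \<Rightarrow> 'n phase_space \<Rightarrow> 'n phase_space"
  assumes dim: "CARD('n) \<ge> 2"
    and homogeneous: "Y (r *\<^sub>R u) = r *\<^sub>R Y u"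
    and derivative: "u \<noteq> 0 \<Longrightarrow> (Y has_derivative S u) (at u)"
    and hamiltonian: "u \<noteq> 0 \<Longrightarrow> omega (S u x) y = - omega x (S u y)"
    and monotone: "u \<noteq> w \<Longrightarrow> omega (Y u - Y w) (u - w) > 0"
    and plane_invariant: "Y (a *\<^sub>R u + b *\<^sub>R Y u) \<in> span {u, Y u}"
begin

lemma Y_0 [simp]: "Y 0 = 0"
  using homogeneous[of 0 0] by simp

lemma energy_pos: "u \<noteq> 0 \<Longrightarrow> omega (Y u) u > 0"
  using monotone[of u 0] by simp

lemma plane_symplectic: "u \<noteq> 0 \<Longrightarrow> omega u (Y u) < 0"
  using energy_pos symplectic_skew[of u "Y u"] by simp

lemma plane_symplectic': "u \<noteq> 0 \<Longrightarrow> omega u (Y u) \<noteq> 0"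
  by (metis less_irrefl plane_symplectic)

lemma plane_nonzero:
  assumes "u \<noteq> 0" "(a, b) \<noteq> (0, 0)"
  shows "a *\<^sub>R u + b *\<^sub>R Y u \<noteq> 0"
  by (rule symplectic_combination_nonzero[OF plane_symplectic'[OF assms(1)] assms(2)])

lemma linear_S: "u \<noteq> 0 \<Longrightarrow> linear (S u)"
  using derivative has_derivative_bounded_linear bounded_linear.linear by blast

lemma Y_vector_derivative:
  "(p has_vector_derivative p') (at t) \<Longrightarrow> p t \<noteq> 0 \<Longrightarrow>
   ((\<lambda>t. Y (p t)) has_vector_derivative S (p t) p') (at t)"
  by (rule has_vector_derivative_compose[OF _ derivative])

lemma S_along_line:
  assumes "u \<noteq> 0" "((\<lambda>t. Y (u + t *\<^sub>R v)) has_vector_derivative d) (at 0)"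
  shows "S u v = d"
proof -
  have "((\<lambda>t. Y (u + t *\<^sub>R v)) has_vector_derivative S (u + 0 *\<^sub>R v) v) (at 0)"
    by (rule Y_vector_derivative[OF has_vector_derivative_line]) (use assms in simp)
  then show ?thesis using vector_derivative_unique_at assms(2) by fastforce
qed

lemma S_self:
  assumes "u \<noteq> 0"
  shows "S u u = Y u"
proof (rule S_along_line[OF assms])
  have eq: "(\<lambda>t. Y (u + t *\<^sub>R u)) = (\<lambda>t. Y u + t *\<^sub>R Y u)"
    using homogeneous[of "1 + t" u for t] by (auto simp: algebra_simps)
  show "((\<lambda>t. Y (u + t *\<^sub>R u)) has_vector_derivative Y u) (at 0)"
    unfolding eq by (rule has_vector_derivative_line)
qed

lemma S_plane:
  assumes "u \<noteq> 0" "(a, b) \<noteq> (0, 0)" "v \<in> span {u, Y u}"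
  shows "S (a *\<^sub>R u + b *\<^sub>R Y u) v \<in> span {u, Y u}"
proof (rule vector_derivative_in_plane[OF plane_symplectic'[OF assms(1)]])
  let ?m = "a *\<^sub>R u + b *\<^sub>R Y u"
  have "((\<lambda>t. Y (?m + t *\<^sub>R v)) has_vector_derivative S (?m + 0 *\<^sub>R v) v) (at 0)"
    by (rule Y_vector_derivative[OF has_vector_derivative_line]) (use plane_nonzero assms in simp)
  then show "((\<lambda>t. Y (?m + t *\<^sub>R v)) has_vector_derivative S ?m v) (at 0)" by simp
  fix t
  obtain c d where v: "v = c *\<^sub>R u + d *\<^sub>R Y u" using assms(3) span_pair by blast
  have "?m + t *\<^sub>R v = (a + t * c) *\<^sub>R u + (b + t * d) *\<^sub>R Y u"
    by (simp add: v algebra_simps)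
  then show "Y (?m + t *\<^sub>R v) \<in> span {u, Y u}" using plane_invariant by simp
qed

text \<open>A skew map that preserves a plane preserves the symplectic complement of the plane.\<close>

lemma S_complement:
  assumes "u \<noteq> 0" "(a, b) \<noteq> (0, 0)" "omega u y = 0" "omega (Y u) y = 0"
  shows "omega u (S (a *\<^sub>R u + b *\<^sub>R Y u) y) = 0" "omega (Y u) (S (a *\<^sub>R u + b *\<^sub>R Y u) y) = 0"
proof -
  let ?m = "a *\<^sub>R u + b *\<^sub>R Y u"
  have m: "?m \<noteq> 0" using plane_nonzero assms by blast
  have "omega v (S ?m y) = 0" if "v \<in> span {u, Y u}" for v
  proof -
    have "omega (S ?m v) y = 0"
      using S_plane[OF assms(1,2) that] assms(3,4)
      unfolding mem_span_pair_iff_symplectic[OF plane_symplectic'[OF assms(1)]] by blast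
    then show ?thesis using hamiltonian[OF m, of v y] by simp
  qed
  then show "omega u (S ?m y) = 0" "omega (Y u) (S ?m y) = 0" by (simp_all add: span_base)
qed

lemma S_complement_base:
  assumes "u \<noteq> 0" "omega u y = 0" "omega (Y u) y = 0"
  shows "omega u (S u y) = 0" "omega (Y u) (S u y) = 0"
  using S_complement[of u 1 0 y] assms by simp_all

text \<open>Differentiate \<open>Y (a u + b Y u) \<in> span {u, Y u}\<close> in a direction \<open>x\<close> that moves the plane itself.\<close>

lemma transverse_derivative:
  assumes u: "u \<noteq> 0" "(a, b) \<noteq> (0, 0)" and Ym: "Y (a *\<^sub>R u + b *\<^sub>R Y u) = c *\<^sub>R u + d *\<^sub>R Y u"
    and y: "omega u y = 0" "omega (Y u) y = 0"
  shows "omega (S (a *\<^sub>R u + b *\<^sub>R Y u) (a *\<^sub>R x + b *\<^sub>R S u x)) y = c * omega x y + d * omega (S u x) y"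
proof -
  let ?p = "\<lambda>t. u + t *\<^sub>R x"
  have q: "((\<lambda>t. Y (?p t)) has_vector_derivative S u x) (at 0)"
    using Y_vector_derivative[OF has_vector_derivative_line[of u x 0]] u(1) by simp
  have m: "((\<lambda>t. a *\<^sub>R ?p t + b *\<^sub>R Y (?p t)) has_vector_derivative a *\<^sub>R x + b *\<^sub>R S u x) (at 0)"
    by (intro has_vector_derivative_add bounded_linear.has_vector_derivative[OF bounded_linear_scaleR_right]
        has_vector_derivative_line q)
  show ?thesis
  proof (rule variation_in_moving_plane[where p = ?p and q = "\<lambda>t. Y (?p t)"
        and D = "\<lambda>t. Y (a *\<^sub>R ?p t + b *\<^sub>R Y (?p t))"])
    show "((\<lambda>t. Y (a *\<^sub>R ?p t + b *\<^sub>R Y (?p t))) has_vector_derivative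
        S (a *\<^sub>R u + b *\<^sub>R Y u) (a *\<^sub>R x + b *\<^sub>R S u x)) (at 0)"
      using Y_vector_derivative[OF m] plane_nonzero[OF u] by simp
  qed (use assms plane_symplectic' q has_vector_derivative_line plane_invariant in auto)
qed

text \<open>By \<open>transverse_derivative\<close> the form \<open>omega (S m \<cdot>) \<cdot>\<close> at the point \<open>m = a u + b Y u\<close> is expressed by
  \<open>S u\<close>; its symmetry at \<open>m\<close> and at \<open>u\<close> leaves only this relation between the coordinates of \<open>m\<close> and
  of \<open>Y m\<close>.\<close>

lemma transverse_relation:
  assumes u: "u \<noteq> 0" "(a, b) \<noteq> (0, 0)" and Ym: "Y (a *\<^sub>R u + b *\<^sub>R Y u) = c *\<^sub>R u + d *\<^sub>R Y u"
    and x: "omega u x = 0" "omega (Y u) x = 0" and y: "omega u y = 0" "omega (Y u) y = 0"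
  shows "a * c * omega x y + b * d * omega (S u x) (S u y) = 0"
proof -
  let ?m = "a *\<^sub>R u + b *\<^sub>R Y u"
  let ?P = "a *\<^sub>R x + b *\<^sub>R S u x" and ?Q = "a *\<^sub>R y + b *\<^sub>R S u y"
  have P: "omega u ?P = 0" "omega (Y u) ?P = 0" and Q: "omega u ?Q = 0" "omega (Y u) ?Q = 0"
    using x y S_complement_base[OF u(1)] by (simp_all add: symplectic_simps)
  have "omega (S ?m ?P) ?Q = c * omega x ?Q + d * omega (S u x) ?Q"
    by (rule transverse_derivative[OF u Ym Q])
  moreover have "omega (S ?m ?Q) ?P = c * omega y ?P + d * omega (S u y) ?P"
    by (rule transverse_derivative[OF u Ym P])
  moreover have "omega (S ?m ?P) ?Q = omega (S ?m ?Q) ?P"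
    using hamiltonian[OF plane_nonzero[OF u], of ?P ?Q] symplectic_skew[of ?P "S ?m ?Q"] by simp
  moreover have "omega (S u x) y = - omega x (S u y)" "omega (S u y) x = - omega y (S u x)"
    using hamiltonian[OF u(1)] by blast+
  moreover have "omega (S u x) y = - omega y (S u x)" "omega y x = - omega x y"
    "omega (S u y) (S u x) = - omega (S u x) (S u y)"
    by (rule symplectic_skew)+
  ultimately show ?thesis by (simp add: symplectic_simps algebra_simps)
qed


lemma plane_coordinates:
  obtains c d where "Y (a *\<^sub>R u + b *\<^sub>R Y u) = c *\<^sub>R u + d *\<^sub>R Y u"
  using plane_invariant span_pair by blast

lemma coordinates_positive:
  assumes u: "u \<noteq> 0" "(a, b) \<noteq> (0, 0)" and Ym: "Y (a *\<^sub>R u + b *\<^sub>R Y u) = c *\<^sub>R u + d *\<^sub>R Y u"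
  shows "d * a - c * b > 0"
proof -
  have "0 < omega (Y (a *\<^sub>R u + b *\<^sub>R Y u)) (a *\<^sub>R u + b *\<^sub>R Y u)"
    by (rule energy_pos[OF plane_nonzero[OF u]])
  also have "\<dots> = (c * b - d * a) * omega u (Y u)"
    using symplectic_skew[of "Y u" u] by (simp add: Ym symplectic_simps algebra_simps)
  finally show ?thesis using plane_symplectic[OF u(1)] by (simp add: zero_less_mult_iff)
qed

text \<open>The relation says that \<open>Y m\<close> is conjugate to \<open>m\<close> for the quadratic form \<open>a\<^sup>2 + k b\<^sup>2\<close> on the plane. The form
  must be definite, because on a null direction \<open>Y m\<close> would be a multiple of \<open>m\<close>, which contradicts
  \<open>omega (Y m) m > 0\<close>.\<close>

lemma conic_constant:
  assumes u: "u \<noteq> 0"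
  obtains k where "k > 0" "\<And>a b c d. (a, b) \<noteq> (0, 0) \<Longrightarrow>
    Y (a *\<^sub>R u + b *\<^sub>R Y u) = c *\<^sub>R u + d *\<^sub>R Y u \<Longrightarrow> a * c + k * b * d = 0"
proof -
  have "omega u (Y u) \<noteq> 0" by (rule plane_symplectic'[OF u])
  from symplectic_complement_pair[OF dim this] obtain x y where
    xy: "omega u x = 0" "omega (Y u) x = 0" "omega u y = 0" "omega (Y u) y = 0" "omega x y \<noteq> 0"
    by metis
  define k where "k = omega (S u x) (S u y) / omega x y"
  have rel: "a * c + k * b * d = 0"
    if "(a, b) \<noteq> (0, 0)" "Y (a *\<^sub>R u + b *\<^sub>R Y u) = c *\<^sub>R u + d *\<^sub>R Y u" for a b c d
    using transverse_relation[OF u that xy(1-4)] xy(5) by (simp add: k_def field_simps)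
  have "k > 0"
  proof (rule ccontr)
    assume "\<not> k > 0"
    show False
    proof (cases "k = 0")
      case False
      with \<open>\<not> k > 0\<close> have k: "k < 0" by simp
      \<comment> \<open>The vector with coordinates \<open>(r, 1)\<close> is a null vector of \<open>a\<^sup>2 + k b\<^sup>2\<close>.\<close>
      define r where "r = sqrt (- k)"
      have r: "r > 0" "r * r = - k" using k by (simp_all add: r_def)
      obtain c d where cd: "Y (r *\<^sub>R u + 1 *\<^sub>R Y u) = c *\<^sub>R u + d *\<^sub>R Y u"
        using plane_coordinates by blast
      have "r * c + k * 1 * d = 0" by (rule rel[OF _ cd]) simp
      moreover have "k = - (r * r)" using r by simp
      ultimately have "r * (c - r * d) = 0" by (simp add: algebra_simps)
      then have "c = d * r" using r by simp
      then show False using coordinates_positive[OF u _ cd] by simp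
    next
      case k0: True
      \<comment> \<open>For \<open>k = 0\<close> the null direction is \<open>Y u\<close> itself. The relation says nothing there and is used
        at the neighbouring vectors \<open>t u + Y u\<close>.\<close>
      define f where "f = (\<lambda>t. omega (Y (t *\<^sub>R u + Y u)) (Y u))"
      have f0: "f t = 0" if t: "t \<noteq> 0" for t
      proof -
        obtain c d where cd: "Y (t *\<^sub>R u + 1 *\<^sub>R Y u) = c *\<^sub>R u + d *\<^sub>R Y u"
          using plane_coordinates by blast
        have "t * c + k * 1 * d = 0" by (rule rel[OF _ cd]) simp
        then have "c = 0" using t k0 by simp
        then show ?thesis using cd by (simp add: f_def symplectic_simps)
      qed
      have "Y u \<noteq> 0" using plane_nonzero[OF u, of 0 1] by simp
      have "((\<lambda>t. Y (Y u + t *\<^sub>R u)) has_vector_derivative S (Y u + 0 *\<^sub>R u) u) (at 0)"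
        by (rule Y_vector_derivative[OF has_vector_derivative_line]) (use \<open>Y u \<noteq> 0\<close> in simp)
      then have "isCont (\<lambda>t. Y (Y u + t *\<^sub>R u)) 0"
        by (rule has_vector_derivative_continuous)
      then have "isCont f 0"
        unfolding f_def symplectic_form_eq_inner
        by (intro continuous_intros bounded_linear.isCont[OF bounded_linear_J]) (simp add: add.commute)
      then have "f \<midarrow>0\<rightarrow> f 0" by (simp add: isCont_def)
      moreover have "f \<midarrow>0\<rightarrow> 0"
        by (rule tendsto_eventually) (auto simp: eventually_at f0 intro!: exI[of _ 1])
      ultimately have f00: "f 0 = 0" by (rule LIM_unique)
      obtain c d where cd: "Y (0 *\<^sub>R u + 1 *\<^sub>R Y u) = c *\<^sub>R u + d *\<^sub>R Y u"
        using plane_coordinates by blast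
      have "f 0 = c * omega u (Y u)" using cd by (simp add: f_def symplectic_simps)
      then have "c = 0" using f00 plane_symplectic'[OF u] by simp
      then show False using coordinates_positive[OF u _ cd] by simp
    qed
  qed
  with rel that show ?thesis by blast
qed

text \<open>Since \<open>dG = omega (Y \<cdot>) \<cdot>\<close>, the relation of \<open>conic_constant\<close> states that \<open>G\<close> is constant along the ellipses
  \<open>a\<^sup>2 + k b\<^sup>2 = const\<close>. By homogeneity \<open>G\<close> is then a multiple of this quadratic form on the plane.\<close>

lemma linear_on_plane:
  assumes u: "u \<noteq> 0"
  obtains k where "k > 0" "\<And>a b. Y (a *\<^sub>R u + b *\<^sub>R Y u) = (- k * b) *\<^sub>R u + a *\<^sub>R Y u"
proof -
  obtain k where k: "k > 0" and rel: "\<And>a b c d. (a, b) \<noteq> (0, 0) \<Longrightarrow>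
    Y (a *\<^sub>R u + b *\<^sub>R Y u) = c *\<^sub>R u + d *\<^sub>R Y u \<Longrightarrow> a * c + k * b * d = 0"
    using conic_constant[OF u] by metis
  define r where "r = sqrt k"
  have r: "r > 0" "r * r = k" "r \<noteq> 0" using k by (simp_all add: r_def)
  define m where "m = (\<lambda>t. cos t *\<^sub>R u + (sin t / r) *\<^sub>R Y u)"
  define m' where "m' = (\<lambda>t. (- sin t) *\<^sub>R u + (cos t / r) *\<^sub>R Y u)"
  have nz: "(cos t, sin t / r) \<noteq> (0, 0)" for t
    using sin_zero_norm_cos_one[of t] r(3) by auto
  have m0: "m t \<noteq> 0" for t unfolding m_def by (rule plane_nonzero[OF u nz])
  have dm: "(m has_vector_derivative m' t) (at t)" for t
    unfolding m_def m'_def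
    by (intro has_vector_derivative_add)
      (use r(3) in \<open>auto intro!: derivative_eq_intros simp: has_vector_derivative_def\<close>)
  define e where "e = (\<lambda>t. omega (Y (m t)) (m t))"
  have tangent: "omega (Y (m t)) (m' t) = 0" for t
  proof -
    obtain c d where cd: "Y (cos t *\<^sub>R u + (sin t / r) *\<^sub>R Y u) = c *\<^sub>R u + d *\<^sub>R Y u"
      using plane_coordinates by blast
    have "cos t * c + k * (sin t / r) * d = 0" by (rule rel[OF nz cd])
    moreover have "cos t * c + k * (sin t / r) * d = r * (cos t * c / r + sin t * d)"
      unfolding r(2)[symmetric] using r(3) by (simp add: field_simps)
    ultimately have "cos t * c / r + sin t * d = 0" using r(3) by simp
    moreover have "omega (Y (m t)) (m' t) = (cos t * c / r + sin t * d) * omega u (Y u)"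
      unfolding m_def cd m'_def using symplectic_skew[of "Y u" u]
      by (simp add: symplectic_simps algebra_simps)
    ultimately show ?thesis by simp
  qed
  have "(e has_vector_derivative omega (Y (m t)) (m' t) + omega (S (m t) (m' t)) (m t)) (at t)" for t
    unfolding e_def by (intro symplectic.has_vector_derivative dm Y_vector_derivative m0)
  moreover have "omega (S (m t) (m' t)) (m t) = omega (Y (m t)) (m' t)" for t
    using hamiltonian[OF m0, of t "m' t" "m t"] S_self[OF m0, of t] symplectic_skew[of "m' t" "Y (m t)"]
    by simp
  ultimately have "(e has_real_derivative 0) (at t)" for t
    by (simp add: tangent has_real_derivative_iff_has_vector_derivative)
  then have e: "e t = e 0" for t using DERIV_isconst_all by blast
  have circle: "Y (cos t *\<^sub>R u + (sin t / r) *\<^sub>R Y u) = (- k * (sin t / r)) *\<^sub>R u + cos t *\<^sub>R Y u" for t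
  proof -
    define a b where "a = cos t" and "b = sin t / r"
    have nrm: "a * a + k * b * b = 1"
      using r sin_cos_squared_add3[of t] by (auto simp: a_def b_def field_simps)
    obtain c d where cd: "Y (a *\<^sub>R u + b *\<^sub>R Y u) = c *\<^sub>R u + d *\<^sub>R Y u"
      using plane_coordinates by blast
    have 1: "a * c + k * b * d = 0" using rel[OF _ cd] nz by (simp add: a_def b_def)
    have "e t = (c * b - d * a) * omega u (Y u)"
      using cd symplectic_skew[of "Y u" u]
      by (simp add: e_def m_def a_def b_def symplectic_simps algebra_simps)
    moreover have "e 0 = - omega u (Y u)"
      using symplectic_skew[of "Y u" u] by (simp add: e_def m_def)
    ultimately have "(c * b - d * a + 1) * omega u (Y u) = 0" using e[of t] by (simp add: algebra_simps)
    then have 2: "d * a - c * b = 1" using plane_symplectic'[OF u] by simp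
    have "d = d * (a * a + k * b * b) - b * (a * c + k * b * d)" by (simp add: nrm 1)
    also have "\<dots> = a * (d * a - c * b)" by (simp add: algebra_simps)
    finally have d: "d = a" by (simp add: 2)
    have "c = c * (a * a + k * b * b) - a * (a * c + k * b * d)" by (simp add: nrm 1)
    also have "\<dots> = - k * b * (d * a - c * b)" by (simp add: algebra_simps)
    finally have c: "c = - k * b" by (simp add: 2)
    show ?thesis using cd unfolding c d a_def b_def .
  qed
  have "Y (a *\<^sub>R u + b *\<^sub>R Y u) = (- k * b) *\<^sub>R u + a *\<^sub>R Y u" for a b
  proof (cases "(a, b) = (0, 0)")
    case False
    have "(a, r * b) \<noteq> (0, 0)" using False r(3) by simp
    then obtain s t where st: "a = s * cos t" "r * b = s * sin t" by (rule polar_coordinates)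
    have "b = s * (sin t / r)" using st(2) r(3) by (simp add: field_simps)
    note ab = st(1) this
    have "a *\<^sub>R u + b *\<^sub>R Y u = s *\<^sub>R (cos t *\<^sub>R u + (sin t / r) *\<^sub>R Y u)"
      by (simp add: ab scaleR_add_right)
    then have "Y (a *\<^sub>R u + b *\<^sub>R Y u) = s *\<^sub>R ((- k * (sin t / r)) *\<^sub>R u + cos t *\<^sub>R Y u)"
      by (simp only: homogeneous circle)
    then show ?thesis by (simp add: ab algebra_simps)
  qed simp
  with k that show ?thesis by blast
qed

text \<open>The constant \<open>k\<close> of \<open>linear_on_plane\<close>, written as a differentiable function of \<open>u\<close>.\<close>

definition frequency :: "'n phase_space \<Rightarrow> real" where
  "frequency u = - (Y (Y u) \<bullet> u) / (u \<bullet> u)"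

lemma frequency:
  assumes u: "u \<noteq> 0"
  shows "frequency u > 0" "Y (a *\<^sub>R u + b *\<^sub>R Y u) = (- frequency u * b) *\<^sub>R u + a *\<^sub>R Y u"
proof -
  obtain k where k: "k > 0" and Y: "\<And>a b. Y (a *\<^sub>R u + b *\<^sub>R Y u) = (- k * b) *\<^sub>R u + a *\<^sub>R Y u"
    using linear_on_plane[OF u] by metis
  have "Y (Y u) = (- k) *\<^sub>R u" using Y[of 0 1] by simp
  then have "frequency u = k" using u by (simp add: frequency_def)
  with k Y show "frequency u > 0"
    "Y (a *\<^sub>R u + b *\<^sub>R Y u) = (- frequency u * b) *\<^sub>R u + a *\<^sub>R Y u" by simp_all
qed

lemma Y_Y: "u \<noteq> 0 \<Longrightarrow> Y (Y u) = (- frequency u) *\<^sub>R u"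
  using frequency(2)[of u 0 1] by simp

text \<open>On the symplectic complement of the plane this follows from \<open>transverse_relation\<close> at \<open>a = b = 1\<close>, which
  says that \<open>S u\<close> multiplies the symplectic form by \<open>frequency u\<close>. On the plane \<open>Y\<close> is linear and
  \<open>S u\<close> agrees with \<open>Y\<close>.\<close>

lemma S_squared:
  assumes u: "u \<noteq> 0"
  shows "S u (S u x) = (- frequency u) *\<^sub>R x"
proof -
  let ?k = "frequency u"
  note lin = linear_S[OF u]
  have 1: "S u (S u y) = (- ?k) *\<^sub>R y" if y: "omega u y = 0" "omega (Y u) y = 0" for y
  proof -
    note c1 = S_complement_base[OF u y]
    note c2 = S_complement_base[OF u c1]
    have "S u (S u y) + ?k *\<^sub>R y = 0"
    proof (rule symplectic_complement_nondegenerate[OF plane_symplectic'[OF u]])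
      show "omega u (S u (S u y) + ?k *\<^sub>R y) = 0" "omega (Y u) (S u (S u y) + ?k *\<^sub>R y) = 0"
        using y c2 by (simp_all add: symplectic_simps)
      fix z assume z: "omega u z = 0" "omega (Y u) z = 0"
      have "1 * (- ?k * 1) * omega y z + 1 * 1 * omega (S u y) (S u z) = 0"
        by (rule transverse_relation[OF u _ frequency(2)[OF u] y z]) simp
      then show "omega (S u (S u y) + ?k *\<^sub>R y) z = 0"
        using hamiltonian[OF u, of "S u y" z] by (simp add: symplectic_simps)
    qed
    then show ?thesis by (simp add: eq_neg_iff_add_eq_0)
  qed
  have 2: "S u (Y u) = (- ?k) *\<^sub>R u"
  proof (rule S_along_line[OF u])
    have eq: "(\<lambda>t. Y (u + t *\<^sub>R Y u)) = (\<lambda>t. Y u + t *\<^sub>R ((- ?k) *\<^sub>R u))"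
      using frequency(2)[OF u, of 1] by (auto simp: algebra_simps)
    show "((\<lambda>t. Y (u + t *\<^sub>R Y u)) has_vector_derivative (- ?k) *\<^sub>R u) (at 0)"
      unfolding eq by (rule has_vector_derivative_line)
  qed
  obtain a b y where x: "x = a *\<^sub>R u + b *\<^sub>R Y u + y" and y: "omega u y = 0" "omega (Y u) y = 0"
    using symplectic_decomposition[OF plane_symplectic'[OF u]] by metis
  have Sx: "S u x = a *\<^sub>R Y u + (b * - ?k) *\<^sub>R u + S u y"
    by (simp add: x linear_add[OF lin] linear_scale[OF lin] linear_neg[OF lin] S_self[OF u] 2)
  show ?thesis
    by (simp only: Sx linear_add[OF lin] linear_scale[OF lin] S_self[OF u] 2 1[OF y])
      (simp add: x algebra_simps)
qed

text \<open>Along the plane the frequency does not change. Differentiating \<open>Y (Y v) = - frequency v \<cdot> v\<close> in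
  a direction of the symplectic complement gives an element of the complement plus a multiple of
  \<open>u\<close>, and this multiple has to vanish.\<close>

lemma frequency_derivative_zero:
  assumes u: "u \<noteq> 0"
  shows "(frequency has_derivative (\<lambda>_. 0)) (at u)"
proof -
  have Yu: "Y u \<noteq> 0" using plane_nonzero[OF u, of 0 1] by simp
  have dYY: "((\<lambda>v. Y (Y v)) has_derivative (\<lambda>h. S (Y u) (S u h))) (at u)"
    using diff_chain_at[OF derivative[OF u] derivative[OF Yu]] by (simp add: o_def)
  have "\<exists>K. (frequency has_derivative K) (at u)"
    unfolding frequency_def
    using has_derivative_divide[OF has_derivative_minus[OF has_derivative_inner[OF dYY has_derivative_ident]]
        has_derivative_inner[OF has_derivative_ident has_derivative_ident]] u by (simp add: exI)
  then obtain K where K: "(frequency has_derivative K) (at u)" by blast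
  have lin: "linear K" using K has_derivative_bounded_linear bounded_linear.linear by blast
  have "((\<lambda>v. (- frequency v) *\<^sub>R v) has_derivative (\<lambda>h. (- frequency u) *\<^sub>R h + (- K h) *\<^sub>R u)) (at u)"
    by (intro has_derivative_scaleR has_derivative_minus K has_derivative_ident)
  then have "((\<lambda>v. Y (Y v)) has_derivative (\<lambda>h. (- frequency u) *\<^sub>R h + (- K h) *\<^sub>R u)) (at u)"
    by (rule has_derivative_transform_within_open[where s = "- {0}"]) (use u Y_Y in auto)
  then have eq: "S (Y u) (S u h) = (- frequency u) *\<^sub>R h + (- K h) *\<^sub>R u" for h
    using fun_cong[OF has_derivative_unique[OF dYY]] by blast
  have 1: "K y = 0" if y: "omega u y = 0" "omega (Y u) y = 0" for y
  proof -
    note c1 = S_complement_base[OF u y]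
    have "omega (Y u) (S (Y u) (S u y)) = 0" using S_complement(2)[OF u _ c1, of 0 1] by simp
    then have "K y * omega (Y u) u = 0" using y by (simp add: eq symplectic_simps)
    then show ?thesis using energy_pos[OF u] by simp
  qed
  have 2: "K v = 0" if v: "v = a *\<^sub>R u + b *\<^sub>R Y u" for v a b
  proof -
    have d: "((\<lambda>t. frequency (u + t *\<^sub>R v)) has_vector_derivative K v) (at 0)"
      using has_vector_derivative_compose[OF has_vector_derivative_line, of frequency K u 0 v] K by simp
    have "frequency (u + t *\<^sub>R v) = frequency u" if nz: "u + t *\<^sub>R v \<noteq> 0" for t
    proof -
      have m: "u + t *\<^sub>R v = (1 + t * a) *\<^sub>R u + (t * b) *\<^sub>R Y u" by (simp add: v algebra_simps)
      have Ym: "Y (u + t *\<^sub>R v) = (- frequency u * (t * b)) *\<^sub>R u + (1 + t * a) *\<^sub>R Y u"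
        unfolding m by (rule frequency(2)[OF u])
      have "Y (Y (u + t *\<^sub>R v)) = (- frequency u) *\<^sub>R (u + t *\<^sub>R v)"
        unfolding Ym frequency(2)[OF u] unfolding m by (simp add: algebra_simps)
      then show ?thesis using Y_Y[OF nz] nz by simp
    qed
    then have "((\<lambda>t. frequency u) has_vector_derivative K v) (at 0)"
      by (intro has_vector_derivative_transform_within_open[OF d, of "{t. u + t *\<^sub>R v \<noteq> 0}"]
          open_Collect_neq continuous_intros) (use u in auto)
    then show ?thesis using vector_derivative_unique_at has_vector_derivative_const by blast
  qed
  have "K h = 0" for h
  proof -
    obtain a b y where h: "h = (a *\<^sub>R u + b *\<^sub>R Y u) + y" and y: "omega u y = 0" "omega (Y u) y = 0"
      using symplectic_decomposition[OF plane_symplectic'[OF u]] by metis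
    show ?thesis unfolding h using linear_add[OF lin, of _ y] 1[OF y] 2[OF refl] by simp
  qed
  then show ?thesis using K by (metis (no_types, lifting) ext)
qed

lemma frequency_constant:
  obtains k where "k > 0" "\<And>u. u \<noteq> 0 \<Longrightarrow> frequency u = k"
proof -
  have "connected (- {0 :: 'n phase_space})"
    by (rule connected_complement_bounded_convex) (use dim in auto)
  then have "frequency u = frequency w" if "u \<noteq> 0" "w \<noteq> 0" for u w
    using has_derivative_zero_unique_connected[of "- {0}" frequency u w] that
      frequency_derivative_zero by auto
  moreover obtain w :: "'n phase_space" where "w \<noteq> 0" using nonempty_Basis nonzero_Basis by blast
  ultimately show ?thesis using that[of "frequency w"] frequency(1) by blast
qed

end

section \<open>Linearity by Liouville's theorem\<close>

text \<open>The hypotheses are the Cauchy-Riemann equations for \<open>g1 + \<i> g2\<close>; an entire function of linear growth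
  is affine.\<close>

lemma conjugate_pair_affine:
  fixes g1 g2 :: "complex \<Rightarrow> real"
  assumes d: "\<And>z. \<exists>p q. (g1 has_derivative (\<lambda>h. p * Re h + q * Im h)) (at z) \<and>
      (g2 has_derivative (\<lambda>h. p * Im h - q * Re h)) (at z)"
    and M: "\<And>z. \<bar>g1 z\<bar> \<le> M * (1 + norm z)" "\<And>z. \<bar>g2 z\<bar> \<le> M * (1 + norm z)"
  shows "\<exists>s. \<forall>x. g1 (of_real x) = g1 0 + x * s" "\<exists>s. \<forall>x. g2 (of_real x) = g2 0 + x * s"
proof -
  define f where "f = (\<lambda>z. of_real (g1 z) + \<i> * of_real (g2 z))"
  have "f field_differentiable (at z)" for z
  proof -
    obtain p q where g: "(g1 has_derivative (\<lambda>h. p * Re h + q * Im h)) (at z)"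
      "(g2 has_derivative (\<lambda>h. p * Im h - q * Re h)) (at z)" using d by blast
    have "(f has_derivative (\<lambda>h. of_real (p * Re h + q * Im h) + \<i> * of_real (p * Im h - q * Re h))) (at z)"
      unfolding f_def
      by (intro has_derivative_add has_derivative_mult_right bounded_linear.has_derivative[OF bounded_linear_of_real] g)
    moreover have "(\<lambda>h. of_real (p * Re h + q * Im h) + \<i> * of_real (p * Im h - q * Re h)) = (*) (Complex p (- q))"
      by (auto simp: complex_eq_iff algebra_simps)
    ultimately show ?thesis
      unfolding field_differentiable_def has_field_derivative_def by metis
  qed
  then have hol: "f holomorphic_on UNIV" by (simp add: holomorphic_on_def field_differentiable_at_within)
  have M0: "M \<ge> 0" using M(1)[of 0] by simp
  have growth: "norm (f z) \<le> (4 * M) * norm z ^ 1" if z: "1 \<le> norm z" for z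
  proof -
    have "norm (f z) \<le> norm (complex_of_real (g1 z)) + norm (\<i> * complex_of_real (g2 z))"
      unfolding f_def by (rule norm_triangle_ineq)
    also have "\<dots> \<le> 2 * (M * (1 + norm z))" using M[of z] by (simp add: norm_mult)
    also have "\<dots> \<le> 2 * (M * (2 * norm z))"
      by (intro mult_left_mono) (use z M0 in auto)
    finally show ?thesis by simp
  qed
  define c where "c = deriv f 0"
  have f: "f z = f 0 + c * z" for z
    using Liouville_polynomial[OF hol growth, of 1 z] by (simp add: c_def)
  have g: "g1 z = Re (f z)" "g2 z = Im (f z)" for z by (simp_all add: f_def)
  have "\<forall>x. g1 (of_real x) = g1 0 + x * Re c" "\<forall>x. g2 (of_real x) = g2 0 + x * Im c"
    unfolding g by (auto simp: f[of "of_real _"])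
  then show "\<exists>s. \<forall>x. g1 (of_real x) = g1 0 + x * s" "\<exists>s. \<forall>x. g2 (of_real x) = g2 0 + x * s" by blast+
qed

text \<open>If \<open>f (a + x b) = f a + x s\<close>, homogeneity and continuity at \<open>b\<close> give \<open>s = f b\<close>. The pairs with
  \<open>a\<close> in the complex line of \<open>b\<close> are limits of others because the complex dimension exceeds 1.\<close>

lemma linear_if_affine_on_complex_lines:
  fixes f :: "'n::finite phase_space \<Rightarrow> real"
  assumes dim: "CARD('n) \<ge> 2"
    and cont: "continuous_on UNIV f" and hom: "\<And>r u. f (r *\<^sub>R u) = r * f u"
    and aff: "\<And>a b. a \<notin> span {b, J b} \<Longrightarrow> \<exists>s. \<forall>x. f (a + x *\<^sub>R b) = f a + x * s"
  shows "linear f"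
proof -
  have tend: "(\<lambda>n. f (b + (1 / real (Suc n)) *\<^sub>R c)) \<longlonglongrightarrow> f b" for b c
  proof -
    have "(\<lambda>n. b + (1 / real (Suc n)) *\<^sub>R c) \<longlonglongrightarrow> b + 0 *\<^sub>R c"
      by (intro tendsto_intros LIMSEQ_Suc lim_1_over_n)
    moreover have "isCont f (b + 0 *\<^sub>R c)"
      using cont by (metis UNIV_I continuous_on_eq_continuous_at open_UNIV)
    ultimately have "(\<lambda>n. f (b + (1 / real (Suc n)) *\<^sub>R c)) \<longlonglongrightarrow> f (b + 0 *\<^sub>R c)"
      by (rule isCont_tendsto_compose[rotated])
    then show ?thesis by simp
  qed
  have 1: "f (a + b) = f a + f b" if "a \<notin> span {b, J b}" for a b
  proof -
    obtain s where s: "\<And>x. f (a + x *\<^sub>R b) = f a + x * s" using aff \<open>a \<notin> _\<close> by blast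
    have "f (b + (1 / real (Suc n)) *\<^sub>R a) = (1 / real (Suc n)) * f a + s" for n
    proof -
      have "b + (1 / real (Suc n)) *\<^sub>R a = (1 / real (Suc n)) *\<^sub>R (a + real (Suc n) *\<^sub>R b)"
        by (simp add: scaleR_add_right)
      then show ?thesis by (simp only: hom s) (simp add: field_simps)
    qed
    moreover have "(\<lambda>n. (1 / real (Suc n)) * f a + s) \<longlonglongrightarrow> 0 * f a + s"
      by (intro tendsto_intros LIMSEQ_Suc lim_1_over_n)
    ultimately have "(\<lambda>n. f (b + (1 / real (Suc n)) *\<^sub>R a)) \<longlonglongrightarrow> s" by simp
    then have "s = f b" using tend[of b a] LIMSEQ_unique by blast
    then show ?thesis using s[of 1] by simp
  qed
  have "f (a + b) = f a + f b" for a b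
  proof -
    have "dim {b, J b} \<le> card {b, J b}" by (rule dim_le_card') simp
    also have "\<dots> \<le> 2" by (simp add: card_insert_if)
    also have "\<dots> < DIM('n phase_space)" using dim by simp
    finally have "dim {b, J b} < DIM('n phase_space)" .
    then have "span {b, J b} \<noteq> UNIV" by (metis dim_UNIV dim_span less_irrefl)
    then obtain c where c: "c \<notin> span {b, J b}" by blast
    show ?thesis
    proof (cases "a \<in> span {b, J b}")
      case True
      have "a + (1 / real (Suc n)) *\<^sub>R c \<notin> span {b, J b}" for n
      proof
        assume "a + (1 / real (Suc n)) *\<^sub>R c \<in> span {b, J b}"
        then have "(1 / real (Suc n)) *\<^sub>R c \<in> span {b, J b}" using True span_add_eq by blast
        then have "real (Suc n) *\<^sub>R ((1 / real (Suc n)) *\<^sub>R c) \<in> span {b, J b}" by (rule span_scale)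
        then show False using c by simp
      qed
      then have "f ((a + b) + (1 / real (Suc n)) *\<^sub>R c) = f (a + (1 / real (Suc n)) *\<^sub>R c) + f b" for n
        using 1 by (metis (no_types, lifting) add.assoc add.commute)
      then have "(\<lambda>n. f (a + (1 / real (Suc n)) *\<^sub>R c) + f b) \<longlonglongrightarrow> f (a + b)"
        using tend[of "a + b" c] by simp
      moreover have "(\<lambda>n. f (a + (1 / real (Suc n)) *\<^sub>R c) + f b) \<longlonglongrightarrow> f a + f b"
        by (intro tendsto_intros tend)
      ultimately show ?thesis using LIMSEQ_unique by blast
    qed (rule 1)
  qed
  then show ?thesis by (intro linearI) (auto simp: hom)
qed

lemma homogeneous_bounded:
  fixes f :: "'a::euclidean_space \<Rightarrow> 'b::real_normed_vector"
  assumes cont: "continuous_on (sphere 0 1) f" and hom: "\<And>r u. f (r *\<^sub>R u) = r *\<^sub>R f u"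
  obtains M where "M \<ge> 0" "\<And>u. norm (f u) \<le> M * norm u"
proof -
  have "compact (f ` sphere 0 1)" by (intro compact_continuous_image cont) simp
  then obtain M where M: "M > 0" "\<And>u. u \<in> sphere 0 1 \<Longrightarrow> norm (f u) \<le> M"
    using compact_imp_bounded bounded_pos by (metis imageI)
  have "norm (f u) \<le> M * norm u" for u
  proof (cases "u = 0")
    case True then show ?thesis using hom[of 0 0] by simp
  next
    case False
    then have "norm (f (inverse (norm u) *\<^sub>R u)) \<le> M" by (intro M(2)) simp
    then show ?thesis using False by (simp add: hom field_simps)
  qed
  then show ?thesis using M that[of M] by simp
qed

context planar_hamiltonian_field
begin

lemma Y_bounded: obtains M where "M \<ge> 0" "\<And>u. norm (Y u) \<le> M * norm u"
proof -
  have "continuous_on (sphere 0 1) Y"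
  proof (intro continuous_at_imp_continuous_on ballI)
    fix u :: "'n phase_space" assume "u \<in> sphere 0 1"
    then have "u \<noteq> 0" by force
    then show "isCont Y u" using derivative has_derivative_continuous by blast
  qed
  from homogeneous_bounded[OF this homogeneous] that show ?thesis by blast
qed

lemma continuous_Y: "continuous_on UNIV Y"
proof -
  obtain M where M: "M \<ge> 0" "\<And>u. norm (Y u) \<le> M * norm u" using Y_bounded by blast
  have "isCont Y u" for u
  proof (cases "u = 0")
    case True
    have "(\<lambda>u :: 'n phase_space. M * norm u) \<midarrow>0\<rightarrow> M * norm (0 :: 'n phase_space)"
      by (rule tendsto_mult[OF tendsto_const tendsto_norm[OF tendsto_ident_at]])
    then have "(Y \<longlongrightarrow> 0) (at 0)"
      by (intro Lim_null_comparison[of Y "\<lambda>u. M * norm u"]) (use M in auto)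
    then show ?thesis by (simp add: isCont_def True)
  qed (use derivative has_derivative_continuous in blast)
  then show ?thesis by (simp add: continuous_on_eq_continuous_at)
qed

lemma S_nonneg:
  assumes u: "u \<noteq> 0"
  shows "omega (S u x) x \<ge> 0"
proof (rule ccontr)
  assume neg: "\<not> omega (S u x) x \<ge> 0"
  have "((\<lambda>t. omega (Y (u + t *\<^sub>R x)) x) has_vector_derivative
      omega (Y (u + 0 *\<^sub>R x)) 0 + omega (S (u + 0 *\<^sub>R x) x) x) (at 0)"
    by (intro symplectic.has_vector_derivative Y_vector_derivative has_vector_derivative_line
        has_vector_derivative_const) (use u in simp)
  then have "DERIV (\<lambda>t. omega (Y (u + t *\<^sub>R x)) x) 0 :> omega (S u x) x"
    by (simp add: has_real_derivative_iff_has_vector_derivative symplectic_simps)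
  from DERIV_neg_dec_right[OF this] neg obtain d where d: "d > 0"
    "\<And>h. 0 < h \<Longrightarrow> h < d \<Longrightarrow> omega (Y (u + h *\<^sub>R x)) x < omega (Y u) x" by auto
  have h: "0 < d / 2" "d / 2 < d" using d by auto
  have "x \<noteq> 0" using neg by (auto simp: symplectic_simps)
  then have "0 < omega (Y (u + (d / 2) *\<^sub>R x) - Y u) (u + (d / 2) *\<^sub>R x - u)"
    by (intro monotone) (use d in auto)
  also have "\<dots> = (d / 2) * (omega (Y (u + (d / 2) *\<^sub>R x)) x - omega (Y u) x)"
    by (simp add: symplectic_simps)
  finally show False using d(2)[OF h] d(1) by (simp add: zero_less_mult_iff)
qed

text \<open>The form \<open>omega (S u \<cdot>) \<cdot>\<close> is positive semidefinite by monotonicity and nondegenerate by \<open>S_squared\<close>.\<close>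

lemma S_definite:
  assumes u: "u \<noteq> 0" and x: "omega (S u x) x = 0"
  shows "x = 0"
proof -
  note lin = linear_S[OF u]
  have "omega (S u x) y = 0" for y
  proof (rule ccontr)
    assume nz: "omega (S u x) y \<noteq> 0"
    define p q where "p = omega (S u x) y" and "q = omega (S u y) y"
    have sym: "omega (S u y) x = p"
      using hamiltonian[OF u, of y x] symplectic_skew[of y "S u x"] by (simp add: p_def)
    define t where "t = - (q + 1) / (2 * p)"
    have "0 \<le> omega (S u (y + t *\<^sub>R x)) (y + t *\<^sub>R x)" by (rule S_nonneg[OF u])
    also have "\<dots> = q + 2 * t * p"
      by (simp add: linear_add[OF lin] linear_scale[OF lin] symplectic_simps sym x flip: p_def q_def)
    also have "\<dots> = - 1" using nz[folded p_def] by (simp add: t_def field_simps)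
    finally show False by simp
  qed
  then have "S u x = 0" by (rule symplectic_nondegenerate)
  then have "(- frequency u) *\<^sub>R x = 0" using S_squared[OF u, of x] linear_0[OF lin] by simp
  then show ?thesis using frequency(1)[OF u] by simp
qed

text \<open>\<open>J\<close> is the standard complex structure, and \<open>S u / \<surd>k\<close> is an almost complex structure by \<open>S_squared\<close>. The map
  \<open>F\<close> below intertwines the two, and so does its inverse \<open>U\<close>. The components of
  \<open>U - \<i> Y(U) / \<surd>k\<close> are holomorphic because \<open>DY\<close> is \<open>\<surd>k\<close> times the almost complex structure.\<close>

theorem linear_Y:
  obtains k where "k > 0" "linear Y" "\<And>u. Y (Y u) = (- k) *\<^sub>R u"
proof -
  obtain k where k: "k > 0" "\<And>u. u \<noteq> 0 \<Longrightarrow> frequency u = k" using frequency_constant by blast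
  define s where "s = sqrt k"
  have s: "s > 0" "s * s = k" using k by (simp_all add: s_def)
  \<comment> \<open>The partial Legendre transform. It is injective because \<open>fst = 0\<close> is a Lagrangian subspace, on
    which the symplectic form vanishes, whereas \<open>Y\<close> is strictly monotone.\<close>
  define F where "F = (\<lambda>u. (fst u, - ((1 / s) *\<^sub>R fst (Y u))))"
  have homF: "F (r *\<^sub>R u) = r *\<^sub>R F u" for r u
    by (simp add: F_def homogeneous prod_eq_iff)
  have lag: "omega x y = 0" if "fst x = 0" "fst y = 0" for x y :: "'n phase_space"
    by (simp add: symplectic_form_def that)
  have inj: "inj F"
  proof (rule injI, rule ccontr)
    fix u w assume F: "F u = F w" and "u \<noteq> w"
    then have "0 < omega (Y u - Y w) (u - w)" by (intro monotone)
    moreover have "omega (Y u - Y w) (u - w) = 0"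
      by (rule lag) (use F s in \<open>auto simp: F_def\<close>)
    ultimately show False by simp
  qed
  have contF: "continuous_on UNIV F"
    unfolding F_def by (intro continuous_intros continuous_on_fst continuous_Y continuous_on_id)
  \<comment> \<open>An open set that contains the origin and is closed under scaling is everything.\<close>
  have "open (range F)" by (rule invariance_of_domain[OF contF open_UNIV inj])
  moreover have "0 \<in> range F" using homF[of 0 0] by (metis rangeI scaleR_zero_left)
  ultimately obtain e where e: "e > 0" "ball 0 e \<subseteq> range F" by (rule openE)
  have surj: "surj F"
  proof -
    have "y \<in> range F" for y
    proof (cases "y = 0")
      case False
      define c where "c = e / (2 * norm y)"
      have c: "c > 0" using e False by (simp add: c_def)
      have "c *\<^sub>R y \<in> ball 0 e" using e False by (simp add: c_def)
      then obtain u where "F u = c *\<^sub>R y" using e(2) by (metis imageE subsetD)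
      then have "F ((1 / c) *\<^sub>R u) = y" using c by (simp add: homF)
      then show ?thesis by blast
    qed (use \<open>0 \<in> range F\<close> in simp)
    then show ?thesis by blast
  qed
  obtain U where U: "homeomorphism UNIV (range F) F U"
    using invariance_of_domain_homeomorphism[OF open_UNIV contF _ inj] by auto
  have contU: "continuous_on UNIV U" using U surj by (simp add: homeomorphism_def)
  have UF: "U (F u) = u" and FU: "F (U y) = y" for u y
    using U surj unfolding homeomorphism_def by blast+
  have homU: "U (r *\<^sub>R y) = r *\<^sub>R U y" for r y
    using UF[of "r *\<^sub>R U y"] by (simp add: homF FU)
  have U0: "U y \<noteq> 0" if "y \<noteq> 0" for y
    using FU[of y] that homF[of 0 0] by auto
  obtain M1 where M1: "M1 \<ge> 0" "\<And>y. norm (U y) \<le> M1 * norm y"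
    using homogeneous_bounded[OF continuous_on_subset[OF contU subset_UNIV] homU] by metis
  obtain M2 where M2: "M2 \<ge> 0" "\<And>u. norm (Y u) \<le> M2 * norm u" using Y_bounded by blast
  have dU: "\<exists>U'. (U has_derivative U') (at y) \<and> (\<forall>h. U' (J h) = (1 / s) *\<^sub>R S (U y) (U' h))"
    if y: "y \<noteq> 0" for y
  proof -
    define u where "u = U y"
    have u: "u \<noteq> 0" using U0[OF y] by (simp add: u_def)
    note lin = linear_S[OF u]
    define F' where "F' = (\<lambda>h. (fst h, - ((1 / s) *\<^sub>R fst (S u h))))"
    have dF: "(F has_derivative F') (at u)"
      unfolding F_def F'_def
      by (intro has_derivative_Pair has_derivative_minus has_derivative_scaleR_right
          has_derivative_fst derivative[OF u] has_derivative_ident)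
    have linF: "linear F'" using dF has_derivative_bounded_linear bounded_linear.linear by blast
    have injF: "inj F'"
    proof (subst linear_injective_0[OF linF], intro allI impI)
      fix h assume "F' h = 0"
      then have "fst h = 0" "fst (S u h) = 0" using s by (auto simp: F'_def prod_eq_iff)
      then show "h = 0" using S_definite[OF u] lag by blast
    qed
    obtain G where G: "linear G" "G \<circ> F' = id"
      using linear_injective_left_inverse[OF linF injF] by blast
    have FG: "F' (G h) = h" for h
    proof -
      obtain x where "h = F' x" using linear_injective_imp_surjective[OF linF injF] by (metis surjD)
      then show ?thesis using G(2) by (metis comp_apply id_apply)
    qed
    have GF: "G (F' h) = h" for h using G(2) by (metis comp_apply id_apply)
    have "(U has_derivative G) (at y)"
      by (rule has_derivative_inverse_basic[where T = UNIV and f = F and g = U and y = y and f' = F', OF dF[unfolded u_def]])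
        (use G FU contU[unfolded continuous_on_eq_continuous_at[OF open_UNIV], THEN bspec[OF _ UNIV_I]]
          in \<open>simp_all add: linear_conv_bounded_linear\<close>)
    moreover have "G (J h) = (1 / s) *\<^sub>R S u (G h)" for h
    proof -
      have SS: "S u ((1 / s) *\<^sub>R S u x) = (1 / s) *\<^sub>R ((- k) *\<^sub>R x)" for x
        using S_squared[OF u] k(2)[OF u] by (simp add: linear_scale[OF lin])
      have one: "(1 / s) * (1 / s) * k = 1" using s(1) unfolding s(2)[symmetric] by simp
      have "F' ((1 / s) *\<^sub>R S u x) = ((1 / s) *\<^sub>R fst (S u x), ((1 / s) * (1 / s) * k) *\<^sub>R fst x)" for x
        unfolding F'_def SS by simp
      then have "F' ((1 / s) *\<^sub>R S u x) = J (F' x)" for x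
        unfolding one by (simp add: F'_def complex_structure_def)
      then have "F' ((1 / s) *\<^sub>R S u (G h)) = J h" by (simp add: FG)
      then show ?thesis using GF by metis
    qed
    ultimately show ?thesis unfolding u_def by blast
  qed
  have aff: "\<exists>t. \<forall>x. U (a + x *\<^sub>R b) \<bullet> w = U a \<bullet> w + x * t"
    "\<exists>t. \<forall>x. Y (U (a + x *\<^sub>R b)) \<bullet> w = Y (U a) \<bullet> w + x * t" if ab: "a \<notin> span {b, J b}" for a b w
  proof -
    define g where "g = (\<lambda>z. a + Re z *\<^sub>R b + Im z *\<^sub>R J b)"
    have g0: "g z \<noteq> 0" for z
    proof
      assume "g z = 0"
      moreover have "a = g z + (- Re z) *\<^sub>R b + (- Im z) *\<^sub>R J b" by (simp add: g_def)
      ultimately have "a = (- Re z) *\<^sub>R b + (- Im z) *\<^sub>R J b" by simp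
      then show False using ab span_pair by blast
    qed
    define g1 where "g1 = (\<lambda>z. U (g z) \<bullet> w)"
    define g2 where "g2 = (\<lambda>z. - (1 / s) * (Y (U (g z)) \<bullet> w))"
    have d: "\<exists>p q. (g1 has_derivative (\<lambda>h. p * Re h + q * Im h)) (at z) \<and>
      (g2 has_derivative (\<lambda>h. p * Im h - q * Re h)) (at z)" for z
    proof -
      define u where "u = U (g z)"
      have u: "u \<noteq> 0" using U0 g0 by (simp add: u_def)
      note lin = linear_S[OF u]
      obtain U' where U': "(U has_derivative U') (at (g z))" "\<And>h. U' (J h) = (1 / s) *\<^sub>R S u (U' h)"
        using dU[OF g0] unfolding u_def by blast
      have linU: "linear U'" using U'(1) has_derivative_bounded_linear bounded_linear.linear by blast
      define d1 where "d1 = U' b"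
      have dg: "(g has_derivative (\<lambda>h. Re h *\<^sub>R b + Im h *\<^sub>R J b)) (at z)"
        unfolding g_def by (auto intro!: derivative_eq_intros)
      have dUg: "((\<lambda>z. U (g z)) has_derivative (\<lambda>h. U' (Re h *\<^sub>R b + Im h *\<^sub>R J b))) (at z)"
        using diff_chain_at[OF dg U'(1)] by (simp add: o_def)
      have e1: "U' (Re h *\<^sub>R b + Im h *\<^sub>R J b) = Re h *\<^sub>R d1 + (Im h / s) *\<^sub>R S u d1" for h
        by (simp add: linear_add[OF linU] linear_scale[OF linU] U'(2) d1_def)
      have dYUg: "((\<lambda>z. Y (U (g z))) has_derivative (\<lambda>h. S u (U' (Re h *\<^sub>R b + Im h *\<^sub>R J b)))) (at z)"
        using diff_chain_at[OF dUg derivative[OF u, unfolded u_def]] by (simp add: o_def u_def)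
      have e2: "S u (U' (Re h *\<^sub>R b + Im h *\<^sub>R J b)) = Re h *\<^sub>R S u d1 - (Im h * s) *\<^sub>R d1" for h
      proof -
        have "(Im h / s) * k = Im h * s" using s(1) unfolding s(2)[symmetric] by simp
        then show ?thesis
          using S_squared[OF u] k(2)[OF u] by (simp add: e1 linear_add[OF lin] linear_scale[OF lin])
      qed
      have 1: "(g1 has_derivative (\<lambda>h. (d1 \<bullet> w) * Re h + (S u d1 \<bullet> w / s) * Im h)) (at z)"
        unfolding g1_def
        by (rule has_derivative_eq_rhs[OF has_derivative_inner_left[OF dUg]])
          (simp add: e1 inner_add_left fun_eq_iff)
      have 2: "(g2 has_derivative (\<lambda>h. (d1 \<bullet> w) * Im h - (S u d1 \<bullet> w / s) * Re h)) (at z)"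
        unfolding g2_def
        by (rule has_derivative_eq_rhs[OF has_derivative_mult_right[OF has_derivative_inner_left[OF dYUg]]])
          (use s(1) in \<open>simp add: e2 inner_diff_left fun_eq_iff field_simps\<close>)
      from 1 2 show ?thesis by blast
    qed
    define M where "M = (M1 + M2 * M1 / s) * (norm a + norm b + norm b) * norm w"
    have gz: "norm (g z) \<le> (norm a + norm b + norm b) * (1 + norm z)" for z
    proof -
      have "norm (g z) \<le> norm a + \<bar>Re z\<bar> * norm b + \<bar>Im z\<bar> * norm b"
        unfolding g_def by (intro norm_triangle_le add_mono) auto
      also have "\<dots> \<le> norm a * (1 + norm z) + (1 + norm z) * norm b + (1 + norm z) * norm b"
        using abs_Re_le_cmod[of z] abs_Im_le_cmod[of z]
        by (intro add_mono mult_right_mono) (auto simp: algebra_simps)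
      finally show ?thesis by (simp add: algebra_simps)
    qed
    have b1: "norm (U (g z)) \<le> M1 * ((norm a + norm b + norm b) * (1 + norm z))" for z
      using M1(2)[of "g z"] mult_left_mono[OF gz M1(1), of z] by linarith
    have b2: "norm (Y (U (g z))) \<le> M2 * (M1 * ((norm a + norm b + norm b) * (1 + norm z)))" for z
      using M2(2)[of "U (g z)"] mult_left_mono[OF b1 M2(1), of z] by linarith
    have pos: "0 \<le> (norm a + norm b + norm b) * (1 + norm z) * norm w" for z by simp
    have bound: "\<bar>g1 z\<bar> \<le> M * (1 + norm z)" "\<bar>g2 z\<bar> \<le> M * (1 + norm z)" for z
    proof -
      let ?N = "(norm a + norm b + norm b) * (1 + norm z) * norm w"
      have "\<bar>g1 z\<bar> \<le> norm (U (g z)) * norm w" unfolding g1_def by (rule Cauchy_Schwarz_ineq2)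
      also have "\<dots> \<le> M1 * ?N" using mult_right_mono[OF b1[of z], of "norm w"] by (simp add: mult.assoc)
      also have "\<dots> \<le> (M1 + M2 * M1 / s) * ?N"
        by (rule mult_right_mono) (use M1 M2 s pos in auto)
      finally show "\<bar>g1 z\<bar> \<le> M * (1 + norm z)" by (simp add: M_def mult_ac)
      have "\<bar>Y (U (g z)) \<bullet> w\<bar> \<le> norm (Y (U (g z))) * norm w" by (rule Cauchy_Schwarz_ineq2)
      also have "\<dots> \<le> M2 * M1 * ?N" using mult_right_mono[OF b2[of z], of "norm w"] by (simp add: mult.assoc)
      finally have "(1 / s) * \<bar>Y (U (g z)) \<bullet> w\<bar> \<le> (1 / s) * (M2 * M1 * ?N)"
        by (rule mult_left_mono) (use s in simp)
      then have "\<bar>g2 z\<bar> \<le> (M2 * M1 / s) * ?N" using s by (simp add: g2_def abs_mult)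
      also have "\<dots> \<le> (M1 + M2 * M1 / s) * ?N"
        by (rule mult_right_mono) (use M1 M2 s pos in auto)
      finally show "\<bar>g2 z\<bar> \<le> M * (1 + norm z)" by (simp add: M_def mult_ac)
    qed
    note res = conjugate_pair_affine[OF d bound]
    show "\<exists>t. \<forall>x. U (a + x *\<^sub>R b) \<bullet> w = U a \<bullet> w + x * t"
      using res(1) by (simp add: g1_def g_def)
    from res(2) obtain t where t: "\<And>x. g2 (of_real x) = g2 0 + x * t" by blast
    have "Y (U (a + x *\<^sub>R b)) \<bullet> w = Y (U a) \<bullet> w + x * (- s * t)" for x
      using t[of x] s(1) by (simp add: g2_def g_def field_simps)
    then show "\<exists>t. \<forall>x. Y (U (a + x *\<^sub>R b)) \<bullet> w = Y (U a) \<bullet> w + x * t" by blast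
  qed
  have linear_components: "linear R" if "\<And>w. linear (\<lambda>u. R u \<bullet> w)" for R :: "'n phase_space \<Rightarrow> 'n phase_space"
  proof (rule linearI)
    fix x y r
    show "R (x + y) = R x + R y"
      using linear_add[OF that] by (intro vector_eq_rdot[THEN iffD1]) (simp add: inner_add_left)
    show "R (r *\<^sub>R x) = r *\<^sub>R R x"
      using linear_scale[OF that] by (intro vector_eq_rdot[THEN iffD1]) simp
  qed
  have YU: "continuous_on UNIV (\<lambda>y. Y (U y))"
    using continuous_on_compose2[OF continuous_Y contU] by simp
  have "linear U"
    by (intro linear_components linear_if_affine_on_complex_lines dim aff continuous_on_inner
        continuous_on_const contU) (simp_all add: homU)
  have "linear (\<lambda>y. Y (U y))"
    by (intro linear_components linear_if_affine_on_complex_lines dim aff continuous_on_inner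
        continuous_on_const YU) (simp_all add: homU homogeneous)
  moreover have "linear F"
    using \<open>linear U\<close> UF FU by (intro linearI) (metis linear_add, simp add: homF)
  ultimately have "linear (\<lambda>u. Y (U (F u)))"
    using linear_compose[of F "\<lambda>y. Y (U y)"] by (simp add: o_def)
  then have "linear Y" by (simp add: UF)
  moreover have "Y (Y u) = (- k) *\<^sub>R u" for u
    using Y_Y[of u] k(2)[of u] by (cases "u = 0") auto
  ultimately show ?thesis using that k(1) by blast
qed

end

section \<open>Even fields preserving complex lines\<close>

text \<open>The situation of \<open>C = - J \<nabla>f\<close> for an odd function \<open>f\<close> that is homogeneous of degree 1, and \<open>I\<close> is a linear complex structure
  compatible with the symplectic form. Along each complex line \<open>C\<close> varies only within that line.\<close>

locale planar_even_field =
  fixes I :: "'n::finite phase_space \<Rightarrow> 'n phase_space"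
    and C :: "'n phase_space \<Rightarrow> 'n phase_space"
    and T :: "'n phase_space \<Rightarrow> 'n phase_space \<Rightarrow> 'n phase_space"
  assumes dim: "CARD('n) \<ge> 2"
    and linear_I: "linear I" and I_I: "I (I u) = - u"
    and I_skew: "omega (I u) w = - omega u (I w)"
    and I_positive: "u \<noteq> 0 \<Longrightarrow> omega (I u) u > 0"
    and homogeneous: "r \<noteq> 0 \<Longrightarrow> C (r *\<^sub>R u) = C u"
    and derivative: "u \<noteq> 0 \<Longrightarrow> (C has_derivative T u) (at u)"
    and hamiltonian: "u \<noteq> 0 \<Longrightarrow> omega (T u x) y = - omega x (T u y)"
    and plane_invariant: "u \<noteq> 0 \<Longrightarrow> (a, b) \<noteq> (0, 0) \<Longrightarrow> C (a *\<^sub>R u + b *\<^sub>R I u) - C u \<in> span {u, I u}"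
    and bounded: "bounded (C ` (- {0}))"
begin

lemmas I_simps = linear_add[OF linear_I] linear_scale[OF linear_I] linear_neg[OF linear_I]
  linear_diff[OF linear_I] linear_0[OF linear_I] I_I

lemma bounded_linear_I: "bounded_linear I"
  using linear_I by (simp add: linear_conv_bounded_linear)

lemma I_isometry: "omega (I u) (I w) = omega u w"
  using I_skew[of u "I w"] by (simp add: I_simps symplectic_simps)

lemma plane_symplectic: "u \<noteq> 0 \<Longrightarrow> omega u (I u) \<noteq> 0"
  using I_positive[of u] symplectic_skew[of u "I u"] by auto

lemma plane_nonzero:
  assumes "u \<noteq> 0" "(a, b) \<noteq> (0, 0)"
  shows "a *\<^sub>R u + b *\<^sub>R I u \<noteq> 0"
  by (rule symplectic_combination_nonzero[OF plane_symplectic[OF assms(1)] assms(2)])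

lemma linear_T: "u \<noteq> 0 \<Longrightarrow> linear (T u)"
  using derivative has_derivative_bounded_linear bounded_linear.linear by blast

lemma T_self:
  assumes "u \<noteq> 0"
  shows "T u u = 0"
proof -
  have "((\<lambda>t. C (u + t *\<^sub>R u)) has_vector_derivative T u u) (at 0)"
    using has_vector_derivative_compose[OF has_vector_derivative_line, of C "T u" u 0 u]
      derivative[OF assms] by simp
  moreover have "((\<lambda>t. C u) has_vector_derivative 0) (at 0)" by (rule has_vector_derivative_const)
  then have "((\<lambda>t. C (u + t *\<^sub>R u)) has_vector_derivative 0) (at 0)"
  proof (rule has_vector_derivative_transform_within_open[of _ _ _ "{-1<..}"])
    fix t :: real assume "t \<in> {-1<..}"
    then show "C u = C (u + t *\<^sub>R u)" using homogeneous[of "1 + t" u] by (simp add: algebra_simps)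
  qed auto
  ultimately show ?thesis using vector_derivative_unique_at by blast
qed

lemma transverse_derivative:
  assumes u: "u \<noteq> 0" "(a, b) \<noteq> (0, 0)"
    and Cm: "C (a *\<^sub>R u + b *\<^sub>R I u) - C u = c *\<^sub>R u + d *\<^sub>R I u"
    and x: "omega u x = 0" "omega (I u) x = 0" and y: "omega u y = 0" "omega (I u) y = 0"
  shows "omega (T (a *\<^sub>R u + b *\<^sub>R I u) (a *\<^sub>R x + b *\<^sub>R I x) - T u x) y = c * omega x y + d * omega (I x) y"
proof -
  let ?p = "\<lambda>t. u + t *\<^sub>R x"
  have p0: "?p t \<noteq> 0" for t
  proof
    assume *: "?p t = 0"
    have "omega (I u) (?p t) = omega (I u) u" by (simp add: symplectic_simps x)
    then show False using I_positive[OF u(1)] by (simp add: * symplectic_simps)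
  qed
  have q: "((\<lambda>t. I (?p t)) has_vector_derivative I x) (at 0)"
    by (rule bounded_linear.has_vector_derivative[OF bounded_linear_I has_vector_derivative_line])
  have m: "((\<lambda>t. a *\<^sub>R ?p t + b *\<^sub>R I (?p t)) has_vector_derivative a *\<^sub>R x + b *\<^sub>R I x) (at 0)"
    by (intro has_vector_derivative_add bounded_linear.has_vector_derivative[OF bounded_linear_scaleR_right]
        has_vector_derivative_line q)
  have 1: "((\<lambda>t. C (?p t)) has_vector_derivative T u x) (at 0)"
    using has_vector_derivative_compose[OF has_vector_derivative_line, of C "T u" u 0 x]
      derivative[OF u(1)] by simp
  have 2: "((\<lambda>t. C (a *\<^sub>R ?p t + b *\<^sub>R I (?p t))) has_vector_derivative
      T (a *\<^sub>R u + b *\<^sub>R I u) (a *\<^sub>R x + b *\<^sub>R I x)) (at 0)"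
    using has_vector_derivative_compose[OF m, of C "T (a *\<^sub>R u + b *\<^sub>R I u)"]
      derivative[OF plane_nonzero[OF u]] by simp
  show ?thesis
  proof (rule variation_in_moving_plane[where p = ?p and q = "\<lambda>t. I (?p t)"
        and D = "\<lambda>t. C (a *\<^sub>R ?p t + b *\<^sub>R I (?p t)) - C (?p t)"])
    show "((\<lambda>t. C (a *\<^sub>R ?p t + b *\<^sub>R I (?p t)) - C (?p t)) has_vector_derivative
        T (a *\<^sub>R u + b *\<^sub>R I u) (a *\<^sub>R x + b *\<^sub>R I x) - T u x) (at 0)"
      by (rule has_vector_derivative_diff[OF 2 1])
    show "C (a *\<^sub>R ?p t + b *\<^sub>R I (?p t)) - C (?p t) \<in> span {?p t, I (?p t)}" for t
      by (rule plane_invariant[OF p0 u(2)])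
  qed (use assms plane_symplectic q has_vector_derivative_line in auto)
qed

text \<open>The counterpart of \<open>transverse_relation\<close>. In the basis \<open>u, I u\<close> it computes the component of
  \<open>C m - C u\<close> in the direction of \<open>m\<close>, which determines the tangential derivative of the other
  component.\<close>

lemma radial_relation:
  assumes u: "u \<noteq> 0"
  obtains k where "\<And>a b c d. (a, b) \<noteq> (0, 0) \<Longrightarrow>
    C (a *\<^sub>R u + b *\<^sub>R I u) - C u = c *\<^sub>R u + d *\<^sub>R I u \<Longrightarrow> a * c + b * d = k * b"
proof -
  have "omega u (I u) \<noteq> 0" by (rule plane_symplectic[OF u])
  from symplectic_complement_pair[OF dim this] obtain x y where
    x: "omega u x = 0" "omega (I u) x = 0" and y: "omega u y = 0" "omega (I u) y = 0"
    and xy: "omega x y \<noteq> 0" by metis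
  have I_compl: "omega u (I z) = 0" "omega (I u) (I z) = 0" if "omega u z = 0" "omega (I u) z = 0" for z
    using that I_skew[of u z] I_isometry[of u z] by simp_all
  define k where "k = - (omega (T u x) (I y) - omega (T u y) (I x)) / (2 * omega x y)"
  have "a * c + b * d = k * b" if ab: "(a, b) \<noteq> (0, 0)"
    and Cm: "C (a *\<^sub>R u + b *\<^sub>R I u) - C u = c *\<^sub>R u + d *\<^sub>R I u" for a b c d
  proof -
    let ?m = "a *\<^sub>R u + b *\<^sub>R I u"
    let ?P = "a *\<^sub>R x + b *\<^sub>R I x" and ?Q = "a *\<^sub>R y + b *\<^sub>R I y"
    have P: "omega u ?P = 0" "omega (I u) ?P = 0" and Q: "omega u ?Q = 0" "omega (I u) ?Q = 0"
      using x y I_compl[OF x] I_compl[OF y] by (simp_all add: symplectic_simps)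
    have "omega (T ?m ?P) ?Q - omega (T u x) ?Q = c * omega x ?Q + d * omega (I x) ?Q"
      using transverse_derivative[OF u ab Cm x Q] by (simp only: symplectic.diff_left)
    moreover have "omega (T ?m ?Q) ?P - omega (T u y) ?P = c * omega y ?P + d * omega (I y) ?P"
      using transverse_derivative[OF u ab Cm y P] by (simp only: symplectic.diff_left)
    moreover have "omega (T ?m ?P) ?Q = omega (T ?m ?Q) ?P"
      using hamiltonian[OF plane_nonzero[OF u ab], of ?P ?Q] symplectic_skew[of ?P "T ?m ?Q"] by simp
    moreover have "omega (T u x) y = omega (T u y) x"
      using hamiltonian[OF u, of x y] symplectic_skew[of x "T u y"] by simp
    moreover have "omega y x = - omega x y" "omega (I x) y = - omega x (I y)" "omega (I y) x = - omega y (I x)"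
      "omega y (I x) = - omega (I x) y"
      by (rule symplectic_skew I_skew)+
    moreover have "omega (I x) (I y) = omega x y" "omega (I y) (I x) = omega y x"
      by (rule I_isometry)+
    ultimately have "2 * (a * c + b * d) * omega x y = - b * (omega (T u x) (I y) - omega (T u y) (I x))"
      by (simp add: symplectic_simps algebra_simps)
    then show ?thesis using xy by (simp add: k_def field_simps)
  qed
  then show ?thesis using that by blast
qed

text \<open>On the circle \<open>m t\<close> let \<open>f\<close> be the component of \<open>C (m t) - C u\<close> transversal to \<open>m t\<close>. By \<open>radial_relation\<close>
  it is a multiple of \<open>k (cos t - 1)\<close>. As \<open>C\<close> takes the same value at \<open>u\<close> and \<open>- u\<close>, the value at
  \<open>t = \<pi>\<close> gives \<open>k = 0\<close>, and then both components vanish.\<close>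

lemma constant_on_plane:
  assumes u: "u \<noteq> 0" "(a, b) \<noteq> (0, 0)"
  shows "C (a *\<^sub>R u + b *\<^sub>R I u) = C u"
proof -
  obtain k where k: "\<And>a b c d. (a, b) \<noteq> (0, 0) \<Longrightarrow>
    C (a *\<^sub>R u + b *\<^sub>R I u) - C u = c *\<^sub>R u + d *\<^sub>R I u \<Longrightarrow> a * c + b * d = k * b"
    using radial_relation[OF u(1)] by metis
  define g where "g = omega u (I u)"
  have g: "g \<noteq> 0" "omega (I u) u = - g"
    using plane_symplectic[OF u(1)] symplectic_skew[of "I u" u] by (simp_all add: g_def)
  define m where "m = (\<lambda>t. cos t *\<^sub>R u + sin t *\<^sub>R I u)"
  have nz: "(cos t, sin t) \<noteq> (0, 0)" for t :: real using sin_zero_norm_cos_one[of t] by auto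
  have m0: "m t \<noteq> 0" for t unfolding m_def by (rule plane_nonzero[OF u(1) nz])
  have dm: "(m has_vector_derivative I (m t)) (at t)" for t
    unfolding m_def
    by (auto intro!: derivative_eq_intros simp: has_vector_derivative_def I_simps algebra_simps)
  have coord: "\<exists>c d. C (m t) - C u = c *\<^sub>R u + d *\<^sub>R I u \<and> cos t * c + sin t * d = k * sin t" for t
    using plane_invariant[OF u(1) nz, of t] k[OF nz, of t] unfolding m_def span_pair by blast
  define f where "f = (\<lambda>t. omega (C (m t) - C u) (m t))"
  have "(f has_vector_derivative omega (C (m t) - C u) (I (m t)) + omega (T (m t) (I (m t)) - 0) (m t)) (at t)" for t
    unfolding f_def
    by (intro symplectic.has_vector_derivative has_vector_derivative_diff has_vector_derivative_const dm
        has_vector_derivative_compose[OF dm] derivative m0)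
  moreover have "omega (T (m t) (I (m t)) - 0) (m t) = 0" for t
    using hamiltonian[OF m0, of t "I (m t)" "m t"] T_self[OF m0, of t] by (simp add: symplectic_simps)
  moreover have "omega (C (m t) - C u) (I (m t)) = (k * sin t) * g" for t
  proof -
    obtain c d where cd: "C (m t) - C u = c *\<^sub>R u + d *\<^sub>R I u" "cos t * c + sin t * d = k * sin t"
      using coord by blast
    have "omega (C (m t) - C u) (I (m t)) = (cos t * c + sin t * d) * g"
      unfolding cd(1) unfolding m_def by (simp add: I_simps symplectic_simps g algebra_simps flip: g_def)
    then show ?thesis by (simp only: cd(2))
  qed
  ultimately have "(f has_real_derivative k * sin t * g) (at t)" for t
    by (simp add: has_real_derivative_iff_has_vector_derivative)
  then have "((\<lambda>t. f t + k * g * cos t) has_real_derivative 0) (at t)" for t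
    by (auto intro!: derivative_eq_intros)
  then have f: "f t + k * g * cos t = f 0 + k * g * cos 0" for t
    using DERIV_isconst_all[of "\<lambda>t. f t + k * g * cos t"] by blast
  have f0: "f 0 = 0" by (simp add: f_def m_def symplectic_simps)
  have "f pi = 0" using homogeneous[of "-1" u] by (simp add: f_def m_def symplectic_simps)
  then have k0: "k = 0" using f[of pi] f0 g by simp
  have circle: "C (m t) = C u" for t
  proof -
    obtain c d where cd: "C (m t) - C u = c *\<^sub>R u + d *\<^sub>R I u" "cos t * c + sin t * d = 0"
      using coord[of t] unfolding k0 mult_zero_left by blast
    have "f t = 0" using f[of t] f0 k0 by simp
    then have "(c * sin t - d * cos t) * g = 0"
      unfolding f_def cd(1) unfolding m_def by (simp add: symplectic_simps g algebra_simps flip: g_def)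
    then have e: "c * sin t - d * cos t = 0" using g by simp
    have "c * (x\<^sup>2 + y\<^sup>2) = x * (x * c + y * d) + y * (c * y - d * x)"
      "d * (x\<^sup>2 + y\<^sup>2) = y * (x * c + y * d) - x * (c * y - d * x)" for x y :: real
      by (simp_all add: algebra_simps power2_eq_square)
    from this[of "cos t" "sin t"] have c: "c = 0" and d: "d = 0" by (simp_all only: cd(2) e) simp_all
    show ?thesis using cd(1) c d by simp
  qed
  obtain s t where s: "s > 0" and ab: "a = s * cos t" "b = s * sin t"
    using u(2) by (rule polar_coordinates)
  have "a *\<^sub>R u + b *\<^sub>R I u = s *\<^sub>R m t" by (simp add: ab m_def scaleR_add_right)
  then show ?thesis using homogeneous[of s "m t"] s circle by simp
qed

text \<open>Differentiate \<open>C (v + I v) = C v\<close> and compare the symmetry of the derivative at \<open>u + I u\<close> with that at \<open>u\<close>.\<close>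

lemma T_antilinear:
  assumes u: "u \<noteq> 0"
  shows "T u (I x) = - I (T u x)"
proof -
  have Iu: "I u \<noteq> 0" using plane_nonzero[OF u, of 0 1] by simp
  let ?m = "u + I u"
  have m: "?m \<noteq> 0" using plane_nonzero[OF u, of 1 1] by simp
  have m2: "((\<lambda>v. v + I v) has_derivative (\<lambda>h. h + I h)) (at u)"
    by (intro has_derivative_add has_derivative_ident bounded_linear_imp_has_derivative bounded_linear_I)
  have "((\<lambda>v. C (v + I v)) has_derivative (\<lambda>h. T ?m (h + I h))) (at u)"
    using diff_chain_at[OF m2 derivative[OF m]] by (simp add: o_def)
  moreover have "((\<lambda>v. C (v + I v)) has_derivative T u) (at u)"
  proof (rule has_derivative_transform_within_open[where s = "- {0}", OF derivative[OF u]])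
    show "C v = C (v + I v)" if "v \<in> - {0}" for v
      using constant_on_plane[of v 1 1] that by simp
  qed (use u in auto)
  ultimately have "(\<lambda>h. T ?m (h + I h)) = T u" by (rule has_derivative_unique)
  then have Tm: "T ?m (h + I h) = T u h" for h by (rule fun_cong)
  have "omega (T u (I x) + I (T u x)) y = 0" for y
  proof -
    have "omega (T ?m (x + I x)) (y + I y) = - omega (x + I x) (T ?m (y + I y))"
      by (rule hamiltonian[OF m])
    then have "omega (T u x) (y + I y) = - omega (x + I x) (T u y)" by (simp only: Tm)
    then have "omega (T u x) (I y) + omega (I x) (T u y) = 0"
      using hamiltonian[OF u, of x y] by (simp add: symplectic_simps)
    then show ?thesis
      using hamiltonian[OF u, of "I x" y] I_skew[of "T u x" y] by (simp add: symplectic_simps)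
  qed
  then have "T u (I x) + I (T u x) = 0" by (rule symplectic_nondegenerate)
  then show ?thesis by (simp add: eq_neg_iff_add_eq_0)
qed

text \<open>By \<open>T_antilinear\<close> the function \<open>C \<bullet> w + \<i> (I C) \<bullet> w\<close> is holomorphic on the complex line through
  \<open>a\<close> in direction \<open>b\<close>, and it is bounded.\<close>

lemma constant_on_complex_line:
  assumes ab: "a \<notin> span {b, I b}"
  shows "C (a + b) = C a"
proof -
  obtain M where M: "\<And>u. u \<noteq> 0 \<Longrightarrow> norm (C u) \<le> M"
    using bounded unfolding bounded_iff by blast
  obtain N where N: "N > 0" "\<And>v. norm (I v) \<le> norm v * N"
    using bounded_linear.pos_bounded[OF bounded_linear_I] by blast
  define g where "g = (\<lambda>z. a + Re z *\<^sub>R b + Im z *\<^sub>R I b)"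
  have g0: "g z \<noteq> 0" for z
  proof
    assume "g z = 0"
    moreover have "a = g z + (- Re z) *\<^sub>R b + (- Im z) *\<^sub>R I b" by (simp add: g_def)
    ultimately have "a = (- Re z) *\<^sub>R b + (- Im z) *\<^sub>R I b" by simp
    then show False using ab span_pair by blast
  qed
  have M0: "M \<ge> 0" using norm_ge_zero M[OF g0[of 0]] order_trans by blast
  have "C (a + b) \<bullet> w = C a \<bullet> w" for w
  proof -
    define g1 where "g1 = (\<lambda>z. C (g z) \<bullet> w)"
    define g2 where "g2 = (\<lambda>z. I (C (g z)) \<bullet> w)"
    have d: "\<exists>p q. (g1 has_derivative (\<lambda>h. p * Re h + q * Im h)) (at z) \<and>
      (g2 has_derivative (\<lambda>h. p * Im h - q * Re h)) (at z)" for z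
    proof -
      note T = derivative[OF g0] and lin = linear_T[OF g0]
      define d1 where "d1 = T (g z) b"
      have dg: "(g has_derivative (\<lambda>h. Re h *\<^sub>R b + Im h *\<^sub>R I b)) (at z)"
        unfolding g_def by (auto intro!: derivative_eq_intros)
      have dC: "((\<lambda>z. C (g z)) has_derivative (\<lambda>h. T (g z) (Re h *\<^sub>R b + Im h *\<^sub>R I b))) (at z)"
        using diff_chain_at[OF dg T] by (simp add: o_def)
      have e: "T (g z) (Re h *\<^sub>R b + Im h *\<^sub>R I b) = Re h *\<^sub>R d1 - Im h *\<^sub>R I d1" for h
        by (simp add: linear_add[OF lin] linear_scale[OF lin] T_antilinear[OF g0] d1_def)
      have dIC: "((\<lambda>z. I (C (g z))) has_derivative (\<lambda>h. I (Re h *\<^sub>R d1 - Im h *\<^sub>R I d1))) (at z)"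
        by (rule bounded_linear.has_derivative[OF bounded_linear_I dC[unfolded e]])
      have 1: "(g1 has_derivative (\<lambda>h. (d1 \<bullet> w) * Re h + (- (I d1 \<bullet> w)) * Im h)) (at z)"
        unfolding g1_def
        by (rule has_derivative_eq_rhs[OF has_derivative_inner_left[OF dC[unfolded e]]])
          (simp add: inner_diff_left fun_eq_iff)
      have 2: "(g2 has_derivative (\<lambda>h. (d1 \<bullet> w) * Im h - (- (I d1 \<bullet> w)) * Re h)) (at z)"
        unfolding g2_def
        by (rule has_derivative_eq_rhs[OF has_derivative_inner_left[OF dIC]])
          (simp add: I_simps inner_add_left fun_eq_iff)
      from 1 2 show ?thesis by blast
    qed
    have b1: "\<bar>g1 z\<bar> \<le> M * norm w" for z
      using Cauchy_Schwarz_ineq2[of "C (g z)" w] mult_right_mono[OF M[OF g0[of z]], of "norm w"]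
      unfolding g1_def by simp
    have "norm (I (C (g z))) \<le> M * N" for z
      by (rule order_trans[OF N(2) mult_right_mono[OF M[OF g0]]]) (use N(1) in simp)
    then have b2: "\<bar>g2 z\<bar> \<le> M * N * norm w" for z
      using Cauchy_Schwarz_ineq2[of "I (C (g z))" w] mult_right_mono[of "norm (I (C (g z)))" "M * N" "norm w"]
      unfolding g2_def by fastforce
    define K where "K = M * norm w + M * N * norm w"
    have K: "M * norm w \<le> K" "M * N * norm w \<le> K" "0 \<le> K" using M0 N by (simp_all add: K_def)
    have bound: "\<bar>g1 z\<bar> \<le> K * (1 + norm z)" "\<bar>g2 z\<bar> \<le> K * (1 + norm z)" for z
    proof -
      have "K \<le> K * (1 + norm z)" using K(3) by (simp add: distrib_left)
      then show "\<bar>g1 z\<bar> \<le> K * (1 + norm z)" "\<bar>g2 z\<bar> \<le> K * (1 + norm z)"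
        using b1[of z] b2[of z] K by linarith+
    qed
    obtain s where s: "\<And>x. g1 (of_real x) = g1 0 + x * s"
      using conjugate_pair_affine(1)[OF d bound] by blast
    have "s = 0"
    proof (rule ccontr)
      assume s0: "s \<noteq> 0"
      have "\<bar>x * s\<bar> \<le> 2 * (M * norm w)" for x using b1[of "of_real x"] b1[of 0] s[of x] by linarith
      from this[of "(2 * (M * norm w) + 1) / s"] show False using s0 by simp
    qed
    then show ?thesis using s[of 1] by (simp add: g1_def g_def)
  qed
  then show ?thesis using vector_eq_rdot by blast
qed

text \<open>Two vectors that are independent over \<open>I\<close> lie on a complex line that avoids the origin.\<close>

theorem constant_off_origin:
  assumes "u \<noteq> 0" "w \<noteq> 0"
  shows "C u = C w"
proof (cases "u \<in> span {w, I w}")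
  case True
  then obtain a b where ab: "u = a *\<^sub>R w + b *\<^sub>R I w" using span_pair by blast
  then have "(a, b) \<noteq> (0, 0)" using assms(1) by auto
  then show ?thesis using ab constant_on_plane[OF assms(2)] by simp
next
  case False
  \<comment> \<open>If \<open>u = \<lambda> (w - u)\<close> for a complex number \<open>\<lambda> = a + \<i> b\<close>, then \<open>(1 + \<lambda>) u = \<lambda> w\<close>; multiplication by the
    conjugate of \<open>1 + \<lambda>\<close> puts \<open>u\<close> into the complex line of \<open>w\<close>.\<close>
  have "u \<notin> span {w - u, I (w - u)}"
  proof
    assume "u \<in> span {w - u, I (w - u)}"
    then obtain a b where ab: "u = a *\<^sub>R (w - u) + b *\<^sub>R I (w - u)" using span_pair by blast
    define c where "c = (1 + a)\<^sup>2 + b\<^sup>2"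
    have "I u = I (a *\<^sub>R (w - u) + b *\<^sub>R I (w - u))" using ab by (rule arg_cong)
    also have "\<dots> = a *\<^sub>R I (w - u) - b *\<^sub>R (w - u)"
      by (simp only: I_simps(1,2) I_I scaleR_minus_right add_uminus_conv_diff)
    finally have Iu: "I u = a *\<^sub>R I (w - u) - b *\<^sub>R (w - u)" .
    have e1: "(1 + a) *\<^sub>R u + b *\<^sub>R I u = a *\<^sub>R w + b *\<^sub>R I w"
      using ab by (simp add: I_simps algebra_simps)
    have e2: "(1 + a) *\<^sub>R I u - b *\<^sub>R u = a *\<^sub>R I w - b *\<^sub>R w"
      using Iu by (simp add: I_simps algebra_simps)
    have "(e\<^sup>2 + b\<^sup>2) *\<^sub>R u = e *\<^sub>R (e *\<^sub>R u + b *\<^sub>R I u) - b *\<^sub>R (e *\<^sub>R I u - b *\<^sub>R u)" for e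
      by (simp add: power2_eq_square algebra_simps)
    then have "c *\<^sub>R u = (1 + a) *\<^sub>R ((1 + a) *\<^sub>R u + b *\<^sub>R I u) - b *\<^sub>R ((1 + a) *\<^sub>R I u - b *\<^sub>R u)"
      unfolding c_def .
    also have "\<dots> = (1 + a) *\<^sub>R (a *\<^sub>R w + b *\<^sub>R I w) - b *\<^sub>R (a *\<^sub>R I w - b *\<^sub>R w)" by (simp only: e1 e2)
    also have "\<dots> \<in> span {w, I w}"
      by (intro span_diff span_scale span_add span_base) auto
    finally have cu: "c *\<^sub>R u \<in> span {w, I w}" .
    show False
    proof (cases "c = 0")
      case True
      then have "a = -1" "b = 0" by (auto simp: c_def sum_power2_eq_zero_iff)
      then show False using ab assms(2) by simp
    next
      case c: False
      have "(1 / c) *\<^sub>R (c *\<^sub>R u) \<in> span {w, I w}" by (rule span_scale[OF cu])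
      then show False using c False by simp
    qed
  qed
  then show ?thesis using constant_on_complex_line[of u "w - u"] by simp
qed

end

section \<open>Differentiability of implicit maps and symmetry of second derivatives\<close>

text \<open>A continuous solution \<open>g\<close> of \<open>F (g x) = h x\<close> is differentiable wherever \<open>F\<close> and \<open>h\<close> are and the derivative
  of \<open>F\<close> has a left inverse.
  It is applied with \<open>g\<close> the support point and \<open>h\<close> the normalisation \<open>u / norm u\<close>.\<close>

lemma differentiable_implicit:
  fixes F :: "'a::euclidean_space \<Rightarrow> 'b::real_normed_vector" and g :: "'c::real_normed_vector \<Rightarrow> 'a"
  assumes F: "(F has_derivative L) (at (g y))" and inj: "inj L" and fin: "\<exists>G. bounded_linear G \<and> G \<circ> L = id"
    and cont: "isCont g y" and Fg: "((\<lambda>x. F (g x)) has_derivative R) (at y)"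
  shows "g differentiable (at y)"
proof -
  obtain G where G: "bounded_linear G" and GL: "\<And>x. G (L x) = x"
    using fin by (metis comp_apply id_apply)
  interpret G: bounded_linear G by (rule G)
  obtain N where N: "N > 0" "\<And>x. norm (G x) \<le> norm x * N" using G.pos_bounded by blast
  have R: "bounded_linear R" by (rule has_derivative_bounded_linear[OF Fg])
  have GR: "bounded_linear (\<lambda>x. G (R x))" by (rule bounded_linear_compose[OF G R])
  then obtain P where P: "P > 0" "\<And>x. norm (G (R x)) \<le> norm x * P"
    using bounded_linear.pos_bounded[OF GR] by blast
  have "(g has_derivative (\<lambda>x. G (R x))) (at y)"
    unfolding has_derivative_at_alt
  proof (intro conjI GR allI impI)
    fix e :: real assume e: "e > 0"
    \<comment> \<open>The first bound lets \<open>norm D\<close> be absorbed into the left-hand side, which gives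
      \<open>norm D \<le> (1 + 2 * P) * norm (x - y)\<close>; the second bound then yields the error \<open>e\<close>.\<close>
    define c where "c = min (1 / (2 * N)) (e / (N * (3 + 2 * P)))"
    have c: "c > 0" "N * c \<le> 1 / 2" "N * c * (3 + 2 * P) \<le> e"
    proof -
      show "c > 0" using e N P by (simp add: c_def)
      have "c \<le> 1 / (2 * N)" "c \<le> e / (N * (3 + 2 * P))" by (auto simp: c_def)
      then have "c * (2 * N) \<le> 1" "c * (N * (3 + 2 * P)) \<le> e"
        using N P pos_le_divide_eq[of "2 * N" c 1] pos_le_divide_eq[of "N * (3 + 2 * P)" c e] by simp_all
      then show "N * c \<le> 1 / 2" "N * c * (3 + 2 * P) \<le> e" by (simp_all add: algebra_simps)
    qed
    obtain d1 where d1: "d1 > 0" "\<And>x. norm (x - g y) < d1 \<Longrightarrow>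
        norm (F x - F (g y) - L (x - g y)) \<le> c * norm (x - g y)"
      using F c(1) unfolding has_derivative_at_alt by blast
    obtain d2 where d2: "d2 > 0" "\<And>x. norm (x - y) < d2 \<Longrightarrow> norm (g x - g y) < d1"
      using cont d1(1) unfolding continuous_at_eps_delta dist_norm by metis
    obtain d3 where d3: "d3 > 0" "\<And>x. norm (x - y) < d3 \<Longrightarrow>
        norm (F (g x) - F (g y) - R (x - y)) \<le> c * norm (x - y)"
      using Fg c(1) unfolding has_derivative_at_alt by blast
    show "\<exists>d>0. \<forall>x. norm (x - y) < d \<longrightarrow> norm (g x - g y - G (R (x - y))) \<le> e * norm (x - y)"
    proof (intro exI[of _ "min d2 d3"] conjI allI impI)
      show "min d2 d3 > 0" using d2 d3 by simp
      fix x assume x: "norm (x - y) < min d2 d3"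
      define D where "D = g x - g y"
      define r1 where "r1 = F (g x) - F (g y) - L D"
      define r2 where "r2 = F (g x) - F (g y) - R (x - y)"
      have r1: "norm r1 \<le> c * norm D" unfolding r1_def D_def using d1(2) d2(2) x by simp
      have r2: "norm r2 \<le> c * norm (x - y)" unfolding r2_def using d3(2) x by simp
      have eq: "D - G (R (x - y)) = G (r2 - r1)"
      proof -
        have "r2 - r1 = L D - R (x - y)" by (simp add: r1_def r2_def)
        then show ?thesis by (simp add: G.diff GL)
      qed
      have "norm (r2 - r1) \<le> c * norm (x - y) + c * norm D"
        using norm_triangle_ineq4[of r2 r1] r1 r2 by linarith
      then have "norm (G (r2 - r1)) \<le> (c * norm (x - y) + c * norm D) * N"
        using N by (meson mult_right_mono less_imp_le order_trans)
      then have D1: "norm (D - G (R (x - y))) \<le> N * c * (norm (x - y) + norm D)"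
        unfolding eq by (simp add: algebra_simps)
      have "norm D \<le> norm (D - G (R (x - y))) + norm (G (R (x - y)))"
        using norm_triangle_ineq[of "D - G (R (x - y))" "G (R (x - y))"] by simp
      also have "\<dots> \<le> N * c * (norm (x - y) + norm D) + norm (x - y) * P" using D1 P(2) by (intro add_mono)
      also have "\<dots> \<le> 1 / 2 * (norm (x - y) + norm D) + norm (x - y) * P"
        by (intro add_mono mult_right_mono c(2)) (use P(1) in auto)
      finally have "norm D \<le> (1 + 2 * P) * norm (x - y)" by (simp add: algebra_simps)
      then have "N * c * (norm (x - y) + norm D) \<le> N * c * (norm (x - y) + (1 + 2 * P) * norm (x - y))"
        using N c by (intro mult_left_mono add_left_mono) auto
      also have "\<dots> \<le> (N * c * (3 + 2 * P)) * norm (x - y)"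
        using N c P by (simp add: algebra_simps)
      also have "\<dots> \<le> e * norm (x - y)" by (intro mult_right_mono c(3)) auto
      finally show "norm (g x - g y - G (R (x - y))) \<le> e * norm (x - y)"
        using D1 unfolding D_def by linarith
    qed
  qed
  then show ?thesis by (rule differentiableI)
qed

text \<open>The mean value theorem, applied in the direction of \<open>a\<close> only, turns the second difference into an
  increment of the gradient.\<close>

lemma second_difference_estimate:
  fixes h :: "'a::euclidean_space \<Rightarrow> real" and Z :: "'a \<Rightarrow> 'a"
  assumes d: "d > 0" "\<And>x. norm (x - u) < d \<Longrightarrow> (h has_derivative (\<lambda>k. Z x \<bullet> k)) (at x)"
    and Z: "linear D" "\<And>x. norm (x - u) < d \<Longrightarrow> norm (Z x - Z u - D (x - u)) \<le> e * norm (x - u)"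
    and e: "e \<ge> 0" and t: "t > 0" "t * (norm a + norm b) < d"
  shows "\<bar>h (u + t *\<^sub>R a + t *\<^sub>R b) - h (u + t *\<^sub>R a) - h (u + t *\<^sub>R b) + h u - t\<^sup>2 * (D b \<bullet> a)\<bar>
     \<le> t\<^sup>2 * (e * (2 * norm a + norm b) * norm a)"
proof -
  define p where "p = (\<lambda>s. h (u + s *\<^sub>R a + t *\<^sub>R b) - h (u + s *\<^sub>R a))"
  have n1: "norm (s *\<^sub>R a + t *\<^sub>R b) \<le> t * (norm a + norm b)"
    and n2: "norm (s *\<^sub>R a) \<le> t * (norm a + norm b)" if "0 \<le> s" "s \<le> t" for s
  proof -
    have sa: "norm (s *\<^sub>R a) \<le> t * norm a" using that by (simp add: mult_right_mono)
    then show "norm (s *\<^sub>R a + t *\<^sub>R b) \<le> t * (norm a + norm b)"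
      using t norm_triangle_ineq[of "s *\<^sub>R a" "t *\<^sub>R b"] by (simp add: algebra_simps)
    show "norm (s *\<^sub>R a) \<le> t * (norm a + norm b)" using sa t by (simp add: distrib_left add_increasing2)
  qed
  have dp: "(p has_real_derivative (Z (u + s *\<^sub>R a + t *\<^sub>R b) \<bullet> a - Z (u + s *\<^sub>R a) \<bullet> a)) (at s)"
    if s: "0 \<le> s" "s \<le> t" for s
  proof -
    have 1: "(h has_derivative (\<lambda>k. Z (u + s *\<^sub>R a + t *\<^sub>R b) \<bullet> k)) (at (u + s *\<^sub>R a + t *\<^sub>R b))"
      using n1[OF s] t by (intro d(2)) (simp add: add.assoc)
    have 2: "(h has_derivative (\<lambda>k. Z (u + s *\<^sub>R a) \<bullet> k)) (at (u + s *\<^sub>R a))"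
      using n2[OF s] t by (intro d(2)) simp
    have l: "((\<lambda>s. u + s *\<^sub>R a + t *\<^sub>R b) has_derivative (\<lambda>x. x *\<^sub>R a)) (at s)"
      "((\<lambda>s. u + s *\<^sub>R a) has_derivative (\<lambda>x. x *\<^sub>R a)) (at s)"
      by (auto intro!: derivative_eq_intros)
    have "(p has_derivative (\<lambda>x. Z (u + s *\<^sub>R a + t *\<^sub>R b) \<bullet> (x *\<^sub>R a) - Z (u + s *\<^sub>R a) \<bullet> (x *\<^sub>R a))) (at s)"
      unfolding p_def
      using has_derivative_diff[OF diff_chain_at[OF l(1) 1] diff_chain_at[OF l(2) 2]] by (simp add: o_def)
    moreover have "(\<lambda>x. Z (u + s *\<^sub>R a + t *\<^sub>R b) \<bullet> (x *\<^sub>R a) - Z (u + s *\<^sub>R a) \<bullet> (x *\<^sub>R a))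
        = (*) (Z (u + s *\<^sub>R a + t *\<^sub>R b) \<bullet> a - Z (u + s *\<^sub>R a) \<bullet> a)"
      by (auto simp: algebra_simps)
    ultimately show ?thesis unfolding has_field_derivative_def by simp
  qed
  from MVT2[OF t(1) dp] obtain s where s: "0 < s" "s < t"
    and ps: "p t - p 0 = (t - 0) * (Z (u + s *\<^sub>R a + t *\<^sub>R b) \<bullet> a - Z (u + s *\<^sub>R a) \<bullet> a)"
    by blast
  have s': "0 \<le> s" "s \<le> t" using s by auto
  define r1 where "r1 = Z (u + s *\<^sub>R a + t *\<^sub>R b) - Z u - D (s *\<^sub>R a + t *\<^sub>R b)"
  define r2 where "r2 = Z (u + s *\<^sub>R a) - Z u - D (s *\<^sub>R a)"
  have "norm r1 \<le> e * norm (s *\<^sub>R a + t *\<^sub>R b)" unfolding r1_def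
    using Z(2)[of "u + s *\<^sub>R a + t *\<^sub>R b"] n1[OF s'] t by (simp add: add.assoc)
  also have "\<dots> \<le> e * (t * (norm a + norm b))" by (rule mult_left_mono[OF n1[OF s'] e])
  finally have r1: "norm r1 \<le> e * (t * (norm a + norm b))" .
  have "norm r2 \<le> e * norm (s *\<^sub>R a)" unfolding r2_def
    using Z(2)[of "u + s *\<^sub>R a"] n2[OF s'] t by simp
  also have "\<dots> \<le> e * (t * norm a)" using s' e by (intro mult_left_mono) (auto simp: mult_right_mono)
  finally have r2: "norm r2 \<le> e * (t * norm a)" .
  have "Z (u + s *\<^sub>R a + t *\<^sub>R b) - Z (u + s *\<^sub>R a) = t *\<^sub>R D b + (r1 - r2)"
    by (simp add: r1_def r2_def linear_add[OF Z(1)] linear_scale[OF Z(1)])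
  then have "p t - p 0 = t * ((t *\<^sub>R D b + (r1 - r2)) \<bullet> a)" using ps by (simp add: inner_diff_left[symmetric])
  then have eq: "p t - p 0 - t\<^sup>2 * (D b \<bullet> a) = t * ((r1 - r2) \<bullet> a)"
    by (simp add: inner_add_left power2_eq_square algebra_simps)
  have "norm (r1 - r2) \<le> e * (t * (norm a + norm b)) + e * (t * norm a)"
    using norm_triangle_ineq4[of r1 r2] r1 r2 by linarith
  then have "\<bar>(r1 - r2) \<bullet> a\<bar> \<le> (e * (t * (norm a + norm b)) + e * (t * norm a)) * norm a"
    using Cauchy_Schwarz_ineq2[of "r1 - r2" a] by (meson mult_right_mono norm_ge_zero order_trans)
  then have "t * \<bar>(r1 - r2) \<bullet> a\<bar> \<le> t * ((e * (t * (norm a + norm b)) + e * (t * norm a)) * norm a)"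
    using t by (intro mult_left_mono) auto
  also have "\<dots> = t\<^sup>2 * (e * (2 * norm a + norm b) * norm a)" by (simp add: power2_eq_square algebra_simps)
  finally have "\<bar>p t - p 0 - t\<^sup>2 * (D b \<bullet> a)\<bar> \<le> t\<^sup>2 * (e * (2 * norm a + norm b) * norm a)"
    using t by (simp add: eq abs_mult)
  moreover have "p t - p 0 = h (u + t *\<^sub>R a + t *\<^sub>R b) - h (u + t *\<^sub>R a) - h (u + t *\<^sub>R b) + h u"
    by (simp add: p_def)
  ultimately show ?thesis by simp
qed

text \<open>The second difference of \<open>second_difference_estimate\<close> does not change when \<open>a\<close> and \<open>b\<close> are swapped.\<close>

lemma gradient_derivative_symmetric:
  fixes h :: "'a::euclidean_space \<Rightarrow> real" and Z :: "'a \<Rightarrow> 'a"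
  assumes h: "\<forall>\<^sub>F x in nhds u. (h has_derivative (\<lambda>k. Z x \<bullet> k)) (at x)"
    and Z: "(Z has_derivative D) (at u)"
  shows "D a \<bullet> b = D b \<bullet> a"
proof (rule ccontr)
  assume ne: "D a \<bullet> b \<noteq> D b \<bullet> a"
  have lin: "linear D" using Z has_derivative_bounded_linear bounded_linear.linear by blast
  obtain d0 where d0: "d0 > 0" "\<And>x. norm (x - u) < d0 \<Longrightarrow> (h has_derivative (\<lambda>k. Z x \<bullet> k)) (at x)"
    using h unfolding eventually_nhds_metric dist_norm by blast
  define q where "q = (2 * norm a + norm b) * norm a + (2 * norm b + norm a) * norm b + 1"
  have q: "q > 0" unfolding q_def by (intro add_nonneg_pos add_nonneg_nonneg mult_nonneg_nonneg) auto
  define e where "e = \<bar>D a \<bullet> b - D b \<bullet> a\<bar> / (2 * q)"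
  have e: "e > 0" using ne q by (simp add: e_def)
  obtain d1 where d1: "d1 > 0" "\<And>x. norm (x - u) < d1 \<Longrightarrow> norm (Z x - Z u - D (x - u)) \<le> e * norm (x - u)"
    using Z e unfolding has_derivative_at_alt by blast
  define d where "d = min d0 d1"
  define t where "t = d / (norm a + norm b + 1)"
  have d: "d > 0" using d0 d1 by (simp add: d_def)
  have pos: "norm a + norm b + 1 > 0" by (simp add: add_nonneg_pos)
  have t: "t > 0" "t * (norm a + norm b) < d" "t * (norm b + norm a) < d"
    using d pos by (simp_all add: t_def field_simps)
  define X where "X = h (u + t *\<^sub>R a + t *\<^sub>R b) - h (u + t *\<^sub>R a) - h (u + t *\<^sub>R b) + h u"
  have X1: "\<bar>X - t\<^sup>2 * (D b \<bullet> a)\<bar> \<le> t\<^sup>2 * (e * (2 * norm a + norm b) * norm a)"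
    unfolding X_def
    by (rule second_difference_estimate[where h = h and Z = Z and D = D and d = d, OF d _ lin]) (use d0 d1 e t in \<open>auto simp: d_def\<close>)
  have "\<bar>h (u + t *\<^sub>R b + t *\<^sub>R a) - h (u + t *\<^sub>R b) - h (u + t *\<^sub>R a) + h u - t\<^sup>2 * (D a \<bullet> b)\<bar>
      \<le> t\<^sup>2 * (e * (2 * norm b + norm a) * norm b)"
    by (rule second_difference_estimate[where h = h and Z = Z and D = D and d = d, OF d _ lin]) (use d0 d1 e t in \<open>auto simp: d_def\<close>)
  then have X2: "\<bar>X - t\<^sup>2 * (D a \<bullet> b)\<bar> \<le> t\<^sup>2 * (e * (2 * norm b + norm a) * norm b)"
    by (simp add: X_def algebra_simps)
  have "t\<^sup>2 * \<bar>D a \<bullet> b - D b \<bullet> a\<bar> = \<bar>t\<^sup>2 * (D a \<bullet> b) - t\<^sup>2 * (D b \<bullet> a)\<bar>"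
    by (simp add: abs_mult flip: right_diff_distrib)
  also have "\<dots> \<le> t\<^sup>2 * (e * (2 * norm a + norm b) * norm a) + t\<^sup>2 * (e * (2 * norm b + norm a) * norm b)"
    using X1 X2 by linarith
  also have "\<dots> \<le> t\<^sup>2 * (e * q)" using e by (simp add: q_def algebra_simps)
  finally have "\<bar>D a \<bullet> b - D b \<bullet> a\<bar> \<le> e * q" using t by simp
  then show False using q ne by (simp add: e_def)
qed

section \<open>Normals of smooth convex bodies\<close>

definition supports :: "'a::euclidean_space set \<Rightarrow> 'a \<Rightarrow> 'a \<Rightarrow> bool" where
  "supports K z a \<longleftrightarrow> (\<forall>x\<in>K. a \<bullet> x \<le> a \<bullet> z)"

lemma support_interior:
  assumes "supports K z a" "a \<noteq> 0" "c \<in> interior K"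
  shows "a \<bullet> c < a \<bullet> z"
proof -
  obtain e where e: "e > 0" "ball c e \<subseteq> K" using assms(3) mem_interior by blast
  define x where "x = c + (e / (2 * norm a)) *\<^sub>R a"
  have "x \<in> ball c e" using e assms(2) by (simp add: x_def dist_norm)
  then have "a \<bullet> x \<le> a \<bullet> z" using assms(1) e by (auto simp: supports_def)
  moreover have "a \<bullet> x = a \<bullet> c + e * norm a / 2"
    using assms(2) by (simp add: x_def inner_add_right dot_square_norm power2_eq_square)
  moreover have "0 < e * norm a / 2" using e assms(2) by simp
  ultimately show ?thesis by linarith
qed

lemma support_frontier:
  assumes "closed K" "z \<in> K" "supports K z a" "a \<noteq> 0"
  shows "z \<in> frontier K"
  using support_interior[OF assms(3,4), of z] assms(1,2) by (auto simp: frontier_def)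

lemma frontier_supported:
  assumes "convex_body K" "z \<in> frontier K"
  obtains a where "norm a = 1" "supports K z a"
proof -
  have K: "closed K" "convex K" "interior K \<noteq> {}"
    using assms(1) by (auto simp: convex_body_def compact_imp_closed)
  have "z \<notin> interior K" using assms(2) by (simp add: frontier_def)
  then obtain a b where ab: "a \<noteq> 0" "\<forall>x\<in>interior K. a \<bullet> x \<le> b" "a \<bullet> z \<ge> b"
    using separating_hyperplane_sets[of "interior K" "{z}"] K by auto
  have "K \<subseteq> closure (interior K)" using convex_closure_interior[OF K(2,3)] closure_subset by blast
  also have "\<dots> \<subseteq> {x. a \<bullet> x \<le> b}"
    by (rule closure_minimal) (use ab closed_halfspace_le in auto)
  finally have "supports K z a" using ab(3) by (auto simp: supports_def)
  then have "supports K z ((1 / norm a) *\<^sub>R a)" using ab(1)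
    by (auto simp: supports_def divide_right_mono)
  then show ?thesis using that[of "(1 / norm a) *\<^sub>R a"] ab(1) by simp
qed

lemma boundary_equation:
  assumes "smooth_hypersurface S" "z \<in> S"
  shows "\<exists>U f g g'. open U \<and> z \<in> U \<and> (\<forall>x\<in>U. (f has_derivative (\<lambda>h. g x \<bullet> h)) (at x)) \<and>
    (g has_derivative g') (at z) \<and> g z \<noteq> 0 \<and> S \<inter> U = {x \<in> U. f x = (0::real)}"
proof -
  obtain U f where U: "open U" "z \<in> U" and f: "smooth_on U f"
    "\<forall>x\<in>U. frechet_derivative f (at x) \<noteq> (\<lambda>h. 0)" "S \<inter> U = {x \<in> U. f x = (0::real)}"
    using assms unfolding smooth_hypersurface_def by blast
  have "Ck_on (Suc (Suc 0)) f U" using f(1) unfolding smooth_on_def by blast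
  then have df: "\<And>x. x \<in> U \<Longrightarrow> f differentiable (at x)"
    and ddf: "\<And>x h. x \<in> U \<Longrightarrow> (\<lambda>x. frechet_derivative f (at x) h) differentiable (at x)" by auto
  define g where "g = (\<lambda>x. \<Sum>b\<in>Basis. frechet_derivative f (at x) b *\<^sub>R b)"
  have lin: "linear (frechet_derivative f (at x))" if "x \<in> U" for x
    using linear_frechet_derivative df that by blast
  have g: "frechet_derivative f (at x) h = g x \<bullet> h" if "x \<in> U" for x h
  proof -
    have "frechet_derivative f (at x) h = frechet_derivative f (at x) (\<Sum>b\<in>Basis. (h \<bullet> b) *\<^sub>R b)"
      by (simp add: euclidean_representation)
    also have "\<dots> = (\<Sum>b\<in>Basis. (h \<bullet> b) * frechet_derivative f (at x) b)"
      using lin[OF that] by (simp add: linear_sum linear_scale)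
    also have "\<dots> = g x \<bullet> h" by (simp add: g_def inner_sum_left inner_commute[of h] mult.commute)
    finally show ?thesis .
  qed
  have "(f has_derivative (\<lambda>h. g x \<bullet> h)) (at x)" if "x \<in> U" for x
    using df[OF that] g[OF that] frechet_derivative_works[of f "at x"] by (metis (no_types, lifting) ext)
  moreover have "g differentiable (at z)"
    unfolding g_def using ddf[OF U(2)]
    by (intro differentiable_sum differentiable_scaleR differentiable_const) auto
  then obtain g' where "(g has_derivative g') (at z)" unfolding differentiable_def by blast
  moreover have "g z \<noteq> 0"
  proof
    assume "g z = 0"
    then have "frechet_derivative f (at z) = (\<lambda>h. 0)" using g[OF U(2)] by auto
    then show False using f(2) U(2) by blast
  qed
  ultimately show ?thesis using U f(3) by blast
qed

locale smooth_body =
  fixes K :: "'a::euclidean_space set"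
  assumes body: "convex_body K" and smooth: "smooth_hypersurface (frontier K)"
begin

lemma K_props: "compact K" "closed K" "convex K" "interior K \<noteq> {}" "bounded K"
  using body by (auto simp: convex_body_def compact_imp_closed compact_imp_bounded)

lemma frontier_subset: "frontier K \<subseteq> K"
  using K_props(2) by (simp add: frontier_subset_closed)

text \<open>Along a curve in the boundary the linear functional \<open>a\<close> has a maximum at \<open>z\<close>.\<close>

lemma tangent_space_supported:
  assumes "supports K z a" "u \<in> tangent_space (frontier K) z"
  shows "a \<bullet> u = 0"
proof -
  obtain \<gamma> e where \<gamma>: "e > 0" "\<gamma> 0 = z" "\<And>t. \<bar>t\<bar> < e \<Longrightarrow> \<gamma> t \<in> frontier K"
    "(\<gamma> has_vector_derivative u) (at 0)"
    using assms(2) unfolding tangent_space_def by blast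
  have "((\<lambda>t. a \<bullet> \<gamma> t) has_vector_derivative a \<bullet> u) (at 0)"
    using bounded_linear.has_vector_derivative[OF bounded_linear_inner_right \<gamma>(4)] .
  then have "DERIV (\<lambda>t. a \<bullet> \<gamma> t) 0 :> a \<bullet> u" by (simp add: has_real_derivative_iff_has_vector_derivative)
  then show ?thesis
  proof (rule DERIV_local_max[OF _ \<gamma>(1)])
    show "\<forall>t. \<bar>0 - t\<bar> < e \<longrightarrow> a \<bullet> \<gamma> t \<le> a \<bullet> \<gamma> 0"
      using \<gamma>(2,3) frontier_subset assms(1) by (auto simp: supports_def)
  qed
qed

text \<open>Every vector in the kernel of \<open>df(z)\<close> is the velocity of a curve in the boundary, namely of the curve of
  boundary points closest to \<open>z + t u\<close>. It is enough to find boundary points at distance \<open>o(t)\<close>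
  from \<open>z + t u\<close>, and the intermediate value theorem on the line in direction of the gradient finds them.\<close>

lemma gradient_tangent:
  assumes U: "open U" "z \<in> U" and f: "\<And>x. x \<in> U \<Longrightarrow> (f has_derivative (\<lambda>h. g x \<bullet> h)) (at x)"
    and eq: "frontier K \<inter> U = {x \<in> U. f x = (0::real)}" and z: "z \<in> frontier K"
    and g: "g z \<noteq> 0" and u: "g z \<bullet> u = 0"
  shows "u \<in> tangent_space (frontier K) z"
proof -
  let ?S = "frontier K"
  have S: "closed ?S" "?S \<noteq> {}" using z by auto
  define \<gamma> where "\<gamma> = (\<lambda>t. closest_point ?S (z + t *\<^sub>R u))"
  have in_S: "\<gamma> t \<in> ?S" for t unfolding \<gamma>_def by (rule closest_point_in_set[OF S])
  have \<gamma>0: "\<gamma> 0 = z" unfolding \<gamma>_def using closest_point_self[OF z] by simp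
  obtain r where r: "r > 0" "ball z r \<subseteq> U" using U openE by blast
  have fz: "f z = 0" using eq z U by blast
  define G where "G = norm (g z)"
  have G: "G > 0" using g by (simp add: G_def)
  have "(\<gamma> has_derivative (\<lambda>t. t *\<^sub>R u)) (at 0)"
    unfolding has_derivative_at_alt
  proof (intro conjI allI impI)
    show "bounded_linear (\<lambda>t. t *\<^sub>R u)" by (rule bounded_linear_scaleR_left)
    fix e0 :: real assume e0: "e0 > 0"
    \<comment> \<open>the displacement transversal to the boundary is at most \<open>e * \<bar>t\<bar>\<close> in units of the gradient\<close>
    define e where "e = e0 / G"
    have e: "e > 0" using e0 G by (simp add: e_def)
    define M where "M = norm u + e * G"
    have M: "M > 0" using e G by (simp add: M_def add_nonneg_pos)
    define c where "c = e * G\<^sup>2 / (2 * M)"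
    have c: "c > 0" using e G M by (simp add: c_def)
    obtain d1 where d1: "d1 > 0" "\<And>x. norm (x - z) < d1 \<Longrightarrow>
        norm (f x - f z - g z \<bullet> (x - z)) \<le> c * norm (x - z)"
      using f[OF U(2)] c unfolding has_derivative_at_alt by blast
    define d where "d = min d1 r / M"
    have d: "d > 0" using d1 r M by (simp add: d_def)
    show "\<exists>d>0. \<forall>t. norm (t - 0) < d \<longrightarrow> norm (\<gamma> t - \<gamma> 0 - (t - 0) *\<^sub>R u) \<le> e0 * norm (t - 0)"
    proof (intro exI[of _ d] conjI d allI impI)
      fix t :: real assume "norm (t - 0) < d"
      then have t: "\<bar>t\<bar> * M < min d1 r" using M by (simp add: d_def field_simps)
      define p where "p = (\<lambda>s. z + t *\<^sub>R u + s *\<^sub>R g z)"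
      have np: "norm (p s - z) \<le> \<bar>t\<bar> * M" if "\<bar>s\<bar> \<le> e * \<bar>t\<bar>" for s
      proof -
        have "norm (t *\<^sub>R u + s *\<^sub>R g z) \<le> \<bar>t\<bar> * norm u + \<bar>s\<bar> * G"
          unfolding G_def by (metis norm_scaleR norm_triangle_ineq real_norm_def)
        also have "\<dots> \<le> \<bar>t\<bar> * norm u + (e * \<bar>t\<bar>) * G"
          using that G by (intro add_left_mono mult_right_mono) auto
        finally show ?thesis by (simp add: p_def M_def algebra_simps)
      qed
      have pU: "p s \<in> U" if "\<bar>s\<bar> \<le> e * \<bar>t\<bar>" for s
        using np[OF that] t r by (auto simp: dist_norm norm_minus_commute)
      have fp: "\<bar>f (p s) - s * G\<^sup>2\<bar> \<le> e * \<bar>t\<bar> * G\<^sup>2" if s: "\<bar>s\<bar> \<le> e * \<bar>t\<bar>" for s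
      proof -
        have "\<bar>f (p s) - g z \<bullet> (p s - z)\<bar> \<le> c * norm (p s - z)"
          using d1(2)[of "p s"] np[OF s] t by (simp add: fz)
        also have "\<dots> \<le> c * (\<bar>t\<bar> * M)" using np[OF s] c by (intro mult_left_mono) auto
        also have "\<dots> = e * \<bar>t\<bar> * G\<^sup>2 / 2" using M by (simp add: c_def)
        also have "\<dots> \<le> e * \<bar>t\<bar> * G\<^sup>2" using e by simp
        finally show ?thesis by (simp add: p_def inner_add_right u G_def dot_square_norm)
      qed
      have "continuous_on {- (e * \<bar>t\<bar>)..e * \<bar>t\<bar>} (\<lambda>s. f (p s))"
      proof (rule continuous_on_compose2[where g = f and f = p and t = U])
        show "continuous_on U f"
          using f has_derivative_continuous by (intro continuous_at_imp_continuous_on) blast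
        show "continuous_on {- (e * \<bar>t\<bar>)..e * \<bar>t\<bar>} p" unfolding p_def by (intro continuous_intros)
        show "p ` {- (e * \<bar>t\<bar>)..e * \<bar>t\<bar>} \<subseteq> U" using pU by auto
      qed
      moreover have "f (p (- (e * \<bar>t\<bar>))) \<le> 0" "0 \<le> f (p (e * \<bar>t\<bar>))"
        using fp[of "- (e * \<bar>t\<bar>)"] fp[of "e * \<bar>t\<bar>"] e by (auto simp: abs_le_iff)
      moreover have "- (e * \<bar>t\<bar>) \<le> e * \<bar>t\<bar>" using e by simp
      ultimately obtain s where s: "- (e * \<bar>t\<bar>) \<le> s" "s \<le> e * \<bar>t\<bar>" "f (p s) = 0"
        using IVT'[of "\<lambda>s. f (p s)" "- (e * \<bar>t\<bar>)" 0 "e * \<bar>t\<bar>"] by blast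
      have s': "\<bar>s\<bar> \<le> e * \<bar>t\<bar>" using s by linarith
      have "p s \<in> ?S" using eq pU[OF s'] s(3) by blast
      then have "dist (z + t *\<^sub>R u) (\<gamma> t) \<le> dist (z + t *\<^sub>R u) (p s)"
        unfolding \<gamma>_def by (rule closest_point_le[OF S(1)])
      also have "\<dots> = \<bar>s\<bar> * G" by (simp add: p_def dist_norm G_def)
      also have "\<dots> \<le> (e * \<bar>t\<bar>) * G" using s' G by (intro mult_right_mono) auto
      also have "\<dots> = e0 * \<bar>t\<bar>" using G by (simp add: e_def)
      finally show "norm (\<gamma> t - \<gamma> 0 - (t - 0) *\<^sub>R u) \<le> e0 * norm (t - 0)"
        by (simp add: \<gamma>0 dist_norm norm_minus_commute algebra_simps)
    qed
  qed
  then have "(\<gamma> has_vector_derivative u) (at 0)" by (simp add: has_vector_derivative_def)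
  then show ?thesis unfolding tangent_space_def using in_S \<gamma>0
    by (intro CollectI exI[of _ \<gamma>] exI[of _ 1]) auto
qed

lemma parallel_if_orthogonal:
  fixes a g :: 'a
  assumes "g \<noteq> 0" "\<And>u. g \<bullet> u = 0 \<Longrightarrow> a \<bullet> u = 0"
  shows "\<exists>c. a = c *\<^sub>R g"
proof -
  define r where "r = a - ((a \<bullet> g) / (g \<bullet> g)) *\<^sub>R g"
  have gr: "g \<bullet> r = 0" using assms(1) by (simp add: r_def inner_diff_right inner_commute)
  then have "a \<bullet> r = 0" by (rule assms(2))
  then have "r \<bullet> r = 0" using gr by (simp add: r_def inner_diff_left)
  then have "a = ((a \<bullet> g) / (g \<bullet> g)) *\<^sub>R g" by (simp add: r_def)
  then show ?thesis by blast
qed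

lemma support_normal_parallel:
  assumes U: "open U" "z \<in> U" and f: "\<And>x. x \<in> U \<Longrightarrow> (f has_derivative (\<lambda>h. g x \<bullet> h)) (at x)"
    and eq: "frontier K \<inter> U = {x \<in> U. f x = (0::real)}" and z: "z \<in> frontier K"
    and g: "g z \<noteq> 0" and a: "\<And>u. u \<in> tangent_space (frontier K) z \<Longrightarrow> a \<bullet> u = 0"
  shows "\<exists>c. a = c *\<^sub>R g z"
  by (rule parallel_if_orthogonal[OF g]) (use a gradient_tangent[OF U f eq z g] in blast)

lemma unit_normals_opposite:
  assumes z: "z \<in> frontier K" and "norm a = 1" "norm b = 1"
    and a: "\<And>u. u \<in> tangent_space (frontier K) z \<Longrightarrow> a \<bullet> u = 0"
    and b: "\<And>u. u \<in> tangent_space (frontier K) z \<Longrightarrow> b \<bullet> u = 0"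
  shows "b = a \<or> b = - a"
proof -
  obtain U f g g' where U: "open U" "z \<in> U" and f0: "\<forall>x\<in>U. (f has_derivative (\<lambda>h. g x \<bullet> h)) (at x)"
    and "(g has_derivative g') (at z)" and g: "g z \<noteq> 0" and eq: "frontier K \<inter> U = {x \<in> U. f x = (0::real)}"
    using boundary_equation[OF smooth z] by blast
  note f = f0[rule_format]
  obtain c where c: "a = c *\<^sub>R g z" using support_normal_parallel[OF U f eq z g a] by blast
  obtain d where d: "b = d *\<^sub>R g z" using support_normal_parallel[OF U f eq z g b] by blast
  have "\<bar>c\<bar> * norm (g z) = \<bar>d\<bar> * norm (g z)" using assms(2,3) c d by simp
  then have "\<bar>c\<bar> = \<bar>d\<bar>" using g by simp
  then have "d = c \<or> d = - c" by linarith
  then show ?thesis using c d by auto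
qed

lemma support_unit_unique:
  assumes z: "z \<in> frontier K" and a: "norm a = 1" "supports K z a" and b: "norm b = 1" "supports K z b"
  shows "b = a"
proof (rule ccontr)
  assume "b \<noteq> a"
  then have "b = - a"
    using unit_normals_opposite[OF z a(1) b(1)] tangent_space_supported a(2) b(2) by blast
  moreover obtain c where "c \<in> interior K" using K_props(4) by blast
  then have "a \<bullet> c < a \<bullet> z" "b \<bullet> c < b \<bullet> z"
    using support_interior a b by (metis norm_zero zero_neq_one)+
  ultimately show False by simp
qed

text \<open>Otherwise a hyperplane separates \<open>K\<close> from the segment that leaves \<open>z\<close> in direction \<open>- a\<close>. Its normal supports \<open>K\<close>
  at \<open>z\<close> and so equals \<open>a\<close> up to scaling, but \<open>- a\<close> points to the wrong side of it.\<close>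

lemma inward_segment:
  assumes z: "z \<in> frontier K" and a: "norm a = 1" "supports K z a" and e: "e > 0"
  shows "\<exists>s. 0 < s \<and> s < e \<and> z - s *\<^sub>R a \<in> K"
proof (rule ccontr)
  assume none: "\<nexists>s. 0 < s \<and> s < e \<and> z - s *\<^sub>R a \<in> K"
  define R where "R = (\<lambda>s. z - s *\<^sub>R a) ` {0<..<e}"
  have "R = (+) z ` ((\<lambda>s. s *\<^sub>R (- a)) ` {0<..<e})" by (auto simp: R_def image_image)
  moreover have "convex ((\<lambda>s. s *\<^sub>R (- a)) ` {0<..<e})"
    by (intro convex_linear_image bounded_linear.linear[OF bounded_linear_scaleR_left]) auto
  ultimately have cR: "convex R" by (simp add: convex_translation)
  have nR: "R \<noteq> {}" using e by (auto simp: R_def)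
  have KR: "K \<inter> R = {}" using none by (auto simp: R_def)
  have nK: "K \<noteq> {}" using K_props(4) interior_subset by auto
  obtain b c where b: "b \<noteq> 0" "\<forall>x\<in>K. b \<bullet> x \<le> c" "\<forall>x\<in>R. c \<le> b \<bullet> x"
    using separating_hyperplane_sets[OF K_props(3) cR nK nR KR] by blast
  have bs: "c \<le> b \<bullet> z - s * (b \<bullet> a)" if "0 < s" "s < e" for s
  proof -
    have "z - s *\<^sub>R a \<in> R" unfolding R_def by (rule imageI) (use that in simp)
    then have "c \<le> b \<bullet> (z - s *\<^sub>R a)" by (rule b(3)[rule_format])
    then show ?thesis by (simp add: inner_diff_right)
  qed
  have zK: "z \<in> K" using z frontier_subset by blast
  have neg: "b \<bullet> a \<le> 0"
  proof (rule ccontr)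
    assume "\<not> b \<bullet> a \<le> 0"
    moreover have "(e / 2) * (b \<bullet> a) \<le> 0" using bs[of "e / 2"] e b(2) zK by fastforce
    ultimately show False using e by (simp add: mult_le_0_iff)
  qed
  have "c \<le> b \<bullet> z"
  proof (rule field_le_epsilon)
    fix r :: real assume r: "r > 0"
    define s where "s = min (e / 2) (r / (1 - b \<bullet> a))"
    have s: "0 < s" "s < e" using e r neg by (auto simp: s_def min_less_iff_disj)
    have "s * (1 - b \<bullet> a) \<le> r"
      using neg pos_le_divide_eq[of "1 - b \<bullet> a" s r] by (simp add: s_def)
    then show "c \<le> b \<bullet> z + r" using bs[OF s] s by (simp add: algebra_simps)
  qed
  then have "supports K z ((1 / norm b) *\<^sub>R b)"
    using b(1,2) by (force simp: supports_def intro!: divide_right_mono)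
  then have "(1 / norm b) *\<^sub>R b = a"
    using support_unit_unique[OF z a, of "(1 / norm b) *\<^sub>R b"] b(1) by simp
  then have "b \<bullet> ((1 / norm b) *\<^sub>R b) \<le> 0" using neg by simp
  then show False using b(1) by (simp add: dot_square_norm power2_eq_square)
qed

text \<open>The outer normal is the only unit normal that supports \<open>K\<close>: the opposite unit vector is excluded by
  \<open>inward_segment\<close>.\<close>

lemma outer_normal_eqI:
  assumes z: "z \<in> frontier K" and a: "norm a = 1" "supports K z a"
  shows "outer_normal K z = a"
  unfolding outer_normal_def
proof (rule the_equality)
  have "z + s *\<^sub>R a \<notin> K" if "s > 0" for s
  proof
    assume "z + s *\<^sub>R a \<in> K"
    then have "a \<bullet> (z + s *\<^sub>R a) \<le> a \<bullet> z" using a(2) by (simp add: supports_def)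
    then show False using that a(1) by (simp add: inner_add_right dot_square_norm)
  qed
  then show "norm a = 1 \<and> (\<forall>u\<in>tangent_space (frontier K) z. a \<bullet> u = 0) \<and>
      (\<exists>e>0. \<forall>s. 0 < s \<and> s < e \<longrightarrow> z + s *\<^sub>R a \<notin> K)"
    using a tangent_space_supported[OF a(2)] by (intro conjI exI[of _ 1]) auto
  fix b assume b: "norm b = 1 \<and> (\<forall>u\<in>tangent_space (frontier K) z. b \<bullet> u = 0) \<and>
      (\<exists>e>0. \<forall>s. 0 < s \<and> s < e \<longrightarrow> z + s *\<^sub>R b \<notin> K)"
  then have "b = a \<or> b = - a"
    using unit_normals_opposite[OF z a(1)] tangent_space_supported[OF a(2)] by blast
  moreover have "b \<noteq> - a"
  proof
    assume ba: "b = - a"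
    obtain e where "e > 0" "\<And>s. 0 < s \<Longrightarrow> s < e \<Longrightarrow> z + s *\<^sub>R b \<notin> K" using b by blast
    then show False using inward_segment[OF z a, of e] ba by auto
  qed
  ultimately show "b = a" by blast
qed

lemma outer_normal_supports:
  assumes "z \<in> frontier K"
  shows "norm (outer_normal K z) = 1" "supports K z (outer_normal K z)"
proof -
  obtain a where a: "norm a = 1" "supports K z a" using frontier_supported[OF body assms] by blast
  then show "norm (outer_normal K z) = 1" "supports K z (outer_normal K z)"
    using outer_normal_eqI[OF assms a] by simp_all
qed

text \<open>Near a boundary point the outer normal is the normalised gradient of a local equation up to a sign. The
  sign is locally constant because it can be read off from the position of a fixed interior point
  \<open>c\<close>.\<close>

lemma outer_normal_extension:
  assumes z: "z \<in> frontier K"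
  obtains V N N' f b where "open V" "z \<in> V" "(N has_derivative N') (at z)"
    "\<And>x. x \<in> frontier K \<inter> V \<Longrightarrow> outer_normal K x = N x" "\<And>x. x \<in> V \<Longrightarrow> norm (N x) = 1"
    "(f has_derivative (\<lambda>h. b \<bullet> h)) (at z)" "\<And>x. x \<in> frontier K \<inter> V \<Longrightarrow> f x = (0::real)"
    "b \<noteq> 0" "\<And>u. b \<bullet> u = 0 \<Longrightarrow> u \<in> tangent_space (frontier K) z"
proof -
  obtain U f g g' where U: "open U" "z \<in> U" and f0: "\<forall>x\<in>U. (f has_derivative (\<lambda>h. g x \<bullet> h)) (at x)"
    and g': "(g has_derivative g') (at z)" and g: "g z \<noteq> 0" and eq: "frontier K \<inter> U = {x \<in> U. f x = (0::real)}"
    using boundary_equation[OF smooth z] by blast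
  note f = f0[rule_format]
  obtain c where c: "c \<in> interior K" using K_props(4) by blast
  define q where "q = (\<lambda>x. g x \<bullet> (x - c))"
  have par: "\<exists>k. outer_normal K x = k *\<^sub>R g x" if x: "x \<in> frontier K" "x \<in> U" "g x \<noteq> 0" for x
    by (rule support_normal_parallel[OF U(1) x(2) f eq x(1) x(3)])
      (assumption | rule tangent_space_supported[OF outer_normal_supports(2)[OF x(1)]])+
  have sgn: "outer_normal K x = (sgn (q x) / norm (g x)) *\<^sub>R g x \<and> q x \<noteq> 0"
    if x: "x \<in> frontier K" "x \<in> U" "g x \<noteq> 0" for x
  proof -
    obtain k where k: "outer_normal K x = k *\<^sub>R g x" using par[OF x] by blast
    note n = outer_normal_supports[OF x(1)]
    have "outer_normal K x \<noteq> 0" using n(1) by auto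
    then have "outer_normal K x \<bullet> c < outer_normal K x \<bullet> x" by (rule support_interior[OF n(2) _ c])
    then have pos: "k * q x > 0" by (simp add: k q_def inner_diff_right algebra_simps)
    have "\<bar>k\<bar> * norm (g x) = 1" using n(1) k by simp
    then have "\<bar>k\<bar> = 1 / norm (g x)" using x(3) by (simp add: field_simps)
    moreover have "k = sgn (q x) * \<bar>k\<bar>" using pos by (auto simp: sgn_if zero_less_mult_iff)
    ultimately show ?thesis using k pos by auto
  qed
  define sg where "sg = sgn (q z)"
  have qz: "q z \<noteq> 0" using sgn[OF z U(2) g] by blast
  have contg: "isCont g z" by (rule has_derivative_continuous[OF g'])
  then have contq: "isCont q z" unfolding q_def by (intro continuous_intros)
  have "isCont (\<lambda>x. sg * q x) z" by (intro continuous_intros contq)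
  moreover have "sg * q z > 0" using qz by (auto simp: sg_def sgn_if)
  ultimately have "\<forall>\<^sub>F x in nhds z. sg * q x > 0"
    unfolding isCont_def tendsto_at_iff_tendsto_nhds[of "\<lambda>x. sg * q x" z] by (rule order_tendstoD)
  moreover have "\<forall>\<^sub>F x in nhds z. g x \<in> - {0}"
    using contg g unfolding isCont_def tendsto_at_iff_tendsto_nhds[of g z]
    by (intro topological_tendstoD) auto
  moreover have "\<forall>\<^sub>F x in nhds z. x \<in> U" using U eventually_nhds by blast
  ultimately have "\<forall>\<^sub>F x in nhds z. sg * q x > 0 \<and> g x \<in> - {0} \<and> x \<in> U" by eventually_elim auto
  then obtain V where V: "open V" "z \<in> V" "\<And>x. x \<in> V \<Longrightarrow> sg * q x > 0 \<and> g x \<in> - {0} \<and> x \<in> U"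
    unfolding eventually_nhds by blast
  define N where "N = (\<lambda>x. (sg / norm (g x)) *\<^sub>R g x)"
  have "(\<lambda>x. norm (g x)) differentiable (at z)"
    using differentiable_compose[of norm g z UNIV] differentiable_norm_at[OF g] g'
    by (auto simp: differentiable_def)
  then have "N differentiable (at z)"
    unfolding N_def using g g'
    by (intro differentiable_scaleR differentiable_divide differentiable_const) (auto simp: differentiable_def)
  then obtain N' where N': "(N has_derivative N') (at z)" unfolding differentiable_def by blast
  have sg: "\<bar>sg\<bar> = 1" using qz by (simp add: sg_def abs_sgn_eq)
  show ?thesis
  proof (rule that[OF V(1,2) N' _ _ f[OF U(2)] _ g])
    show "outer_normal K x = N x" if x: "x \<in> frontier K \<inter> V" for x
    proof -
      have "sgn (q x) = sg" using V(3)[of x] x sg by (auto simp: sgn_if zero_less_mult_iff sg_def split: if_splits)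
      then show ?thesis using sgn[of x] V(3)[of x] x by (auto simp: N_def)
    qed
    show "norm (N x) = 1" if "x \<in> V" for x using V(3)[OF that] sg by (simp add: N_def)
    show "f x = 0" if "x \<in> frontier K \<inter> V" for x using that V(3)[of x] eq by blast
    show "u \<in> tangent_space (frontier K) z" if "g z \<bullet> u = 0" for u
      by (rule gradient_tangent[OF U f eq z g that])
  qed
qed

end

section \<open>Support points of strongly convex bodies\<close>

lemma derivative_along_curve:
  assumes F: "(F has_derivative D) (at z within S)" and e: "e > 0" "\<gamma> 0 = z"
    "\<And>t. \<bar>t\<bar> < e \<Longrightarrow> \<gamma> t \<in> S" and \<gamma>: "(\<gamma> has_vector_derivative u) (at 0)"
  shows "((\<lambda>t. F (\<gamma> t)) has_vector_derivative D u) (at (0::real))"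
proof -
  let ?T = "{-e<..<e}"
  have "(F has_derivative D) (at (\<gamma> 0) within \<gamma> ` ?T)"
    by (rule has_derivative_subset[OF F[folded e(2)]]) (use e(3) in force)
  then have "((F \<circ> \<gamma>) has_vector_derivative D u) (at 0 within ?T)"
    using vector_derivative_diff_chain_within[OF has_vector_derivative_at_within[OF \<gamma>]] by blast
  then show ?thesis using e(1) by (simp add: at_within_open[of 0 ?T] o_def)
qed

locale strongly_convex_body = smooth_body +
  assumes strong: "strongly_convex K"
begin

text \<open>The second fundamental form is defined through some derivative of the Gauss map relative to the boundary.
  On tangent vectors, which are velocities of curves in the boundary, it agrees with the derivative of
  any extension.\<close>

lemma gauss_map_positive:
  assumes z: "z \<in> frontier K" and V: "open V" "z \<in> V" and N: "(N has_derivative N') (at z)"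
    and eq: "\<And>x. x \<in> frontier K \<inter> V \<Longrightarrow> outer_normal K x = N x"
    and u: "u \<in> tangent_space (frontier K) z" "u \<noteq> 0"
  shows "N' u \<bullet> u > 0"
proof -
  obtain d where d: "d > 0" "ball z d \<subseteq> V" using V openE by blast
  have dN: "(outer_normal K has_derivative N') (at z within frontier K)"
  proof (rule has_derivative_transform_within[OF has_derivative_at_withinI[OF N] d(1) z])
    show "N x = outer_normal K x" if "x \<in> frontier K" "dist x z < d" for x
      using eq[of x] that d(2) by (force simp: dist_commute)
  qed
  define D where "D = frechet_derivative (outer_normal K) (at z within frontier K)"
  have dD: "(outer_normal K has_derivative D) (at z within frontier K)"
    using dN unfolding D_def differentiable_def by (metis frechet_derivative_works differentiable_def)
  obtain \<gamma> e where \<gamma>: "e > 0" "\<gamma> 0 = z" "\<And>t. \<bar>t\<bar> < e \<Longrightarrow> \<gamma> t \<in> frontier K"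
    "(\<gamma> has_vector_derivative u) (at 0)"
    using u(1) unfolding tangent_space_def by blast
  have "D u = N' u"
    using vector_derivative_unique_at[OF derivative_along_curve[OF dD \<gamma>] derivative_along_curve[OF dN \<gamma>]] .
  moreover have "D u \<bullet> u > 0"
    using strong z u unfolding strongly_convex_def second_fundamental_form_def D_def by blast
  ultimately show ?thesis by simp
qed

text \<open>If a supporting hyperplane touched \<open>K\<close> in two points, the segment between them would lie in the boundary
  and the Gauss map would be constant along it, so that the second fundamental form would vanish.\<close>

lemma supports_unique:
  assumes "a \<noteq> 0" "x \<in> K" "supports K x a" "y \<in> K" "supports K y a"
  shows "x = y"
proof (rule ccontr)
  assume "x \<noteq> y"
  define n where "n = (1 / norm a) *\<^sub>R a"
  define w where "w = (1 / 2) *\<^sub>R (x + y)"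
  define u where "u = y - x"
  have u0: "u \<noteq> 0" using \<open>x \<noteq> y\<close> by (simp add: u_def)
  have axy: "a \<bullet> x = a \<bullet> y" using assms by (force simp: supports_def)
  have n: "norm n = 1" using assms(1) by (simp add: n_def)
  define \<gamma> where "\<gamma> = (\<lambda>t. w + t *\<^sub>R u)"
  have \<gamma>K: "\<gamma> t \<in> K" if "\<bar>t\<bar> < 1 / 2" for t
  proof -
    have "\<gamma> t = (1 / 2 - t) *\<^sub>R x + (1 / 2 + t) *\<^sub>R y"
      by (simp add: \<gamma>_def w_def u_def algebra_simps)
    then show ?thesis using convexD[OF K_props(3) assms(2,4), of "1 / 2 - t" "1 / 2 + t"] that by force
  qed
  have \<gamma>s: "supports K (\<gamma> t) n" for t
  proof -
    have "a \<bullet> \<gamma> t = a \<bullet> x"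
      by (simp add: \<gamma>_def w_def u_def inner_add_right inner_diff_right axy)
    then show ?thesis using assms(1,3) by (auto simp: supports_def n_def divide_right_mono)
  qed
  have n0: "n \<noteq> 0" using n by auto
  have \<gamma>F: "\<gamma> t \<in> frontier K" if "\<bar>t\<bar> < 1 / 2" for t
    by (rule support_frontier[OF K_props(2) \<gamma>K[OF that] \<gamma>s n0])
  have \<gamma>N: "outer_normal K (\<gamma> t) = n" if "\<bar>t\<bar> < 1 / 2" for t
    by (rule outer_normal_eqI[OF \<gamma>F[OF that] n \<gamma>s])
  have w: "w \<in> frontier K" using \<gamma>F[of 0] by (simp add: \<gamma>_def)
  have d\<gamma>: "(\<gamma> has_vector_derivative u) (at 0)"
    unfolding \<gamma>_def by (auto intro!: derivative_eq_intros simp: has_vector_derivative_def)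
  have uT: "u \<in> tangent_space (frontier K) w"
    unfolding tangent_space_def using \<gamma>F d\<gamma> by (intro CollectI exI[of _ \<gamma>] exI[of _ "1 / 2"]) (auto simp: \<gamma>_def)
  show False
  proof (rule outer_normal_extension[OF w])
    fix V N N' f b
    assume V: "open V" "w \<in> V" and N: "(N has_derivative N') (at w)"
      and eq: "\<And>x. x \<in> frontier K \<inter> V \<Longrightarrow> outer_normal K x = N x"
    have pos: "N' u \<bullet> u > 0" by (rule gauss_map_positive[OF w V N eq uT u0])
    have "((\<lambda>t. N (\<gamma> t)) has_vector_derivative N' u) (at 0)"
      by (rule derivative_along_curve[where S = UNIV and e = 1]) (use N d\<gamma> in \<open>auto simp: \<gamma>_def\<close>)
    moreover have "open (\<gamma> -` V \<inter> {-1/2<..<1/2})"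
      by (intro open_Int continuous_open_vimage V) (auto simp: \<gamma>_def intro!: continuous_intros)
    moreover have "0 \<in> \<gamma> -` V \<inter> {-1/2<..<1/2}" using V by (simp add: \<gamma>_def)
    moreover have "N (\<gamma> t) = n" if "t \<in> \<gamma> -` V \<inter> {-1/2<..<1/2}" for t
      using eq[of "\<gamma> t"] \<gamma>N[of t] \<gamma>F[of t] that by auto
    ultimately have "((\<lambda>t. n) has_vector_derivative N' u) (at 0)"
      by (rule has_vector_derivative_transform_within_open)
    then have "N' u = 0" using vector_derivative_unique_at has_vector_derivative_const by blast
    then show False using pos by simp
  qed
qed

definition support_point :: "'a \<Rightarrow> 'a" where
  "support_point u = (SOME x. x \<in> K \<and> supports K x u)"

lemma support_point: "support_point u \<in> K" "supports K (support_point u) u"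
proof -
  have "K \<noteq> {}" using K_props(4) interior_subset by auto
  then have "\<exists>x\<in>K. \<forall>y\<in>K. u \<bullet> y \<le> u \<bullet> x"
    by (intro continuous_attains_sup K_props(1) continuous_intros)
  then have "\<exists>x. x \<in> K \<and> supports K x u" by (auto simp: supports_def)
  from someI_ex[OF this] show "support_point u \<in> K" "supports K (support_point u) u"
    unfolding support_point_def by auto
qed

lemma support_point_max: "x \<in> K \<Longrightarrow> u \<bullet> x \<le> u \<bullet> support_point u"
  using support_point(2) by (simp add: supports_def)

lemma support_point_eqI: "u \<noteq> 0 \<Longrightarrow> x \<in> K \<Longrightarrow> supports K x u \<Longrightarrow> support_point u = x"
  using supports_unique support_point by blast

lemma support_point_eqI': "u \<noteq> 0 \<Longrightarrow> x \<in> K \<Longrightarrow> u \<bullet> support_point u \<le> u \<bullet> x \<Longrightarrow> support_point u = x"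
  by (rule support_point_eqI) (auto simp: supports_def intro: order_trans[OF support_point_max])

lemma support_point_scale: "r > 0 \<Longrightarrow> support_point (r *\<^sub>R u) = support_point u"
proof (cases "u = 0")
  case False
  assume "r > 0"
  then show ?thesis using False support_point[of u]
    by (intro support_point_eqI) (auto simp: supports_def)
qed simp

lemma support_point_frontier: "u \<noteq> 0 \<Longrightarrow> support_point u \<in> frontier K"
  by (rule support_frontier[OF K_props(2) support_point])

lemma outer_normal_support_point:
  assumes "u \<noteq> 0"
  shows "outer_normal K (support_point u) = (1 / norm u) *\<^sub>R u"
  by (rule outer_normal_eqI[OF support_point_frontier[OF assms]])
    (use assms support_point[of u] in \<open>auto simp: supports_def divide_right_mono\<close>)

lemma support_point_outer_normal:
  assumes "x \<in> frontier K"
  shows "support_point (outer_normal K x) = x"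
  using outer_normal_supports[OF assms] frontier_subset assms
  by (intro support_point_eqI) auto

lemma support_point_injective:
  assumes "u \<noteq> 0" "w \<noteq> 0" "support_point u = support_point w"
  shows "(1 / norm u) *\<^sub>R u = (1 / norm w) *\<^sub>R w"
  using outer_normal_support_point[OF assms(1)] outer_normal_support_point[OF assms(2)] assms(3) by simp

text \<open>On the points of \<open>K\<close> at distance at least \<open>e\<close> from the support point the functional \<open>u\<close> stays away from its
  maximum, by compactness and strict convexity.\<close>

lemma isCont_support_point:
  assumes u: "u \<noteq> 0"
  shows "isCont support_point u"
  unfolding continuous_at_eps_delta dist_norm
proof (intro allI impI)
  fix e :: real assume e: "e > 0"
  obtain B where B: "B > 0" "\<And>x. x \<in> K \<Longrightarrow> norm x \<le> B" using K_props(5) bounded_pos by metis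
  let ?p = "support_point u"
  define C where "C = K \<inter> {x. norm (x - ?p) \<ge> e}"
  have "closed {x. norm (x - ?p) \<ge> e}" by (intro closed_Collect_le continuous_intros)
  then have C: "compact C" unfolding C_def by (intro compact_Int_closed K_props(1))
  show "\<exists>d>0. \<forall>x. norm (x - u) < d \<longrightarrow> norm (support_point x - ?p) < e"
  proof (cases "C = {}")
    case True
    then have "\<not> e \<le> norm (support_point x - ?p)" for x
      using support_point(1)[of x] unfolding C_def by blast
    then show ?thesis by (intro exI[of _ 1]) (simp add: not_le)
  next
    case False
    have "continuous_on C (\<lambda>x. u \<bullet> x)" by (intro continuous_intros)
    then obtain c where c: "c \<in> C" "\<forall>x\<in>C. u \<bullet> x \<le> u \<bullet> c"
      using continuous_attains_sup[OF C False] by blast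
    have "u \<bullet> c \<noteq> u \<bullet> ?p" using support_point_eqI'[OF u, of c] c(1) e by (auto simp: C_def)
    then have gap: "u \<bullet> c < u \<bullet> ?p" using support_point_max[of c u] c(1) by (simp add: C_def)
    define d where "d = (u \<bullet> ?p - u \<bullet> c) / (2 * B)"
    have d: "d > 0" using gap B by (simp add: d_def)
    have "norm (support_point x - ?p) < e" if x: "norm (x - u) < d" for x
    proof (rule ccontr)
      assume "\<not> norm (support_point x - ?p) < e"
      then have "support_point x \<in> C" using support_point(1) by (simp add: C_def)
      then have 1: "u \<bullet> support_point x \<le> u \<bullet> c" using c(2) by blast
      have 2: "x \<bullet> ?p \<le> x \<bullet> support_point x" by (rule support_point_max[OF support_point(1)])
      have "(x - u) \<bullet> (support_point x - ?p) \<le> norm (x - u) * norm (support_point x - ?p)"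
        by (rule norm_cauchy_schwarz)
      also have "\<dots> \<le> norm (x - u) * (2 * B)"
        using B(2)[OF support_point(1)[of x]] B(2)[OF support_point(1)[of u]]
        by (intro mult_left_mono order_trans[OF norm_triangle_ineq4]) auto
      also have "\<dots> < d * (2 * B)" using x B(1) by simp
      also have "\<dots> = u \<bullet> ?p - u \<bullet> c" using B(1) by (simp add: d_def)
      finally have "(x - u) \<bullet> (support_point x - ?p) < u \<bullet> ?p - u \<bullet> c" .
      then show False using 1 2 by (simp add: inner_diff_left inner_diff_right)
    qed
    then show ?thesis using d by blast
  qed
qed

text \<open>The gradient of the support function of \<open>K\<close> is the support point.\<close>

lemma support_function_derivative:
  assumes u: "u \<noteq> 0"
  shows "((\<lambda>x. support_point x \<bullet> x) has_derivative (\<lambda>k. support_point u \<bullet> k)) (at u)"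
  unfolding has_derivative_at_alt
proof (intro conjI allI impI)
  show "bounded_linear (\<lambda>k. support_point u \<bullet> k)" by (rule bounded_linear_inner_right)
  fix e :: real assume e: "e > 0"
  then obtain d where d: "d > 0" "\<And>x. norm (x - u) < d \<Longrightarrow> norm (support_point x - support_point u) < e"
    using isCont_support_point[OF u] unfolding continuous_at_eps_delta dist_norm by metis
  show "\<exists>d>0. \<forall>x. norm (x - u) < d \<longrightarrow>
      norm (support_point x \<bullet> x - support_point u \<bullet> u - support_point u \<bullet> (x - u)) \<le> e * norm (x - u)"
  proof (intro exI[of _ d] conjI d(1) allI impI)
    fix x assume x: "norm (x - u) < d"
    let ?q = "support_point x - support_point u"
    have 1: "0 \<le> ?q \<bullet> x" using support_point_max[OF support_point(1), of x u]
      by (simp add: inner_diff_left inner_diff_right inner_commute)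
    have 2: "?q \<bullet> u \<le> 0" using support_point_max[OF support_point(1), of u x]
      by (simp add: inner_diff_left inner_diff_right inner_commute)
    have "?q \<bullet> x \<le> ?q \<bullet> (x - u)" using 2 by (simp add: inner_diff_right)
    also have "\<dots> \<le> norm ?q * norm (x - u)" by (rule norm_cauchy_schwarz)
    also have "\<dots> \<le> e * norm (x - u)" using d(2)[OF x] by (intro mult_right_mono) auto
    finally have "?q \<bullet> x \<le> e * norm (x - u)" .
    moreover have "support_point x \<bullet> x - support_point u \<bullet> u - support_point u \<bullet> (x - u) = ?q \<bullet> x"
      by (simp add: inner_diff_left inner_diff_right)
    ultimately show "norm (support_point x \<bullet> x - support_point u \<bullet> u - support_point u \<bullet> (x - u))
        \<le> e * norm (x - u)" using 1 by simp
  qed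
qed

text \<open>The support point solves \<open>N (z(u)) = u / norm u\<close> and \<open>f (z(u)) = 0\<close>, where \<open>f\<close> is a local equation of the
  boundary and \<open>N\<close> extends the Gauss map.\<close>

theorem support_point_differentiable:
  assumes u: "u \<noteq> 0"
  shows "support_point differentiable (at u)"
proof (rule outer_normal_extension[OF support_point_frontier[OF u]])
  let ?z = "support_point u"
  fix V N N' f b
  assume V: "open V" "?z \<in> V" and N: "(N has_derivative N') (at ?z)"
    and eq: "\<And>x. x \<in> frontier K \<inter> V \<Longrightarrow> outer_normal K x = N x"
    and unit: "\<And>x. x \<in> V \<Longrightarrow> norm (N x) = 1"
    and f: "(f has_derivative (\<lambda>h. b \<bullet> h)) (at ?z)" and f0: "\<And>x. x \<in> frontier K \<inter> V \<Longrightarrow> f x = (0::real)"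
    and b: "b \<noteq> 0" and tan: "\<And>h. b \<bullet> h = 0 \<Longrightarrow> h \<in> tangent_space (frontier K) ?z"
  note zF = support_point_frontier[OF u]
  have fz: "f ?z = 0" using f0 zF V by blast
  \<comment> \<open>Both equations in one: \<open>DN\<close> has values orthogonal to the normal, whereas the summand with \<open>f\<close> sees
    the direction transversal to the boundary. Hence \<open>L\<close> is injective by strong convexity.\<close>
  define F where "F = (\<lambda>x. N x + f x *\<^sub>R N x)"
  define L where "L = (\<lambda>h. N' h + (b \<bullet> h) *\<^sub>R N ?z)"
  have FL: "(F has_derivative L) (at ?z)"
    unfolding F_def
    by (rule has_derivative_eq_rhs[OF has_derivative_add[OF N has_derivative_scaleR[OF f N]]])
      (simp add: L_def fz)
  have lin: "linear L" using FL has_derivative_bounded_linear bounded_linear.linear by blast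
  have orth: "N' h \<bullet> N ?z = 0" for h
  proof -
    have "((\<lambda>x. N x \<bullet> N x) has_derivative (\<lambda>h. N ?z \<bullet> N' h + N' h \<bullet> N ?z)) (at ?z)"
      by (rule has_derivative_inner[OF N N])
    moreover have "((\<lambda>x. N x \<bullet> N x) has_derivative (\<lambda>h. 0)) (at ?z)"
      by (rule has_derivative_transform_within_open[OF has_derivative_const[of 1] V])
        (use unit in \<open>simp add: dot_square_norm\<close>)
    ultimately have "(\<lambda>h. N ?z \<bullet> N' h + N' h \<bullet> N ?z) = (\<lambda>h. 0)" by (rule has_derivative_unique)
    then have "N ?z \<bullet> N' h + N' h \<bullet> N ?z = 0" by (rule fun_cong)
    then show ?thesis by (simp add: inner_commute)
  qed
  have inj: "inj L"
  proof (subst linear_injective_0[OF lin], intro allI impI)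
    fix h assume h: "L h = 0"
    have "L h \<bullet> N ?z = b \<bullet> h" using unit[OF V(2)] by (simp add: L_def inner_add_left orth dot_square_norm)
    then have bh: "b \<bullet> h = 0" using h by simp
    then have "N' h = 0" using h by (simp add: L_def)
    then show "h = 0" using gauss_map_positive[OF zF V N eq tan[OF bh]] by fastforce
  qed
  obtain G where "linear G" "G \<circ> L = id" using linear_injective_left_inverse[OF lin inj] by blast
  then have G: "\<exists>G. bounded_linear G \<and> G \<circ> L = id" by (auto simp: linear_conv_bounded_linear)
  have "(\<lambda>x::'a. (1 / norm x) *\<^sub>R x) differentiable (at u)"
    using u by (intro differentiable_scaleR differentiable_divide differentiable_const differentiable_norm_at differentiable_ident) auto
  then obtain R where R: "((\<lambda>x::'a. (1 / norm x) *\<^sub>R x) has_derivative R) (at u)"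
    unfolding differentiable_def by blast
  have "\<forall>\<^sub>F x in nhds u. support_point x \<in> V"
    using isCont_support_point[OF u] V
    unfolding isCont_def tendsto_at_iff_tendsto_nhds[of support_point u] by (intro topological_tendstoD)
  then obtain T where T: "open T" "u \<in> T" "\<And>x. x \<in> T \<Longrightarrow> support_point x \<in> V"
    unfolding eventually_nhds by blast
  have "((\<lambda>x. F (support_point x)) has_derivative R) (at u)"
  proof (rule has_derivative_transform_within_open[OF R, of "T \<inter> - {0}"])
    fix x assume x: "x \<in> T \<inter> - {0}"
    then have m: "support_point x \<in> frontier K \<inter> V" using T support_point_frontier by blast
    have "F (support_point x) = outer_normal K (support_point x)" using eq[OF m] f0[OF m] by (simp add: F_def)
    then show "(1 / norm x) *\<^sub>R x = F (support_point x)" using outer_normal_support_point x by simp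
  qed (use T u in \<open>auto intro!: open_Int\<close>)
  then show "support_point differentiable (at u)"
    by (rule differentiable_implicit[OF FL inj G isCont_support_point[OF u]])
qed

end

section \<open>The outer billiard map\<close>

text \<open>An affine plane is determined by a point and two independent directions.\<close>

lemma affine_plane_span:
  fixes P :: "'a::euclidean_space set"
  assumes P: "affine P" "aff_dim P = 2" and p: "p \<in> P" "p + a \<in> P" "p + b \<in> P" "q \<in> P"
    and ind: "independent {a, b}" "a \<noteq> b"
  shows "q - p \<in> span {a, b}"
proof -
  let ?V = "(+) (- p) ` P"
  have "aff_dim P = int (dim ?V)" by (rule aff_dim_eq_dim[OF hull_inc[OF p(1)]])
  then have "dim ?V \<le> card {a, b}" using P(2) ind(2) by simp
  moreover have "{a, b} \<subseteq> ?V" using p(2,3) by force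
  ultimately have "?V \<subseteq> span {a, b}" using card_ge_dim_independent[OF _ ind(1)] by blast
  moreover have "q - p \<in> ?V" using p(4) by force
  ultimately show ?thesis by blast
qed

locale billiard_table = strongly_convex_body K for K :: "'n::finite phase_space set"
begin

lemma width_positive:
  assumes "u \<noteq> 0"
  shows "u \<bullet> (support_point u - support_point (- u)) > 0"
proof -
  obtain c where c: "c \<in> interior K" using K_props(4) by blast
  have "u \<bullet> c < u \<bullet> support_point u" "(- u) \<bullet> c < (- u) \<bullet> support_point (- u)"
    using support_interior[OF support_point(2) _ c] assms by (metis, metis neg_equal_0_iff_equal)
  then show ?thesis by (simp add: inner_diff_right)
qed

text \<open>Of the two supporting inequalities at \<open>z(u)\<close> and \<open>z(w)\<close>, one says \<open>u \<bullet> J w \<le> 0\<close> and the other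
  \<open>w \<bullet> J u \<le> 0\<close>. As \<open>J\<close> is skew both are equalities, and strict convexity applies.\<close>

lemma tangent_line_unique:
  assumes "u \<noteq> 0" "w \<noteq> 0" and eq: "support_point u - J u = support_point w - J w"
  shows "u = w"
proof -
  have diff: "support_point w = support_point u + J w - J u" using eq by (simp add: algebra_simps)
  have "u \<bullet> support_point w \<le> u \<bullet> support_point u" "w \<bullet> support_point u \<le> w \<bullet> support_point w"
    by (intro support_point_max support_point)+
  moreover have "u \<bullet> support_point w = u \<bullet> support_point u + u \<bullet> J w"
    by (simp add: diff inner_diff_right inner_add_right)
  moreover have "w \<bullet> support_point w = w \<bullet> support_point u - w \<bullet> J u"
    by (simp add: diff inner_diff_right inner_add_right)
  moreover have "w \<bullet> J u = - (u \<bullet> J w)" using inner_J[of w u] by (simp add: inner_commute)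
  ultimately have "u \<bullet> support_point w = u \<bullet> support_point u" by linarith
  then have "support_point u = support_point w"
    by (intro support_point_eqI' assms(1) support_point) simp
  then have "J (u - w) = 0" using eq by (simp add: J_diff)
  then show ?thesis by simp
qed

lemma tangent_point_outside:
  assumes "u \<noteq> 0"
  shows "support_point u - J u \<notin> K" "support_point u + J u \<notin> K"
proof -
  have "support_point u + r *\<^sub>R J u \<notin> K" if "r \<noteq> 0" for r
  proof
    assume "support_point u + r *\<^sub>R J u \<in> K"
    then have "support_point u = support_point u + r *\<^sub>R J u"
      by (rule support_point_eqI'[OF assms]) (simp add: inner_add_right)
    then show False using assms that by simp
  qed
  from this[of "-1"] this[of 1]
  show "support_point u - J u \<notin> K" "support_point u + J u \<notin> K" by simp_all
qed

text \<open>The points \<open>z(u) - J u\<close> form a subset of the complement of \<open>K\<close> that is open by invariance of domain and closed by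
  compactness, and the complement of \<open>K\<close> is connected.\<close>

lemma exists_tangent_line:
  assumes x: "x \<notin> K"
  obtains u where "u \<noteq> 0" "x = support_point u - J u"
proof -
  define E where "E = (\<lambda>u. support_point u - J u)"
  define A where "A = E ` (- {0})"
  have contE: "continuous_on (- {0}) E"
    unfolding E_def
    by (intro continuous_on_diff linear_continuous_on bounded_linear_J continuous_at_imp_continuous_on ballI
        isCont_support_point) auto
  have "inj_on E (- {0})" unfolding E_def by (rule inj_onI) (rule tangent_line_unique, auto)
  then have oA: "open A" unfolding A_def by (intro invariance_of_domain[OF contE]) auto
  have AK: "A \<subseteq> - K" using tangent_point_outside(1) by (auto simp: A_def E_def)
  obtain B where B: "\<And>x. x \<in> K \<Longrightarrow> norm x \<le> B" using K_props(5) bounded_iff by metis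
  have clo: "y \<in> A" if y: "y \<in> closure A" "y \<notin> K" for y
  proof -
    obtain s where s: "\<And>n. s n \<in> A" "s \<longlonglongrightarrow> y" using y(1) closure_sequential by metis
    have "\<forall>n. \<exists>u. u \<noteq> 0 \<and> s n = E u" using s(1) unfolding A_def by blast
    then obtain u where u: "\<And>n. u n \<noteq> 0" "\<And>n. s n = E (u n)" by metis
    have "Bseq s" using s(2) by (intro convergent_imp_Bseq convergentI)
    then obtain M where M: "\<And>n. norm (s n) \<le> M" unfolding Bseq_def by blast
    have "norm (u n) \<le> B + M" for n
    proof -
      have "norm (u n) = norm (support_point (u n) - s n)"
        using norm_J[of "u n"] by (simp add: u(2) E_def)
      also have "\<dots> \<le> B + M"
        using B[OF support_point(1)] M by (intro order_trans[OF norm_triangle_ineq4] add_mono)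
      finally show ?thesis .
    qed
    then have ub: "u n \<in> cball 0 (B + M)" for n by simp
    obtain l r where l: "strict_mono r" "(u \<circ> r) \<longlonglongrightarrow> l"
      using compact_cball[of "0 :: 'n phase_space" "B + M"] ub unfolding compact_def by blast
    have sr: "(s \<circ> r) \<longlonglongrightarrow> y" by (rule LIMSEQ_subseq_LIMSEQ[OF s(2) l(1)])
    have Jr: "(\<lambda>n. J (u (r n))) \<longlonglongrightarrow> J l"
      using bounded_linear.tendsto[OF bounded_linear_J l(2)] by (simp add: o_def)
    have l0: "l \<noteq> 0"
    proof
      assume "l = 0"
      have lim: "(\<lambda>n. s (r n) + J (u (r n))) \<longlonglongrightarrow> y + J l"
        by (intro tendsto_add Jr) (use sr in \<open>simp add: o_def\<close>)
      have "y + J l \<in> K"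
        by (rule closed_sequentially[OF K_props(2) _ lim]) (simp add: u(2) E_def support_point(1))
      then show False using y(2) \<open>l = 0\<close> by (simp add: J_zero)
    qed
    have "(\<lambda>n. E (u (r n))) \<longlonglongrightarrow> E l"
    proof (rule continuous_on_tendsto_compose[OF contE])
      show "(\<lambda>n. u (r n)) \<longlonglongrightarrow> l" using l(2) by (simp add: o_def)
    qed (use l0 u in auto)
    then have "y = E l" using sr LIMSEQ_unique u(2) by (force simp: o_def)
    then show ?thesis using l0 by (auto simp: A_def)
  qed
  have "A = - K \<inter> closure A" using AK clo closure_subset by blast
  then have "closedin (top_of_set (- K)) A" by (metis closed_closure closedin_closed_Int)
  moreover have "openin (top_of_set (- K)) A" using oA AK by (simp add: open_subset)
  moreover have "connected (- K)"
  proof (rule connected_complement_bounded_convex[OF K_props(5,3)])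
    have "0 < CARD('n)" by simp
    then show "2 \<le> DIM('n phase_space)" unfolding DIM_phase_space by linarith
  qed
  moreover have "A \<noteq> {}"
  proof -
    obtain w :: "'n phase_space" where "w \<noteq> 0" using nonempty_Basis nonzero_Basis by blast
    then show ?thesis by (auto simp: A_def)
  qed
  ultimately have "A = - K" unfolding connected_clopen by blast
  then have "x \<in> E ` (- {0})" using x by (simp add: A_def)
  then show ?thesis using that by (elim imageE) (simp add: E_def)
qed

lemma outer_billiard_map:
  assumes u: "u \<noteq> 0"
  shows "outer_billiard_map K (support_point u - J u) = support_point u + J u"
  unfolding outer_billiard_map_def characteristic_vector_def
proof (rule the_equality)
  have "norm u *\<^sub>R J (outer_normal K (support_point u)) = J u"
    using u by (simp add: outer_normal_support_point J_scale)
  then show "\<exists>z\<in>frontier K. \<exists>t>0. support_point u - J u = z - t *\<^sub>R J (outer_normal K z) \<and>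
      support_point u + J u = z + t *\<^sub>R J (outer_normal K z)"
    using support_point_frontier[OF u] u by (intro bexI[of _ "support_point u"] exI[of _ "norm u"]) auto
  fix y assume "\<exists>z\<in>frontier K. \<exists>t>0. support_point u - J u = z - t *\<^sub>R J (outer_normal K z) \<and>
      y = z + t *\<^sub>R J (outer_normal K z)"
  then obtain z t where z: "z \<in> frontier K" "t > 0"
    "support_point u - J u = z - t *\<^sub>R J (outer_normal K z)" "y = z + t *\<^sub>R J (outer_normal K z)" by blast
  define w where "w = t *\<^sub>R outer_normal K z"
  have "outer_normal K z \<noteq> 0" using outer_normal_supports(1)[OF z(1)] by auto
  then have "w \<noteq> 0" using z(2) by (simp add: w_def)
  moreover have zw: "support_point w = z"
    using support_point_scale[OF z(2)] support_point_outer_normal[OF z(1)] by (simp add: w_def)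
  moreover have Jw: "t *\<^sub>R J (outer_normal K z) = J w" by (simp add: w_def J_scale)
  ultimately have "u = w" using tangent_line_unique[OF u] z(3) by simp
  then show "y = support_point u + J u" using z(4) zw Jw by simp
qed

text \<open>The normals along the trajectory of \<open>z(u0) - J u0\<close>; their lengths are the distances from the tangency
  points.\<close>

lemma trajectory_normals:
  assumes u: "u0 \<noteq> 0"
  obtains u where "u 0 = u0" "\<And>k. u k \<noteq> 0"
    "\<And>k. outer_billiard_trajectory K (support_point u0 - J u0) k = support_point (u k) - J (u k)"
    "\<And>k. support_point (u (Suc k)) - J (u (Suc k)) = support_point (u k) + J (u k)"
proof -
  let ?t = "outer_billiard_trajectory K (support_point u0 - J u0)"
  have ex: "\<exists>u. u \<noteq> 0 \<and> ?t k = support_point u - J u" for k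
  proof (induction k)
    case 0
    then show ?case using u by (intro exI[of _ u0]) (simp add: outer_billiard_trajectory_def)
  next
    case (Suc k)
    then obtain w where w: "w \<noteq> 0" "?t k = support_point w - J w" by blast
    have "?t (Suc k) = support_point w + J w"
      using outer_billiard_map[OF w(1)] w(2) by (simp add: outer_billiard_trajectory_def)
    then show ?case using tangent_point_outside(2)[OF w(1)] exists_tangent_line by metis
  qed
  then obtain u where u': "\<And>k. u k \<noteq> 0" "\<And>k. ?t k = support_point (u k) - J (u k)" by metis
  have "u 0 = u0"
    using tangent_line_unique[OF u'(1) u, of 0] u'(2)[of 0] by (simp add: outer_billiard_trajectory_def)
  moreover have "support_point (u (Suc k)) - J (u (Suc k)) = support_point (u k) + J (u k)" for k
  proof -
    have "?t (Suc k) = outer_billiard_map K (?t k)" by (simp add: outer_billiard_trajectory_def)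
    then show ?thesis using u'(2) outer_billiard_map[OF u'(1)] by simp
  qed
  ultimately show ?thesis using that u' by blast
qed

text \<open>The support point turned by \<open>- J\<close>. A normal \<open>u\<close> belongs to the tangent direction \<open>J u\<close>, so that planes
  containing tangent lines and tangency points turn into planes containing normals and points \<open>Z u\<close>.\<close>

definition Z :: "'n phase_space \<Rightarrow> 'n phase_space" where
  "Z u = - J (support_point u)"

text \<open>The Hamiltonian vector field of the width function \<open>u \<mapsto> u \<bullet> (z(u) - z(- u))\<close>, written \<open>n\<close> in comments.\<close>

definition width_field :: "'n phase_space \<Rightarrow> 'n phase_space" where
  "width_field u = Z u - Z (- u)"

lemma J_Z [simp]: "J (Z u) = support_point u"
  by (simp add: Z_def J_minus)

lemma Z_scale: "r > 0 \<Longrightarrow> Z (r *\<^sub>R u) = Z u"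
  by (simp add: Z_def support_point_scale)

lemma width_field_positive: "u \<noteq> 0 \<Longrightarrow> omega (width_field u) u > 0"
  using width_positive[of u] by (simp add: symplectic_form_eq_inner width_field_def J_diff inner_commute)

lemma isCont_Z: "u \<noteq> 0 \<Longrightarrow> isCont Z u"
  unfolding Z_def
  by (intro continuous_minus bounded_linear.isCont[OF bounded_linear_J] isCont_support_point)

lemma Z_bounded: obtains B where "B > 0" "\<And>u. norm (Z u) \<le> B"
proof -
  obtain B where B: "B > 0" "\<And>x. x \<in> K \<Longrightarrow> norm x \<le> B" using K_props(5) bounded_pos by metis
  then show ?thesis using that[of B] support_point(1) by (simp add: Z_def)
qed

end

locale planar_billiard = billiard_table K for K :: "'n::finite phase_space set" +
  assumes planar_trajectories: "x \<notin> K \<Longrightarrow> planar (outer_billiard_trajectory K x)"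
begin

text \<open>The plane of the trajectory contains the tangency points, as they are midpoints, and the tangent lines. It
  is spanned by the first tangent direction and the first two tangency points.\<close>

lemma planar_orbit:
  assumes u0: "u0 \<noteq> 0"
  obtains u where "u 0 = u0" "\<And>k. u k \<noteq> 0" "\<And>k. u (Suc k) = - u k + (Z (u (Suc k)) - Z (u k))"
    "\<And>k. u k \<in> span {u0, Z u0 - Z (u 1)}" "\<And>k. Z (u k) - Z u0 \<in> span {u0, Z u0 - Z (u 1)}"
proof -
  obtain u where u: "u 0 = u0" "\<And>k. u k \<noteq> 0"
    "\<And>k. outer_billiard_trajectory K (support_point u0 - J u0) k = support_point (u k) - J (u k)"
    "\<And>k. support_point (u (Suc k)) - J (u (Suc k)) = support_point (u k) + J (u k)"
    using trajectory_normals[OF u0] by metis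
  let ?z = "\<lambda>k. support_point (u k)"
  obtain P where P: "affine P" "aff_dim P = 2" "\<And>k. ?z k - J (u k) \<in> P"
    using planar_trajectories[OF tangent_point_outside(1)[OF u0]] u(3)
    unfolding planar_def by (metis rangeI subsetD)
  have P': "?z k + J (u k) \<in> P" for k using P(3)[of "Suc k"] u(4)[of k] by simp
  have zP: "?z k \<in> P" for k
  proof -
    have "(1 / 2) *\<^sub>R (?z k - J (u k)) + (1 / 2) *\<^sub>R (?z k + J (u k)) \<in> P"
      by (rule mem_affine[OF P(1) P(3) P']) simp
    moreover have "(1 / 2) *\<^sub>R (?z k - J (u k)) + (1 / 2) *\<^sub>R (?z k + J (u k)) = ?z k"
      by (simp flip: scaleR_add_right)
    ultimately show ?thesis by simp
  qed
  have rec: "u (Suc k) = - u k + (Z (u (Suc k)) - Z (u k))" for k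
  proof -
    have "J (u (Suc k)) = J (- u k + (Z (u (Suc k)) - Z (u k)))"
      using u(4)[of k] by (simp add: J_add J_diff J_minus algebra_simps)
    then have "J (u (Suc k) - (- u k + (Z (u (Suc k)) - Z (u k)))) = 0" by (simp add: J_diff)
    then show ?thesis by simp
  qed
  let ?a = "J u0" and ?b = "?z 1 - ?z 0"
  have "?z 1 \<noteq> ?z 0"
  proof
    assume eq: "?z 1 = ?z 0"
    then have "u 1 = - u0" using rec[of 0] u(1) by (simp add: Z_def)
    then show False using width_positive[OF u0] eq u(1) by simp
  qed
  then have "u0 \<bullet> ?z 1 \<noteq> u0 \<bullet> ?z 0"
    using support_point_eqI'[OF u0 support_point(1), of "u 1"] u(1) by auto
  then have b: "u0 \<bullet> ?b \<noteq> 0" by (simp add: inner_diff_right)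
  have ind: "independent {?a, ?b}" "?a \<noteq> ?b"
  proof -
    show ab: "?a \<noteq> ?b" using b by (metis J_inner_self(2))
    have "?a \<notin> span {?b}"
    proof
      assume "?a \<in> span {?b}"
      then obtain c where c: "?a = c *\<^sub>R ?b" by (auto simp: span_singleton)
      then have "c * (u0 \<bullet> ?b) = 0" by (metis J_inner_self(2) inner_scaleR_right)
      then show False using b c u0 by simp
    qed
    then show "independent {?a, ?b}" using b ab by (auto simp: independent_insert)
  qed
  have mem: "q - ?z 0 \<in> span {?a, ?b}" if "q \<in> P" for q
    by (rule affine_plane_span[OF P(1,2) zP _ _ that ind]) (use P'[of 0] zP[of 1] u(1) in simp_all)
  have rot: "- J q \<in> span {u0, Z u0 - Z (u 1)}" if q: "q \<in> span {?a, ?b}" for q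
  proof -
    obtain c d where "q = c *\<^sub>R ?a + d *\<^sub>R ?b" using q span_pair by blast
    moreover have "- J (c *\<^sub>R ?a + d *\<^sub>R ?b) = c *\<^sub>R u0 + (- d) *\<^sub>R (Z u0 - Z (u 1))"
      by (simp add: J_add J_scale J_diff Z_def u(1) algebra_simps)
    ultimately show ?thesis using span_pair by blast
  qed
  have "Z (u k) - Z u0 \<in> span {u0, Z u0 - Z (u 1)}" for k
    using rot[OF mem[OF zP[of k]]] by (simp add: Z_def J_diff u(1))
  moreover have "u k \<in> span {u0, Z u0 - Z (u 1)}" for k
  proof -
    have "(?z k + J (u k) - ?z 0) - (?z k - ?z 0) \<in> span {?a, ?b}"
      by (intro span_diff mem P' zP)
    then have "J (u k) \<in> span {?a, ?b}" by simp
    then show ?thesis using rot by fastforce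
  qed
  ultimately show ?thesis using that u(1,2) rec by blast
qed

end

section \<open>Orbits starting far away\<close>

lemma symplectic_bound: "\<bar>omega a b\<bar> \<le> norm a * norm b"
  using Cauchy_Schwarz_ineq2[of "J a" b] by (simp add: symplectic_form_eq_inner)

context planar_billiard
begin

lemma scaled_orbit:
  assumes u0: "u0 \<noteq> 0" and R: "R > 0"
  obtains m where "m 0 = u0" "\<And>k. m k \<noteq> 0"
    "\<And>k. m (Suc k) = - m k + (1 / R) *\<^sub>R (Z (m (Suc k)) - Z (m k))"
    "\<And>k. m k \<in> span {u0, Z u0 - Z (m 1)}" "\<And>k. Z (m k) - Z u0 \<in> span {u0, Z u0 - Z (m 1)}"
proof -
  have Ru: "R *\<^sub>R u0 \<noteq> 0" using u0 R by simp
  obtain u where u: "u 0 = R *\<^sub>R u0" "\<And>k. u k \<noteq> 0"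
    "\<And>k. u (Suc k) = - u k + (Z (u (Suc k)) - Z (u k))"
    "\<And>k. u k \<in> span {R *\<^sub>R u0, Z (R *\<^sub>R u0) - Z (u 1)}"
    "\<And>k. Z (u k) - Z (R *\<^sub>R u0) \<in> span {R *\<^sub>R u0, Z (R *\<^sub>R u0) - Z (u 1)}"
    by (rule planar_orbit[OF Ru]) blast
  define m where "m = (\<lambda>k. (1 / R) *\<^sub>R u k)"
  have Zm: "Z (u k) = Z (m k)" for k using R by (simp add: m_def Z_scale)
  have Z0: "Z (R *\<^sub>R u0) = Z u0" using R by (simp add: Z_scale)
  have sp: "x \<in> span {u0, Z u0 - Z (m 1)}" if x: "x \<in> span {R *\<^sub>R u0, Z (R *\<^sub>R u0) - Z (u 1)}" for x
  proof -
    obtain a b where "x = a *\<^sub>R (R *\<^sub>R u0) + b *\<^sub>R (Z u0 - Z (m 1))"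
      using x unfolding span_pair Zm Z0 by blast
    then have "x = (a * R) *\<^sub>R u0 + b *\<^sub>R (Z u0 - Z (m 1))" by simp
    then show ?thesis unfolding span_pair by blast
  qed
  show ?thesis
  proof (rule that)
    show "m 0 = u0" using R by (simp add: m_def u(1))
    show "m k \<noteq> 0" for k using u(2)[of k] R by (simp add: m_def)
    show "m (Suc k) = - m k + (1 / R) *\<^sub>R (Z (m (Suc k)) - Z (m k))" for k
      using arg_cong[OF u(3)[of k], of "\<lambda>x. (1 / R) *\<^sub>R x"] unfolding Zm
      by (simp only: m_def scaleR_add_right scaleR_minus_right)
    show "m k \<in> span {u0, Z u0 - Z (m 1)}" for k
      unfolding m_def by (rule span_scale) (use sp[OF u(4)] in \<open>simp add: m_def\<close>)
    show "Z (m k) - Z u0 \<in> span {u0, Z u0 - Z (m 1)}" for k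
      using sp[OF u(5)[of k]] by (simp only: Zm Z0)
  qed
qed

text \<open>The discrete form of an orbit of the Hamiltonian field \<open>n\<close>. While \<open>m (2 * j)\<close> is close to \<open>u0\<close>, the next normal is
  close to \<open>- u0\<close>, and two steps of the recursion move \<open>m\<close> by about \<open>(2 / R) n(u0)\<close>. The function
  \<open>psi\<close>, which vanishes on the ray through \<open>u0 + s n(u0)\<close>, grows at each double step by at least \<open>H / R\<close>
  and by at most a multiple of \<open>1 / R\<close>, so it passes through zero up to an error of order
  \<open>1 / R\<close> before \<open>m\<close> has moved by \<open>r\<close>.\<close>

lemma orbit_hits_ray:
  assumes B: "B > 0" "\<And>u. norm (Z u) \<le> B" and R: "R > 0"
    and m0: "m 0 = u0" and rec: "\<And>k. m (Suc k) = - m k + (1 / R) *\<^sub>R (Z (m (Suc k)) - Z (m k))"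
    and H: "H > 0" and nH: "omega (width_field u0) u0 = H"
    and q: "norm (u0 + s *\<^sub>R width_field u0) \<le> q" "4 * (e * q) \<le> H" "e > 0"
    and cont: "\<And>x. norm (x - u0) < 2 * r \<Longrightarrow> norm (Z x - Z u0) \<le> e"
      "\<And>x. norm (x + u0) < 2 * r \<Longrightarrow> norm (Z x - Z (- u0)) \<le> e"
    and r: "r > 0" and s: "0 \<le> s" "8 * B * s \<le> r" and Rr: "8 * B < r * R"
  shows "\<exists>j. norm (m (2 * j) - u0) < r \<and> \<bar>omega (m (2 * j)) (u0 + s *\<^sub>R width_field u0)\<bar> \<le> 4 * B * q / R"
proof -
  define c where "c = u0 + s *\<^sub>R width_field u0"
  define psi where "psi = (\<lambda>x. omega x c)"
  have rec1: "m (Suc k) + m k = (1 / R) *\<^sub>R (Z (m (Suc k)) - Z (m k))" for k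
  proof -
    have "m (Suc k) + m k = (- m k + (1 / R) *\<^sub>R (Z (m (Suc k)) - Z (m k))) + m k"
      using rec[of k] by (rule arg_cong)
    then show ?thesis by simp
  qed
  have step1: "norm (m (Suc k) + m k) \<le> 2 * B / R" for k
  proof -
    have "norm (m (Suc k) + m k) = norm ((1 / R) *\<^sub>R (Z (m (Suc k)) - Z (m k)))" by (simp only: rec1)
    also have "\<dots> = norm (Z (m (Suc k)) - Z (m k)) / R" using R by simp
    also have "\<dots> \<le> (B + B) / R"
      by (intro divide_right_mono order_trans[OF norm_triangle_ineq4] add_mono B(2)) (use R in simp)
    finally show ?thesis by simp
  qed
  have rec2: "m (Suc (Suc k)) - m k = (1 / R) *\<^sub>R (Z (m (Suc (Suc k))) + Z (m k) - 2 *\<^sub>R Z (m (Suc k)))" for k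
  proof -
    have "m (Suc (Suc k)) - m k = (m (Suc (Suc k)) + m (Suc k)) - (m (Suc k) + m k)" by simp
    also have "\<dots> = (1 / R) *\<^sub>R ((Z (m (Suc (Suc k))) - Z (m (Suc k))) - (Z (m (Suc k)) - Z (m k)))"
      by (simp only: rec1 scaleR_diff_right)
    finally show ?thesis by (simp add: scaleR_2 algebra_simps)
  qed
  have step2: "norm (m (Suc (Suc k)) - m k) \<le> 4 * B / R" for k
  proof -
    have "m (Suc (Suc k)) - m k = (m (Suc (Suc k)) + m (Suc k)) - (m (Suc k) + m k)" by simp
    also have "norm \<dots> \<le> 2 * B / R + 2 * B / R"
      by (intro order_trans[OF norm_triangle_ineq4] add_mono step1)
    finally show ?thesis by simp
  qed
  have near: "norm (m (2 * j) - u0) \<le> 4 * B * real j / R" for j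
  proof (induction j)
    case (Suc j)
    have "m (2 * Suc j) - u0 = (m (Suc (Suc (2 * j))) - m (2 * j)) + (m (2 * j) - u0)" by simp
    also have "norm \<dots> \<le> 4 * B / R + 4 * B * real j / R"
      by (intro order_trans[OF norm_triangle_ineq] add_mono step2 Suc.IH)
    finally show ?case by (simp add: add_divide_distrib algebra_simps)
  qed (simp add: m0)
  have psi_c: "psi (width_field u0) = H" by (simp add: psi_def c_def symplectic_simps nH)
  have psi_0: "psi u0 = - s * H"
    using symplectic_skew[of u0 "width_field u0"] by (simp add: psi_def c_def symplectic_simps nH)
  have psi_bound: "\<bar>psi x\<bar> \<le> norm x * q" for x
    unfolding psi_def
    by (rule order_trans[OF symplectic_bound]) (use q(1) in \<open>simp add: c_def mult_left_mono\<close>)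
  have BR: "4 * B / R < r" "2 * B / R < r" using Rr R B(1) by (simp_all add: field_simps)
  have gain: "psi (m (2 * Suc j)) \<ge> psi (m (2 * j)) + H / R" if j: "norm (m (2 * j) - u0) < r" for j
  proof -
    let ?a = "m (2 * j)" and ?b = "m (Suc (2 * j))" and ?c = "m (Suc (Suc (2 * j)))"
    have "?b + u0 = (?b + ?a) - (?a - u0)" by simp
    also have "norm \<dots> < 2 * r"
      using norm_triangle_ineq4[of "?b + ?a" "?a - u0"] step1[of "2 * j"] BR j by linarith
    finally have b: "norm (Z ?b - Z (- u0)) \<le> e" by (rule cont(2))
    have "?c - u0 = (?c - ?a) + (?a - u0)" by simp
    also have "norm \<dots> < 2 * r"
      using norm_triangle_ineq[of "?c - ?a" "?a - u0"] step2[of "2 * j"] BR j by linarith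
    finally have cc: "norm (Z ?c - Z u0) \<le> e" by (rule cont(1))
    have a: "norm (Z ?a - Z u0) \<le> e" by (rule cont(1)) (use j r in linarith)
    define d where "d = Z ?c + Z ?a - 2 *\<^sub>R Z ?b - 2 *\<^sub>R width_field u0"
    have "d = (Z ?c - Z u0) + (Z ?a - Z u0) - 2 *\<^sub>R (Z ?b - Z (- u0))"
      by (simp add: d_def width_field_def algebra_simps scaleR_2)
    also have "norm \<dots> \<le> (e + e) + 2 * e"
      by (intro order_trans[OF norm_triangle_ineq4] add_mono order_trans[OF norm_triangle_ineq] a cc)
        (use b in simp)
    finally have d: "norm d \<le> 4 * e" by simp
    have "q \<ge> 0" using q(1) norm_ge_zero order_trans by blast
    then have "\<bar>psi d\<bar> \<le> 4 * e * q" using psi_bound[of d] mult_right_mono[OF d, of q] by linarith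
    then have "psi d \<ge> - H" using q(2) by simp
    moreover have "R *\<^sub>R (?c - ?a) = 2 *\<^sub>R width_field u0 + d" using rec2[of "2 * j"] R by (simp add: d_def)
    then have "psi (R *\<^sub>R (?c - ?a)) = psi (2 *\<^sub>R width_field u0 + d)" by simp
    then have "R * (psi ?c - psi ?a) = 2 * H + psi d"
      using psi_c by (simp add: psi_def symplectic_simps)
    ultimately have "R * (psi ?c - psi ?a) \<ge> H" by linarith
    then show ?thesis using R by (simp add: field_simps)
  qed
  have progress: "psi (m (2 * j)) \<ge> - s * H + real j * H / R" if "4 * B * real j < r * R" for j
    using that
  proof (induction j)
    case (Suc j)
    have "4 * B * real j < r * R" using Suc.prems B(1) by (simp add: algebra_simps)
    moreover from this have "norm (m (2 * j) - u0) < r"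
      using near[of j] R by (simp add: field_simps) (smt (verit) mult_less_cancel_left_pos)
    ultimately show ?case using gain[of j] Suc.IH by (simp add: add_divide_distrib algebra_simps)
  qed (simp add: m0 psi_0)
  \<comment> \<open>After \<open>k\<close> double steps the initial value \<open>- s * H\<close> of \<open>psi\<close> has been made up for.\<close>
  define k where "k = nat \<lceil>s * R\<rceil>"
  have k: "s * R \<le> real k" "real k \<le> s * R + 1"
  proof -
    have "0 \<le> s * R" using s(1) R by simp
    then have "real k = of_int \<lceil>s * R\<rceil>" unfolding k_def by simp
    then show "s * R \<le> real k" "real k \<le> s * R + 1" by (simp_all add: of_int_ceiling_le_add_one)
  qed
  have "4 * B * real k \<le> 4 * B * (s * R + 1)" using k(2) B(1) by simp
  also have "\<dots> = (8 * B * s) * R / 2 + 4 * B" by (simp add: algebra_simps)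
  also have "\<dots> \<le> r * R / 2 + 4 * B" using mult_right_mono[OF s(2), of R] R by simp
  also have "\<dots> < r * R" using Rr by simp
  finally have kr: "4 * B * real k < r * R" .
  have "0 \<le> (real k - s * R) * H / R" using k(1) H R by simp
  also have "\<dots> = - s * H + real k * H / R" using R by (simp add: field_simps)
  also have "\<dots> \<le> psi (m (2 * k))" by (rule progress[OF kr])
  finally have pk: "psi (m (2 * k)) \<ge> 0" .
  define j where "j = (LEAST j. psi (m (2 * j)) \<ge> 0)"
  have j0: "psi (m (2 * j)) \<ge> 0" unfolding j_def by (rule LeastI[of _ k]) (rule pk)
  have jk: "j \<le> k" unfolding j_def by (rule Least_le) (rule pk)
  have "4 * B * real j \<le> 4 * B * real k" using jk B(1) by simp
  then have "4 * B * real j < r * R" using kr by linarith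
  then have "4 * B * real j / R < r" using R by (simp add: field_simps)
  then have nj: "norm (m (2 * j) - u0) < r" using near[of j] by linarith
  have q0: "q \<ge> 0" using q(1) norm_ge_zero order_trans by blast
  have "\<bar>psi (m (2 * j))\<bar> \<le> 4 * B * q / R"
  proof (cases j)
    case 0
    then have "psi (m (2 * j)) \<le> 0" using s(1) H by (simp add: m0 psi_0)
    then show ?thesis using j0 B(1) R q0 by simp
  next
    case (Suc i)
    then have "psi (m (2 * i)) < 0" using not_less_Least[of i "\<lambda>j. psi (m (2 * j)) \<ge> 0"] by (simp add: j_def)
    then have "psi (m (2 * j)) \<le> psi (m (2 * j) - m (2 * i))" by (simp add: psi_def symplectic_simps)
    also have "\<dots> \<le> norm (m (2 * j) - m (2 * i)) * q" using psi_bound abs_le_D1 by blast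
    also have "\<dots> \<le> (4 * B / R) * q" using step2[of "2 * i"] q0 Suc by (intro mult_right_mono) simp_all
    finally show ?thesis using j0 by simp
  qed
  then show ?thesis using nj unfolding psi_def c_def by blast
qed

text \<open>Let \<open>R\<close> tend to infinity in \<open>orbit_hits_ray\<close>. A limit point of the normals found there lies on the ray through
  \<open>u0 + s n(u0)\<close>. The tangency points of the trajectory lie in a plane that converges, because it is
  spanned by \<open>u0\<close> and \<open>Z u0 - Z (m 1)\<close> with \<open>m 1 \<rightarrow> - u0\<close>. The two signs come from the normals with even and
  with odd index.\<close>

lemma local_invariance:
  assumes u0: "u0 \<noteq> 0"
  obtains d where "d > 0" "\<And>s. 0 \<le> s \<Longrightarrow> s \<le> d \<Longrightarrow>
    Z (u0 + s *\<^sub>R width_field u0) - Z u0 \<in> span {u0, width_field u0} \<and>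
    Z (- (u0 + s *\<^sub>R width_field u0)) - Z u0 \<in> span {u0, width_field u0}"
proof -
  let ?n = "width_field u0"
  obtain B where B: "B > 0" "\<And>u. norm (Z u) \<le> B" using Z_bounded by blast
  define H where "H = omega ?n u0"
  have H: "H > 0" using width_field_positive[OF u0] by (simp add: H_def)
  have H': "omega u0 ?n = - H" using symplectic_skew[of u0 ?n] by (simp add: H_def)
  define q where "q = norm u0 + norm ?n"
  have q: "q > 0" using u0 by (simp add: q_def add_pos_nonneg)
  define e where "e = H / (4 * q)"
  have e: "e > 0" "4 * (e * q) \<le> H" using H q by (simp_all add: e_def)
  obtain r1 where r1: "r1 > 0" "\<And>x. norm (x - u0) < r1 \<Longrightarrow> norm (Z x - Z u0) < e"
    using isCont_Z[OF u0] e(1) unfolding continuous_at_eps_delta dist_norm by metis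
  have "- u0 \<noteq> 0" using u0 by simp
  from isCont_Z[OF this] obtain r2 where r2: "r2 > 0" "\<And>x. norm (x - (- u0)) < r2 \<Longrightarrow> norm (Z x - Z (- u0)) < e"
    using e(1) unfolding continuous_at_eps_delta dist_norm by metis
  \<comment> \<open>The second bound keeps the coefficient \<open>a\<close> of the limit point \<open>l\<close> positive.\<close>
  define r where "r = min (min r1 r2 / 2) (H / (2 * (norm ?n + 1)))"
  have pos1: "norm ?n + 1 > 0" by (simp add: add_nonneg_pos)
  have r: "r > 0" "2 * r \<le> r1" "2 * r \<le> r2" using r1 r2 H pos1 by (auto simp: r_def)
  have "r \<le> H / (2 * (norm ?n + 1))" by (simp add: r_def)
  then have "r * (2 * (norm ?n + 1)) \<le> H" using pos1 pos_le_divide_eq[of "2 * (norm ?n + 1)" r H] by simp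
  then have "r * (norm ?n + 1) \<le> H / 2" by (simp add: algebra_simps)
  then have rn: "norm ?n * r < H" using H r(1) by (simp add: algebra_simps)
  define d where "d = min 1 (r / (8 * B))"
  have d: "d > 0" using r B by (simp add: d_def)
  have main: "Z (u0 + s *\<^sub>R ?n) - Z u0 \<in> span {u0, ?n} \<and> Z (- (u0 + s *\<^sub>R ?n)) - Z u0 \<in> span {u0, ?n}"
    if s: "0 \<le> s" "s \<le> d" for s
  proof -
    let ?c = "u0 + s *\<^sub>R ?n"
    define R where "R = (\<lambda>n. 8 * B / r + 1 + real n)"
    have R: "R n > 0" "8 * B < r * R n" for n using B r by (simp_all add: R_def add_pos_nonneg field_simps add_pos_pos)
    have "filterlim R at_top sequentially"
      unfolding R_def by (intro filterlim_tendsto_add_at_top[OF tendsto_const] filterlim_real_sequentially)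
    then have R0: "(\<lambda>n. a / R n) \<longlonglongrightarrow> 0" for a
      by (intro tendsto_divide_0[OF tendsto_const] filterlim_at_top_imp_at_infinity)
    have "\<exists>m. m 0 = u0 \<and> (\<forall>k. m (Suc k) = - m k + (1 / R n) *\<^sub>R (Z (m (Suc k)) - Z (m k))) \<and>
      (\<forall>k. m k \<in> span {u0, Z u0 - Z (m 1)}) \<and> (\<forall>k. Z (m k) - Z u0 \<in> span {u0, Z u0 - Z (m 1)})" for n
      by (rule scaled_orbit[OF u0 R(1)[of n]]) blast
    then obtain m where m: "\<And>n. m n 0 = u0"
      "\<And>n k. m n (Suc k) = - m n k + (1 / R n) *\<^sub>R (Z (m n (Suc k)) - Z (m n k))"
      "\<And>n k. m n k \<in> span {u0, Z u0 - Z (m n 1)}" "\<And>n k. Z (m n k) - Z u0 \<in> span {u0, Z u0 - Z (m n 1)}"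
      by metis
    have "s \<le> 1" "s \<le> r / (8 * B)" using s(2) by (auto simp: d_def)
    have cq: "norm ?c \<le> q"
    proof -
      have "norm ?c \<le> norm u0 + s * norm ?n" using s(1) by (intro norm_triangle_le) simp
      then show ?thesis using mult_right_mono[OF \<open>s \<le> 1\<close>, of "norm ?n"] by (simp add: q_def)
    qed
    have sB: "8 * B * s \<le> r" using \<open>s \<le> r / (8 * B)\<close> B(1) by (simp add: field_simps)
    have "\<exists>j. norm (m n (2 * j) - u0) < r \<and> \<bar>omega (m n (2 * j)) ?c\<bar> \<le> 4 * B * q / R n" for n
    proof (rule orbit_hits_ray[OF B R(1) m(1,2) H _ cq e(2,1) _ _ r(1) s(1) sB R(2)])
      show "omega (width_field u0) u0 = H" by (simp add: H_def)
      show "norm (Z x - Z u0) \<le> e" if "norm (x - u0) < 2 * r" for x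
        using r1(2)[of x] that r(2) by simp
      show "norm (Z x - Z (- u0)) \<le> e" if "norm (x + u0) < 2 * r" for x
        using r2(2)[of x] that r(3) by simp
    qed
    then obtain j where j: "\<And>n. norm (m n (2 * j n) - u0) < r"
      "\<And>n. \<bar>omega (m n (2 * j n)) ?c\<bar> \<le> 4 * B * q / R n" by metis
    define p where "p = (\<lambda>n. m n (2 * j n))"
    define p' where "p' = (\<lambda>n. m n (Suc (2 * j n)))"
    have step: "norm (m n (Suc k) + m n k) \<le> 2 * B / R n" for n k
    proof -
      have "m n (Suc k) + m n k = (- m n k + (1 / R n) *\<^sub>R (Z (m n (Suc k)) - Z (m n k))) + m n k"
        using m(2)[of n k] by (rule arg_cong)
      then have "norm (m n (Suc k) + m n k) = norm ((1 / R n) *\<^sub>R (Z (m n (Suc k)) - Z (m n k)))" by simp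
      also have "\<dots> = norm (Z (m n (Suc k)) - Z (m n k)) / R n" using R(1)[of n] by simp
      also have "\<dots> \<le> (B + B) / R n"
        by (intro divide_right_mono order_trans[OF norm_triangle_ineq4] add_mono B(2)) (use R(1)[of n] in simp)
      finally show ?thesis by simp
    qed
    have "p n \<in> cball u0 r" for n
      using j(1)[of n] by (simp add: p_def dist_norm norm_minus_commute less_imp_le)
    then obtain l t where l: "l \<in> cball u0 r" "strict_mono t" "(p \<circ> t) \<longlonglongrightarrow> l"
      using compact_cball[of u0 r] unfolding compact_def by blast
    have pl: "(\<lambda>n. p (t n)) \<longlonglongrightarrow> l" using l(3) by (simp add: o_def)
    have Rt: "(\<lambda>n. a / R (t n)) \<longlonglongrightarrow> 0" for a
      using LIMSEQ_subseq_LIMSEQ[OF R0 l(2)] by (simp add: o_def)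
    have "(\<lambda>n. m (t n) 1 + u0) \<longlonglongrightarrow> 0"
      by (rule Lim_null_comparison[OF _ Rt[of "2 * B"]]) (use step[of _ 0] m(1) in simp)
    then have "(\<lambda>n. (m (t n) 1 + u0) - u0) \<longlonglongrightarrow> 0 - u0" by (intro tendsto_diff tendsto_const)
    then have "(\<lambda>n. m (t n) 1) \<longlonglongrightarrow> - u0" by simp
    then have "(\<lambda>n. Z u0 - Z (m (t n) 1)) \<longlonglongrightarrow> Z u0 - Z (- u0)"
      using u0 by (intro tendsto_diff tendsto_const isCont_tendsto_compose[OF isCont_Z]) auto
    then have wl: "(\<lambda>n. Z u0 - Z (m (t n) 1)) \<longlonglongrightarrow> ?n" by (simp add: width_field_def)
    have sym: "omega u0 ?n \<noteq> 0" using H H' by simp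
    have lspan: "l \<in> span {u0, ?n}"
      by (rule span_pair_limit[OF _ pl wl sym]) (simp only: p_def m(3))
    then obtain a b where ab: "l = a *\<^sub>R u0 + b *\<^sub>R ?n" using span_pair by blast
    have "(\<lambda>n. omega (p (t n)) ?c) \<longlonglongrightarrow> 0"
      by (rule Lim_null_comparison[OF _ Rt[of "4 * B * q"]]) (use j(2) in \<open>simp add: p_def\<close>)
    moreover have "(\<lambda>n. omega (p (t n)) ?c) \<longlonglongrightarrow> omega l ?c" by (intro symplectic.tendsto pl tendsto_const)
    ultimately have "omega l ?c = 0" using LIMSEQ_unique by blast
    then have "(b - a * s) * H = 0" by (simp add: ab symplectic_simps H' algebra_simps flip: H_def)
    then have b: "b = a * s" using H by simp
    then have lc: "l = a *\<^sub>R ?c" by (simp add: ab scaleR_add_right)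
    have "\<bar>omega ?n (l - u0)\<bar> \<le> norm ?n * r"
      using l(1) by (intro order_trans[OF symplectic_bound] mult_left_mono) (auto simp: dist_norm norm_minus_commute)
    moreover have "omega ?n l = a * H" by (simp add: ab symplectic_simps flip: H_def)
    ultimately have "a * H > 0" using rn by (simp add: symplectic_simps flip: H_def)
    then have a: "a > 0" using H by (simp add: zero_less_mult_iff)
    have l0: "l \<noteq> 0"
    proof
      assume "l = 0"
      then have "omega ?n l = 0" by (simp add: symplectic_simps)
      then show False using a H \<open>omega ?n l = a * H\<close> by simp
    qed
    have "(\<lambda>n. Z (p (t n)) - Z u0) \<longlonglongrightarrow> Z l - Z u0"
      by (intro tendsto_diff tendsto_const isCont_tendsto_compose[OF isCont_Z] pl l0)
    then have "Z l - Z u0 \<in> span {u0, ?n}"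
      by (intro span_pair_limit[OF _ _ wl sym, of "\<lambda>n. Z (p (t n)) - Z u0"]) (simp_all only: p_def m(4))
    then have 1: "Z ?c - Z u0 \<in> span {u0, ?n}" by (simp add: lc Z_scale[OF a])
    have "(\<lambda>n. p' (t n) + p (t n)) \<longlonglongrightarrow> 0"
      by (rule Lim_null_comparison[OF _ Rt[of "2 * B"]]) (use step in \<open>simp add: p_def p'_def\<close>)
    then have "(\<lambda>n. (p' (t n) + p (t n)) - p (t n)) \<longlonglongrightarrow> 0 - l" by (intro tendsto_diff pl)
    then have "(\<lambda>n. p' (t n)) \<longlonglongrightarrow> - l" by simp
    then have "(\<lambda>n. Z (p' (t n)) - Z u0) \<longlonglongrightarrow> Z (- l) - Z u0"
      using l0 by (intro tendsto_diff tendsto_const isCont_tendsto_compose[OF isCont_Z]) auto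
    then have "Z (- l) - Z u0 \<in> span {u0, ?n}"
      by (intro span_pair_limit[OF _ _ wl sym, of "\<lambda>n. Z (p' (t n)) - Z u0"]) (simp_all only: p'_def m(4))
    moreover have "- l = a *\<^sub>R (- ?c)" by (simp only: lc scaleR_minus_right)
    ultimately have 2: "Z (- ?c) - Z u0 \<in> span {u0, ?n}" by (simp only: Z_scale[OF a])
    from 1 2 show ?thesis by blast
  qed
  show ?thesis by (rule that[OF d main])
qed


text \<open>The local statement is continued along the segment from \<open>u\<close> to \<open>mu\<close>: the good parameters form a closed
  set that contains with each point a small interval to its right. Both signs are carried along, so that at
  a good point \<open>c\<close> the direction \<open>n(c)\<close> stays in the plane; the assumption \<open>b > 0\<close> makes the segment run to the
  side to which \<open>n(c)\<close> points.\<close>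

lemma plane_invariance_halfplane:
  assumes u: "u \<noteq> 0" and mu: "mu = a *\<^sub>R u + b *\<^sub>R width_field u" "b > 0"
  shows "Z mu - Z u \<in> span {u, width_field u} \<and> Z (- mu) - Z u \<in> span {u, width_field u}"
proof -
  let ?N = "span {u, width_field u}"
  define d where "d = mu - u"
  define c where "c = (\<lambda>x. u + x *\<^sub>R d)"
  have dN: "d \<in> ?N" unfolding d_def mu(1) by (intro span_diff span_add span_scale span_base) auto
  have cN: "c x \<in> ?N" for x unfolding c_def by (intro span_add span_scale dN span_base) auto
  have un: "omega u (width_field u) < 0" using width_field_positive[OF u] symplectic_skew[of u "width_field u"] by simp
  have ud: "omega u d < 0" using un mu(2) by (simp add: d_def mu(1) symplectic_simps mult_pos_neg)
  have c0: "c x \<noteq> 0" if "0 \<le> x" for x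
  proof
    assume "c x = 0"
    moreover have "omega u (c x) = x * omega u d" by (simp add: c_def symplectic_simps)
    ultimately have "x * omega u d = 0" by (simp add: symplectic_simps)
    then have "x = 0" using ud by simp
    then show False using \<open>c x = 0\<close> u by (simp add: c_def)
  qed
  have contc: "continuous_on {0..1} c" unfolding c_def by (intro continuous_intros)
  have contZ: "continuous_on (- {0}) Z" using isCont_Z by (intro continuous_at_imp_continuous_on) auto
  define X where "X = ({0..1} \<inter> (\<lambda>x. Z (c x) - Z u) -` ?N) \<inter> ({0..1} \<inter> (\<lambda>x. Z (- c x) - Z u) -` ?N)"
  have X: "x \<in> X \<longleftrightarrow> 0 \<le> x \<and> x \<le> 1 \<and> Z (c x) - Z u \<in> ?N \<and> Z (- c x) - Z u \<in> ?N" for x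
    by (auto simp: X_def)
  have "closed X" unfolding X_def
    by (intro closed_Int continuous_closed_preimage closed_span closed_atLeastAtMost continuous_on_diff
        continuous_on_const continuous_on_compose2[OF contZ] continuous_on_minus contc) (use c0 in auto)
  have "0 \<in> X" using span_neg[OF span_base[of "width_field u" "{u, width_field u}"]]
    by (auto simp: X c_def width_field_def span_0 simp del: span_neg)
  have extend: "\<exists>e>0. \<forall>t. 0 \<le> t \<and> t \<le> e \<and> x + t \<le> 1 \<longrightarrow> x + t \<in> X" if x: "x \<in> X" for x
  proof -
    have x0: "0 \<le> x" using x X by blast
    let ?c = "c x" and ?n = "width_field (c x)"
    have nN: "?n \<in> ?N" using span_diff[of "Z ?c - Z u" _ "Z (- ?c) - Z u"] x by (simp add: X width_field_def)
    have cn: "omega ?c ?n < 0" using width_field_positive[OF c0[OF x0]] symplectic_skew[of ?c ?n] by simp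
    define p q where "p = omega d ?n / omega ?c ?n" and "q = omega ?c d / omega ?c ?n"
    have d: "d = p *\<^sub>R ?c + q *\<^sub>R ?n"
      unfolding p_def q_def by (rule span_pair_rebase[OF cN nN dN]) (use cn in simp)
    have "omega ?c d = omega u d" by (simp add: c_def symplectic_simps)
    then have q: "q > 0" using ud cn by (simp add: q_def divide_neg_neg)
    obtain l where l: "l > 0" "\<And>s. 0 \<le> s \<Longrightarrow> s \<le> l \<Longrightarrow>
      Z (?c + s *\<^sub>R ?n) - Z ?c \<in> span {?c, ?n} \<and> Z (- (?c + s *\<^sub>R ?n)) - Z ?c \<in> span {?c, ?n}"
      by (rule local_invariance[OF c0[OF x0]]) blast
    have sub: "span {?c, ?n} \<subseteq> ?N" by (intro span_minimal) (use cN nN in auto)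
    \<comment> \<open>A step \<open>t \<le> e\<close> keeps \<open>1 + t * p \<ge> 1 / 2\<close> and the parameter \<open>s\<close> below at most \<open>l\<close>.\<close>
    define e where "e = min (1 / (2 * (\<bar>p\<bar> + 1))) (l / (2 * q))"
    have e: "e > 0" using l q by (auto simp: e_def)
    have "x + t \<in> X" if t: "0 \<le> t" "t \<le> e" "x + t \<le> 1" for t
    proof -
      have "t \<le> 1 / (2 * (\<bar>p\<bar> + 1))" "t \<le> l / (2 * q)" using t(2) by (auto simp: e_def)
      then have tp: "t * (2 * (\<bar>p\<bar> + 1)) \<le> 1" and tq: "2 * (t * q) \<le> l"
        using q pos_le_divide_eq[of "2 * (\<bar>p\<bar> + 1)" t 1] pos_le_divide_eq[of "2 * q" t l]
        by (simp_all add: mult_ac)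
      have "t * \<bar>p\<bar> \<le> 1 / 2" using tp t(1) by (simp add: algebra_simps)
      moreover have "- (t * p) \<le> t * \<bar>p\<bar>" using t(1) by (metis abs_ge_minus_self abs_mult abs_of_nonneg)
      ultimately have k: "1 + t * p \<ge> 1 / 2" by linarith
      then have k0: "1 + t * p > 0" by linarith
      define s where "s = t * q / (1 + t * p)"
      have s0: "s \<ge> 0" using t(1) q k0 by (simp add: s_def)
      have "s * (1 + t * p) = t * q" using k0 by (simp add: s_def)
      moreover have "s * (1 / 2) \<le> s * (1 + t * p)" by (rule mult_left_mono[OF k s0])
      ultimately have sl: "s \<le> l" using tq by linarith
      have "(1 + t * p) *\<^sub>R (?c + s *\<^sub>R ?n) = (1 + t * p) *\<^sub>R ?c + (t * q) *\<^sub>R ?n"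
        using k0 by (simp add: scaleR_add_right s_def)
      also have "\<dots> = ?c + t *\<^sub>R d" by (subst d) (simp add: algebra_simps)
      also have "\<dots> = c (x + t)" by (simp add: c_def algebra_simps)
      finally have eq: "c (x + t) = (1 + t * p) *\<^sub>R (?c + s *\<^sub>R ?n)" by simp
      have eq': "- c (x + t) = (1 + t * p) *\<^sub>R (- (?c + s *\<^sub>R ?n))" by (simp only: eq scaleR_minus_right)
      have "Z (c (x + t)) - Z ?c \<in> ?N" "Z (- c (x + t)) - Z ?c \<in> ?N"
        using l(2)[OF s0 sl] sub unfolding eq' unfolding eq Z_scale[OF k0] by blast+
      from this[THEN span_add, of "Z ?c - Z u"] show ?thesis using x t x0 by (auto simp: X)
    qed
    then show ?thesis using e by blast
  qed
  define Y where "Y = {y. 0 \<le> y \<and> y \<le> 1 \<and> {0..y} \<subseteq> X}"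
  have "0 \<in> Y" using \<open>0 \<in> X\<close> by (auto simp: Y_def)
  have bdd: "bdd_above Y" by (rule bdd_aboveI[of _ 1]) (simp add: Y_def)
  define s where "s = Sup Y"
  have s0: "0 \<le> s" unfolding s_def by (rule cSup_upper[OF \<open>0 \<in> Y\<close> bdd])
  have s1: "s \<le> 1" unfolding s_def
  proof (rule cSup_least)
    show "Y \<noteq> {}" using \<open>0 \<in> Y\<close> by blast
  qed (simp add: Y_def)
  have below: "{0..<s} \<subseteq> X"
  proof
    fix x assume "x \<in> {0..<s}"
    then obtain y where "y \<in> Y" "x < y" "0 \<le> x" using less_cSup_iff[OF _ bdd] \<open>0 \<in> Y\<close> s_def by force
    then show "x \<in> X" by (auto simp: Y_def)
  qed
  have sX: "s \<in> X"
  proof (cases "s = 0")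
    case False
    then have "0 < s" using s0 by simp
    then have "s \<in> closure {0..<s}" by simp
    then show ?thesis using closure_minimal[OF below \<open>closed X\<close>] by blast
  qed (use \<open>0 \<in> X\<close> in simp)
  have "s = 1"
  proof (rule ccontr)
    assume "s \<noteq> 1"
    then have "s < 1" using s1 by simp
    obtain e where e: "e > 0" "\<And>t. 0 \<le> t \<Longrightarrow> t \<le> e \<Longrightarrow> s + t \<le> 1 \<Longrightarrow> s + t \<in> X"
      using extend[OF sX] by blast
    define y where "y = min (s + e) 1"
    have y: "s < y" "y \<le> 1" "y \<le> s + e" using e(1) \<open>s < 1\<close> by (auto simp: y_def)
    have "{0..y} \<subseteq> X"
    proof
      fix x assume x: "x \<in> {0..y}"
      show "x \<in> X"
      proof (cases "x < s")
        case False
        then show ?thesis using e(2)[of "x - s"] x y by auto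
      qed (use below x in auto)
    qed
    then have "y \<in> Y" using y s0 by (auto simp: Y_def)
    then have "y \<le> s" unfolding s_def by (rule cSup_upper[OF _ bdd])
    then show False using y(1) by simp
  qed
  then show ?thesis using sX by (simp add: X c_def d_def)
qed

text \<open>One of \<open>mu\<close> and \<open>- mu\<close> lies in the half-plane of \<open>plane_invariance_halfplane\<close>, which treats both signs at once.\<close>

theorem plane_invariance:
  assumes u: "u \<noteq> 0" and mu: "mu \<in> span {u, width_field u}" "mu \<noteq> 0"
  shows "Z mu - Z u \<in> span {u, width_field u}"
proof -
  obtain a b where ab: "mu = a *\<^sub>R u + b *\<^sub>R width_field u" using mu(1) span_pair by blast
  consider "b > 0" | "b < 0" | "b = 0" by linarith
  then show ?thesis
  proof cases
    case 1
    then show ?thesis using plane_invariance_halfplane[OF u ab] by blast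
  next
    case 2
    have "- mu = (- a) *\<^sub>R u + (- b) *\<^sub>R width_field u" by (simp add: ab)
    from plane_invariance_halfplane[OF u this] 2 show ?thesis by simp
  next
    case 3
    then have a: "mu = a *\<^sub>R u" "a \<noteq> 0" using ab mu(2) by auto
    show ?thesis
    proof (cases "a > 0")
      case True
      then show ?thesis using a by (simp add: Z_scale span_0)
    next
      case False
      then have "- a > 0" using a(2) by simp
      moreover have "mu = (- a) *\<^sub>R (- u)" using a by simp
      ultimately have "Z mu = Z (- u)" using Z_scale by metis
      then have "Z mu - Z u = - width_field u" by (simp add: width_field_def)
      then show ?thesis using span_neg[OF span_base] by (metis insertI1 insert_commute)
    qed
  qed
qed

lemma width_field_plane:
  assumes u: "u \<noteq> 0" and mu: "mu \<in> span {u, width_field u}" "mu \<noteq> 0"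
  shows "width_field mu \<in> span {u, width_field u}"
proof -
  have "Z mu - Z u \<in> span {u, width_field u}" "Z (- mu) - Z u \<in> span {u, width_field u}"
    using plane_invariance[OF u mu] plane_invariance[OF u span_neg[OF mu(1)]] mu(2) by simp_all
  from span_diff[OF this] show ?thesis by (simp add: width_field_def)
qed

end

section \<open>Reconstruction of the body\<close>

text \<open>A linear complex structure compatible with the symplectic form defines a Hermitian inner product; the
  coordinates with respect to a unitary basis \<open>e\<close> are symplectic and turn the inner product into the standard one.\<close>

lemma symplectic_normal_form:
  fixes I :: "'n::finite phase_space \<Rightarrow> 'n phase_space"
  assumes lin: "linear I" and II: "\<And>u. I (I u) = - u"
    and skew: "\<And>u w. omega (I u) w = - omega u (I w)" and pos: "\<And>u. u \<noteq> 0 \<Longrightarrow> omega (I u) u > 0"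
  shows "\<exists>L :: 'n phase_space \<Rightarrow> 'n phase_space. linear L \<and> bij L \<and>
    (\<forall>u w. omega (L u) (L w) = omega u w) \<and> (\<forall>u. (norm (L u))\<^sup>2 = omega (I u) u)"
proof -
  note I_lin = linear_add[OF lin] linear_diff[OF lin] linear_scale[OF lin] linear_neg[OF lin] linear_sum[OF lin]
  define g where "g = (\<lambda>x y. omega (I x) y)"
  have g_sym: "g x y = g y x" for x y
    using skew[of x y] symplectic_skew[of x "I y"] by (simp add: g_def)
  have g_I: "g (I x) y = - omega x y" "g x (I y) = omega x y" "g (I x) (I y) = g x y" for x y
    using skew[of x y] skew[of x "I y"] by (simp_all add: g_def II symplectic_simps)
  have g_simps: "g (x + y) w = g x w + g y w" "g (x - y) w = g x w - g y w" "g (r *\<^sub>R x) w = r * g x w"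
    "g w (x + y) = g w x + g w y" "g w (x - y) = g w x - g w y" "g w (r *\<^sub>R x) = r * g w x" for x y w r
    by (simp_all add: g_def I_lin symplectic_simps)
  have ex: "\<exists>e. \<forall>i\<in>A. \<forall>j\<in>A. g (e i) (e j) = (if i = j then 1 else 0) \<and> g (e i) (I (e j)) = 0"
    for A :: "'n set"
  proof (induction A rule: finite_induct[OF finite])
    case (2 a A)
    obtain e where e: "\<And>i j. i \<in> A \<Longrightarrow> j \<in> A \<Longrightarrow> g (e i) (e j) = (if i = j then 1 else 0)"
      "\<And>i j. i \<in> A \<Longrightarrow> j \<in> A \<Longrightarrow> g (e i) (I (e j)) = 0" using 2(3) by metis
    define X where "X = (\<lambda>j. J (I (e j))) ` A \<union> (\<lambda>j. J (I (I (e j)))) ` A"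
    have "finite A" by simp
    then have "card X \<le> card A + card A"
      unfolding X_def by (intro order_trans[OF card_Un_le] add_mono card_image_le)
    moreover have "card (insert a A) \<le> CARD('n)" by (rule card_mono) auto
    then have "card A < CARD('n)" using 2(2) by simp
    moreover have "dim X \<le> card X" by (rule dim_le_card') (simp add: X_def)
    ultimately have "dim X < DIM('n phase_space)" by simp
    then obtain x where x: "x \<noteq> 0" "\<And>y. y \<in> span X \<Longrightarrow> orthogonal x y"
      using orthogonal_to_subspace_exists by blast
    have gx: "g (e j) x = 0" "g (I (e j)) x = 0" if "j \<in> A" for j
      using x(2)[of "J (I (e j))"] x(2)[of "J (I (I (e j)))"] that
      by (simp_all add: g_def symplectic_form_eq_inner X_def span_base orthogonal_def inner_commute)
    define s where "s = sqrt (g x x)"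
    have "g x x > 0" using pos[OF x(1)] by (simp add: g_def)
    then have s: "s > 0" "s * s = g x x" by (simp_all add: s_def)
    define w where "w = (1 / s) *\<^sub>R x"
    have w1: "g w w = 1" using s(1) by (simp add: w_def g_simps flip: s(2))
    have w2: "g (e j) w = 0" "g w (e j) = 0" "g (e j) (I w) = 0" "g w (I (e j)) = 0" if "j \<in> A" for j
    proof -
      show "g (e j) w = 0" "g w (e j) = 0"
        using gx[OF that] g_sym[of w "e j"] by (simp_all add: w_def g_simps)
      have "g w (I (e j)) = 0" using gx[OF that] g_sym[of w "I (e j)"] by (simp add: w_def g_simps)
      moreover have "omega (e j) w = - omega w (e j)" by (rule symplectic_skew)
      ultimately show "g w (I (e j)) = 0" "g (e j) (I w) = 0" by (simp_all add: g_I)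
    qed
    have w3: "g w (I w) = 0" by (simp add: g_I)
    have "\<forall>i\<in>insert a A. \<forall>j\<in>insert a A. g ((e(a := w)) i) ((e(a := w)) j) = (if i = j then 1 else 0)
        \<and> g ((e(a := w)) i) (I ((e(a := w)) j)) = 0"
      using e w1 w2 w3 2(2) by auto
    then show ?case by blast
  qed simp
  from ex[of UNIV] obtain e :: "'n \<Rightarrow> 'n phase_space" where e: "\<And>i j. g (e i) (e j) = (if i = j then 1 else 0)"
    "\<And>i j. g (e i) (I (e j)) = 0" by auto
  \<comment> \<open>The sign makes \<open>E\<close> intertwine \<open>- J\<close> with \<open>I\<close>, since \<open>omega (J u) u\<close> is negative where \<open>omega (I u) u\<close> is positive.\<close>
  define E where "E = (\<lambda>a. \<Sum>i\<in>UNIV. (fst a $ i) *\<^sub>R e i - (snd a $ i) *\<^sub>R I (e i))"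
  have linE: "linear E"
    by (rule linearI) (simp_all add: E_def scaleR_add_left scaleR_right_diff_distrib scaleR_sum_right sum.distrib
        sum_subtractf algebra_simps)
  have gsum: "g (\<Sum>i\<in>UNIV. f i) y = (\<Sum>i\<in>UNIV. g (f i) y)" "g y (\<Sum>i\<in>UNIV. f i) = (\<Sum>i\<in>UNIV. g y (f i))"
    for f :: "'n \<Rightarrow> 'n phase_space" and y
    by (simp_all add: g_def I_lin symplectic.sum_left symplectic.sum_right)
  have Ie: "g (I (e i)) (e j) = 0" for i j using e(2)[of j i] g_sym by metis
  have delta: "(\<Sum>i\<in>UNIV. x i * (if i = j then 1 else 0)) = x j" for x :: "'n \<Rightarrow> real" and j
    by (simp add: if_distrib[of "(*) _"] cong: if_cong)
  have gE1: "g (E a) (e j) = fst a $ j" for a j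
  proof -
    have "g (E a) (e j) = (\<Sum>i\<in>UNIV. (fst a $ i) * (if i = j then 1 else 0))"
      by (simp only: E_def gsum g_simps e Ie mult_zero_right diff_zero)
    then show ?thesis by (simp only: delta)
  qed
  have gE2: "g (E a) (I (e j)) = - (snd a $ j)" for a j
  proof -
    have "g (E a) (I (e j)) = - (\<Sum>i\<in>UNIV. (snd a $ i) * (if i = j then 1 else 0))"
      by (simp only: E_def gsum g_simps e g_I(3) mult_zero_right diff_0 sum_negf)
    then show ?thesis by (simp only: delta)
  qed
  have gE: "g (E a) (E b) = a \<bullet> b" for a b
  proof -
    have "g (E a) (E b) = (\<Sum>j\<in>UNIV. (fst b $ j) * g (E a) (e j) - (snd b $ j) * g (E a) (I (e j)))"
      by (subst fun_cong[OF E_def, of b]) (simp only: gsum g_simps)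
    then show ?thesis
      by (simp add: gE1 gE2 inner_prod_def inner_vec_def sum.distrib mult.commute)
  qed
  have IE: "I (E a) = E (- J a)" for a
    by (simp add: E_def I_lin II complex_structure_def sum_subtractf sum.distrib sum_negf)
  have symE: "omega (E a) (E b) = omega a b" for a b
  proof -
    have "omega (E a) (E b) = - g (E (- J a)) (E b)" using g_I(1)[of "E a" "E b"] IE by simp
    then show ?thesis by (simp only: gE symplectic_form_eq_inner inner_minus_left minus_minus)
  qed
  have "inj E"
  proof (subst linear_injective_0[OF linE], intro allI impI)
    fix a assume "E a = 0"
    then have "a \<bullet> a = 0" using gE[of a a] by (simp add: g_def symplectic_simps)
    then show "a = 0" by simp
  qed
  then obtain L where L: "linear L" "\<And>x. L (E x) = x" "\<And>x. E (L x) = x"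
    using linear_injective_isomorphism[OF linE] by blast
  show ?thesis
  proof (intro exI[of _ L] conjI allI L(1))
    show "bij L" by (rule bij_betw_byWitness[where f' = E]) (use L in auto)
    show "omega (L u) (L w) = omega u w" for u w using symE[of "L u" "L w"] by (simp add: L)
    show "(norm (L u))\<^sup>2 = omega (I u) u" for u
      using gE[of "L u" "L u"] by (simp add: L g_def dot_square_norm)
  qed
qed

text \<open>Neither the open ball nor the complement of the closed ball meets the boundary of the set, and both are
  connected.\<close>

lemma cball_if_frontier_subset_sphere:
  fixes S :: "'a::euclidean_space set"
  assumes S: "compact S" "interior S \<noteq> {}" and fr: "frontier S \<subseteq> sphere 0 r" and dim: "DIM('a) \<ge> 2"
  shows "S = cball 0 r"
proof
  show "S \<subseteq> cball 0 r"
  proof (rule ccontr)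
    assume "\<not> S \<subseteq> cball 0 r"
    then have 1: "- cball 0 r \<inter> S \<noteq> {}" by blast
    have "connected (- cball (0::'a) r)"
      by (rule connected_complement_bounded_convex[OF bounded_cball convex_cball dim])
    moreover have "- cball 0 r - S \<noteq> {}"
    proof
      assume "- cball 0 r - S = {}"
      then have "cball 0 r \<union> S = UNIV" by blast
      moreover have "bounded (cball 0 r \<union> S)" using S(1) by (simp add: compact_imp_bounded)
      ultimately show False by simp
    qed
    ultimately have "- cball 0 r \<inter> frontier S \<noteq> {}" using connected_Int_frontier 1 by blast
    then show False using fr by auto
  qed
  then have "interior S \<subseteq> ball 0 r" using interior_mono interior_cball by blast
  then have 2: "ball 0 r \<inter> S \<noteq> {}" using S(2) interior_subset by blast
  have "ball 0 r \<subseteq> S"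
  proof (rule ccontr)
    assume "\<not> ball 0 r \<subseteq> S"
    then have "ball 0 r \<inter> frontier S \<noteq> {}" using connected_Int_frontier[OF connected_ball 2] by blast
    then show False using fr by auto
  qed
  then have "closure (ball 0 r) \<subseteq> S" using S(1) by (simp add: closure_minimal compact_imp_closed)
  moreover have "r > 0" using 2 by (metis Int_empty_left ball_eq_empty not_le)
  ultimately show "cball 0 r \<subseteq> S" by simp
qed

context billiard_table
begin

lemma Z_differentiable:
  assumes "u \<noteq> 0"
  shows "Z differentiable (at u)"
proof -
  obtain D where "(support_point has_derivative D) (at u)"
    using support_point_differentiable[OF assms] unfolding differentiable_def by blast
  from has_derivative_minus[OF bounded_linear.has_derivative[OF bounded_linear_J this]]
  show ?thesis unfolding Z_def by (rule differentiableI)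
qed

lemma support_function_reflected:
  assumes "u \<noteq> 0"
  shows "((\<lambda>x. support_point (- x) \<bullet> x) has_derivative (\<lambda>k. support_point (- u) \<bullet> k)) (at u)"
proof -
  have m: "(uminus has_derivative uminus) (at u)" by (rule has_derivative_minus[OF has_derivative_ident])
  have "((\<lambda>x. support_point x \<bullet> x) \<circ> uminus has_derivative (\<lambda>k. support_point (- u) \<bullet> k) \<circ> uminus) (at u)"
    by (rule diff_chain_at[OF m support_function_derivative]) (use assms in simp)
  from has_derivative_minus[OF this] show ?thesis by (simp add: o_def)
qed

text \<open>The Hamiltonian field of half the square of the width function.\<close>

definition energy_field :: "'n phase_space \<Rightarrow> 'n phase_space" where
  "energy_field u = omega (width_field u) u *\<^sub>R width_field u"

text \<open>By \<open>J_Z\<close>, \<open>J\<close> maps this to the midpoint of the two points of \<open>K\<close> with normals \<open>u\<close> and \<open>- u\<close>.\<close>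

definition center_field :: "'n phase_space \<Rightarrow> 'n phase_space" where
  "center_field u = (1 / 2) *\<^sub>R (Z u + Z (- u))"

lemma J_width_field: "J (width_field u) = support_point u - support_point (- u)"
  by (simp add: width_field_def J_diff)

lemma energy_eq: "omega (width_field u) u = support_point u \<bullet> u - support_point (- u) \<bullet> u"
  by (simp add: symplectic_form_eq_inner J_width_field inner_diff_left)

lemma width_field_minus: "width_field (- u) = - width_field u"
  by (simp add: width_field_def)

lemma width_field_scale: "r > 0 \<Longrightarrow> width_field (r *\<^sub>R u) = width_field u"
  using Z_scale[of r u] Z_scale[of r "- u"] by (simp add: width_field_def)

lemma energy_field_homogeneous: "energy_field (r *\<^sub>R u) = r *\<^sub>R energy_field u"
proof -
  consider "r > 0" | "r = 0" | "r < 0" by linarith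
  then show ?thesis
  proof cases
    case 1
    then show ?thesis by (simp add: energy_field_def width_field_scale symplectic_simps)
  next
    case 2
    then show ?thesis by (simp add: energy_field_def symplectic_simps)
  next
    case 3
    then have "width_field (r *\<^sub>R u) = - width_field u" using width_field_scale[of "- r" "- u"] width_field_minus by simp
    then show ?thesis by (simp add: energy_field_def symplectic_simps)
  qed
qed

lemma Z_reflected_differentiable:
  assumes "u \<noteq> 0"
  shows "(\<lambda>x. Z (- x)) differentiable (at u)"
proof -
  obtain D where D: "(Z has_derivative D) (at (- u))"
    using Z_differentiable[of "- u"] assms unfolding differentiable_def by auto
  have m: "(uminus has_derivative uminus) (at u)" by (rule has_derivative_minus[OF has_derivative_ident])
  from diff_chain_at[OF m D] show ?thesis unfolding o_def by (rule differentiableI)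
qed

lemma energy_derivative:
  assumes "u \<noteq> 0"
  shows "((\<lambda>x. omega (width_field x) x) has_derivative (\<lambda>k. J (width_field u) \<bullet> k)) (at u)"
  unfolding energy_eq J_width_field inner_diff_left
  by (intro has_derivative_diff support_function_derivative support_function_reflected assms)

lemma energy_field_differentiable:
  assumes "u \<noteq> 0"
  shows "energy_field differentiable (at u)"
proof -
  have "width_field differentiable (at u)"
    unfolding width_field_def by (intro differentiable_diff Z_differentiable Z_reflected_differentiable assms)
  then obtain F where "(width_field has_derivative F) (at u)" unfolding differentiable_def by blast
  from has_derivative_scaleR[OF energy_derivative[OF assms] this]
  show ?thesis unfolding energy_field_def by (rule differentiableI)
qed

text \<open>\<open>F = - J \<nabla>h\<close>, so that the symmetry of the second derivative of \<open>h\<close> makes the derivative of \<open>F\<close> skew for the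
  symplectic form.\<close>

lemma hamiltonian_from_gradient:
  fixes h :: "'n phase_space \<Rightarrow> real"
  assumes u: "u \<noteq> 0" and h: "\<And>x. x \<noteq> 0 \<Longrightarrow> (h has_derivative (\<lambda>k. J (F x) \<bullet> k)) (at x)"
    and F: "(F has_derivative F') (at u)"
  shows "omega (F' x) y = - omega x (F' y)"
proof -
  have "\<forall>\<^sub>F x in nhds u. (h has_derivative (\<lambda>k. J (F x) \<bullet> k)) (at x)"
    unfolding eventually_nhds using u h by (intro exI[of _ "- {0}"]) auto
  moreover have "((\<lambda>x. J (F x)) has_derivative (\<lambda>k. J (F' k))) (at u)"
    by (rule bounded_linear.has_derivative[OF bounded_linear_J F])
  ultimately have "J (F' x) \<bullet> y = J (F' y) \<bullet> x" by (rule gradient_derivative_symmetric)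
  then show ?thesis using symplectic_skew[of x "F' y"] by (simp add: symplectic_form_eq_inner)
qed

lemma energy_field_hamiltonian:
  assumes u: "u \<noteq> 0" and S: "(energy_field has_derivative S) (at u)"
  shows "omega (S x) y = - omega x (S y)"
proof (rule hamiltonian_from_gradient[OF u _ S])
  fix x :: "'n phase_space" assume x: "x \<noteq> 0"
  let ?H = "\<lambda>x. omega (width_field x) x"
  have "((\<lambda>x. (1 / 2) * (?H x * ?H x)) has_derivative
      (\<lambda>k. (1 / 2) * (?H x * (J (width_field x) \<bullet> k) + (J (width_field x) \<bullet> k) * ?H x))) (at x)"
    by (intro has_derivative_mult_right has_derivative_mult energy_derivative x)
  then show "((\<lambda>x. (1 / 2) * (?H x * ?H x)) has_derivative (\<lambda>k. J (energy_field x) \<bullet> k)) (at x)"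
    by (simp add: energy_field_def J_scale)
qed

lemma center_field_hamiltonian:
  assumes u: "u \<noteq> 0" and S: "(center_field has_derivative S) (at u)"
  shows "omega (S x) y = - omega x (S y)"
proof (rule hamiltonian_from_gradient[OF u _ S])
  fix x :: "'n phase_space" assume x: "x \<noteq> 0"
  have "((\<lambda>x. (1 / 2) * (support_point x \<bullet> x + support_point (- x) \<bullet> x)) has_derivative
      (\<lambda>k. (1 / 2) * (support_point x \<bullet> k + support_point (- x) \<bullet> k))) (at x)"
    by (intro has_derivative_mult_right has_derivative_add support_function_derivative
        support_function_reflected x)
  then show "((\<lambda>x. (1 / 2) * (support_point x \<bullet> x + support_point (- x) \<bullet> x)) has_derivative
      (\<lambda>k. J (center_field x) \<bullet> k)) (at x)"
    by (simp add: center_field_def J_scale J_add inner_add_left)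
qed

text \<open>The three summands on the right of \<open>eq\<close> are nonnegative, as each \<open>z(u)\<close> maximises \<open>u\<close>. If all vanish, the
  width functions agree and \<open>z(u) = z(w)\<close>, so that \<open>u\<close> and \<open>w\<close> are parallel and equal.\<close>

lemma energy_field_monotone:
  assumes "u \<noteq> w"
  shows "omega (energy_field u - energy_field w) (u - w) > 0"
proof -
  let ?H = "\<lambda>x. omega (width_field x) x"
  have le: "omega (width_field u) w \<le> ?H w" for u w
    using support_point_max[OF support_point(1), of w u] support_point_max[OF support_point(1), of "- w" "- u"]
    by (simp add: symplectic_form_eq_inner J_width_field inner_diff_left inner_diff_right inner_commute)
  have nonneg: "?H x \<ge> 0" for x using width_field_positive[of x] by (cases "x = 0") (auto simp: symplectic_simps)
  have eq: "omega (energy_field u - energy_field w) (u - w)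
      = (?H u - ?H w)\<^sup>2 + ?H u * (?H w - omega (width_field u) w) + ?H w * (?H u - omega (width_field w) u)"
    by (simp add: energy_field_def symplectic_simps power2_eq_square algebra_simps)
  have parts: "0 \<le> ?H u * (?H w - omega (width_field u) w)" "0 \<le> ?H w * (?H u - omega (width_field w) u)"
    using le[of u w] le[of w u] nonneg by simp_all
  have "omega (energy_field u - energy_field w) (u - w) \<noteq> 0"
  proof
    assume "omega (energy_field u - energy_field w) (u - w) = 0"
    then have z: "(?H u - ?H w)\<^sup>2 = 0" "?H u * (?H w - omega (width_field u) w) = 0"
      using parts zero_le_power2[of "?H u - ?H w"] unfolding eq by linarith+
    then have H: "?H u = ?H w" by simp
    show False
    proof (cases "u = 0 \<or> w = 0")
      case True
      then have "?H u = 0 \<and> ?H w = 0" using H by (auto simp: symplectic_simps)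
      then show False using width_field_positive[of u] width_field_positive[of w] assms by force
    next
      case False
      then have "omega (width_field u) w = ?H w" using z(2) width_field_positive[of u] by auto
      then have "w \<bullet> support_point w - w \<bullet> support_point (- w) = w \<bullet> support_point u - w \<bullet> support_point (- u)"
        by (simp add: symplectic_form_eq_inner J_width_field inner_diff_left inner_diff_right inner_commute)
      then have "w \<bullet> support_point w \<le> w \<bullet> support_point u"
        using support_point_max[OF support_point(1), of "- w" "- u"] by simp
      then have "support_point w = support_point u"
        using False by (intro support_point_eqI' support_point) auto
      then have n: "(1 / norm w) *\<^sub>R w = (1 / norm u) *\<^sub>R u"
        using support_point_injective False by blast
      define r where "r = norm w / norm u"
      have r: "r > 0" using False by (simp add: r_def)
      have "w = norm w *\<^sub>R ((1 / norm w) *\<^sub>R w)" using False by simp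
      also have "\<dots> = r *\<^sub>R u" unfolding n by (simp add: r_def)
      finally have w: "w = r *\<^sub>R u" .
      have "?H w = r * ?H u" using r by (simp add: w width_field_scale symplectic_simps)
      then have "(r - 1) * ?H u = 0" using H by (simp add: algebra_simps)
      then have "r = 1" using width_field_positive[of u] False by simp
      then show False using w assms by simp
    qed
  qed
  moreover have "omega (energy_field u - energy_field w) (u - w) \<ge> 0" unfolding eq using parts by simp
  ultimately show ?thesis by simp
qed

end

context planar_billiard
begin

lemma span_energy_field: "u \<noteq> 0 \<Longrightarrow> r \<noteq> 0 \<Longrightarrow> span {u, r *\<^sub>R energy_field u} = span {u, width_field u}"
proof -
  assume u: "u \<noteq> 0" and r: "r \<noteq> 0"
  define s where "s = r * omega (width_field u) u"
  have s: "s \<noteq> 0" using width_field_positive[OF u] r by (simp add: s_def)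
  have "r *\<^sub>R energy_field u = s *\<^sub>R width_field u" by (simp add: energy_field_def s_def)
  then have "r *\<^sub>R energy_field u \<in> span {u, width_field u}" by (simp add: span_base span_scale)
  moreover have "width_field u \<in> span {u, r *\<^sub>R energy_field u}"
  proof -
    have "width_field u = (1 / s) *\<^sub>R (r *\<^sub>R energy_field u)" using s by (simp add: energy_field_def s_def)
    then show ?thesis by (metis insertCI span_base span_scale)
  qed
  ultimately show ?thesis by (intro subset_antisym span_minimal) (auto simp: span_base)
qed

lemma energy_field_plane: "energy_field (a *\<^sub>R u + b *\<^sub>R energy_field u) \<in> span {u, energy_field u}"
proof (cases "u = 0 \<or> a *\<^sub>R u + b *\<^sub>R energy_field u = 0")
  case True
  moreover have "energy_field 0 = 0" by (simp add: energy_field_def symplectic_simps)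
  ultimately show ?thesis by (auto simp: span_0)
next
  case False
  then have sp: "span {u, energy_field u} = span {u, width_field u}" using span_energy_field[of u 1] by simp
  have "a *\<^sub>R u + b *\<^sub>R energy_field u \<in> span {u, energy_field u}" using span_pair by blast
  then have "width_field (a *\<^sub>R u + b *\<^sub>R energy_field u) \<in> span {u, width_field u}"
    using width_field_plane False unfolding sp by blast
  then show ?thesis unfolding sp energy_field_def[of "a *\<^sub>R u + b *\<^sub>R energy_field u"] by (rule span_scale)
qed

text \<open>The field \<open>energy_field\<close> is linear and \<open>center_field\<close> is constant. This determines all support points:
  \<open>z(u) = p + J n(u) / 2\<close> with \<open>n(u)\<close> a multiple of the linear field. In the unitary coordinates \<open>L\<close>
  they all have the same distance from the image of \<open>p\<close>, after the additional turn by \<open>J\<close>.\<close>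

theorem ball_up_to_symplectomorphism:
  assumes dim: "CARD('n) \<ge> 2"
  shows "\<exists>\<phi> r. affine_symplectomorphism \<phi> \<and> r > 0 \<and> \<phi> ` K = cball 0 r"
proof -
  define S where "S = (\<lambda>u. frechet_derivative energy_field (at u))"
  have dS: "(energy_field has_derivative S u) (at u)" if "u \<noteq> 0" for u
    using energy_field_differentiable[OF that] unfolding S_def by (simp add: frechet_derivative_works)
  interpret phf: planar_hamiltonian_field energy_field S
  proof
    show "omega (S u x) y = - omega x (S u y)" if "u \<noteq> 0" for u x y
      by (rule energy_field_hamiltonian[OF that dS[OF that]])
  qed (fact dim energy_field_homogeneous dS energy_field_monotone energy_field_plane)+
  obtain k where k: "k > 0" "linear energy_field" "\<And>u. energy_field (energy_field u) = (- k) *\<^sub>R u"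
    using phf.linear_Y by blast
  define s where "s = sqrt k"
  have s: "s > 0" "s * s = k" using k by (simp_all add: s_def)
  define I where "I = (\<lambda>u. (1 / s) *\<^sub>R energy_field u)"
  have linI: "linear I"
    by (rule linearI) (simp_all add: I_def linear_add[OF k(2)] linear_scale[OF k(2)] scaleR_add_right)
  have II: "I (I u) = - u" for u
  proof -
    have "I (I u) = ((1 / s) * (1 / s) * - k) *\<^sub>R u" by (simp add: I_def linear_scale[OF k(2)] k(3))
    also have "(1 / s) * (1 / s) * - k = - 1" using s(1) unfolding s(2)[symmetric] by simp
    finally show ?thesis by simp
  qed
  have skewY: "omega (energy_field x) y = - omega x (energy_field y)" for x y
  proof -
    obtain u :: "'n phase_space" where u: "u \<noteq> 0" using nonempty_Basis nonzero_Basis by blast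
    have "(energy_field has_derivative energy_field) (at u)"
      using k(2) by (intro bounded_linear_imp_has_derivative) (simp add: linear_conv_bounded_linear)
    then show ?thesis by (rule energy_field_hamiltonian[OF u])
  qed
  have skewI: "omega (I x) y = - omega x (I y)" for x y
    using skewY[of x y] by (simp add: I_def symplectic_simps)
  have posI: "omega (I u) u > 0" if "u \<noteq> 0" for u
    using phf.energy_pos[OF that] s(1) by (simp add: I_def symplectic_simps)
  have dT: "(center_field has_derivative frechet_derivative center_field (at u)) (at u)" if "u \<noteq> 0" for u
  proof -
    have "center_field differentiable (at u)"
      unfolding center_field_def
      by (intro differentiable_scaleR differentiable_const differentiable_add Z_differentiable
          Z_reflected_differentiable that)
    then show ?thesis by (simp add: frechet_derivative_works)
  qed
  interpret pef: planar_even_field I center_field "\<lambda>u. frechet_derivative center_field (at u)"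
  proof (rule planar_even_field.intro)
    show "center_field (r *\<^sub>R u) = center_field u" if "r \<noteq> 0" for r u
    proof (cases "r > 0")
      case True
      then show ?thesis using Z_scale[of r u] Z_scale[of r "- u"] by (simp add: center_field_def)
    next
      case False
      then show ?thesis using that Z_scale[of "- r" u] Z_scale[of "- r" "- u"] by (simp add: center_field_def)
    qed
    show "omega (frechet_derivative center_field (at u) x) y = - omega x (frechet_derivative center_field (at u) y)"
      if "u \<noteq> 0" for u x y by (rule center_field_hamiltonian[OF that dT[OF that]])
    show "center_field (a *\<^sub>R u + b *\<^sub>R I u) - center_field u \<in> span {u, I u}"
      if u: "u \<noteq> 0" and ab: "(a, b) \<noteq> (0, 0)" for u a b
    proof -
      let ?m = "a *\<^sub>R u + b *\<^sub>R I u"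
      have sp: "span {u, I u} = span {u, width_field u}"
        unfolding I_def by (rule span_energy_field[OF u]) (use s in simp)
      have m: "?m \<in> span {u, width_field u}" unfolding sp[symmetric] span_pair by blast
      have m0: "?m \<noteq> 0" using phf.plane_nonzero[OF u, of a "b / s"] ab s(1) by (simp add: I_def)
      have m1: "- ?m \<noteq> 0" using m0 neg_equal_0_iff_equal by blast
      have "Z ?m - Z u \<in> span {u, width_field u}" by (rule plane_invariance[OF u m m0])
      moreover have "Z (- ?m) - Z u \<in> span {u, width_field u}" by (rule plane_invariance[OF u span_neg[OF m] m1])
      ultimately have "(1 / 2) *\<^sub>R ((Z ?m - Z u) + (Z (- ?m) - Z u) + width_field u) \<in> span {u, width_field u}"
        by (intro span_scale span_add) (auto simp: span_base)
      moreover have "(1 / 2) *\<^sub>R ((Z ?m - Z u) + (Z (- ?m) - Z u) + width_field u) = center_field ?m - center_field u"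
        by (simp add: center_field_def width_field_def flip: scaleR_diff_right)
      ultimately show ?thesis by (simp only: sp)
    qed
    obtain B where B: "\<And>u. norm (Z u) \<le> B" using Z_bounded by blast
    have "norm (center_field u) \<le> B" for u
      using B[of u] B[of "- u"] norm_triangle_ineq[of "Z u" "Z (- u)"] by (simp add: center_field_def)
    then show "bounded (center_field ` (- {0}))" unfolding bounded_iff by blast
  qed (fact dim linI II skewI posI dT)+
  obtain u1 :: "'n phase_space" where u1: "u1 \<noteq> 0" using nonempty_Basis nonzero_Basis by blast
  define p where "p = J (center_field u1)"
  have sp: "support_point u = p + (1 / 2) *\<^sub>R J (width_field u)" if "u \<noteq> 0" for u
  proof -
    have "p = J (center_field u)" using pef.constant_off_origin[OF u1 that] by (simp add: p_def)
    also have "\<dots> = (1 / 2) *\<^sub>R (support_point u + support_point (- u))"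
      by (simp add: center_field_def J_scale J_add)
    finally show ?thesis by (simp add: J_width_field flip: scaleR_add_right)
  qed
  obtain L :: "'n phase_space \<Rightarrow> 'n phase_space" where L: "linear L" "bij L"
    "\<forall>u w. omega (L u) (L w) = omega u w" "\<forall>u. (norm (L u))\<^sup>2 = omega (I u) u"
    using symplectic_normal_form[OF linI II skewI posI] by blast
  note L_symplectic = L(3)[rule_format] and norm_L = L(4)[rule_format]
  define M where "M = (\<lambda>x. L (J x))"
  have linM: "linear M" unfolding M_def using linear_compose[OF linear_J L(1)] by (simp add: o_def)
  have "bij (J :: 'n phase_space \<Rightarrow> _)"
    by (rule bij_betw_byWitness[where f' = "\<lambda>x. - J x"]) (auto simp: J_minus)
  then have bijM: "bij M" unfolding M_def using L(2) bij_comp[of J L] by (simp add: o_def)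
  define \<phi> where "\<phi> = (\<lambda>x. M x + (- M p))"
  define r where "r = sqrt (s / 4)"
  have r: "r > 0" "r\<^sup>2 = s / 4" using s(1) by (simp_all add: r_def)
  have "bij \<phi>"
  proof -
    have "bij (\<lambda>x. x + (- M p))" by (rule bij_plus_right)
    then show ?thesis unfolding \<phi>_def using bij_comp[OF bijM, of "\<lambda>x. x + (- M p)"] by (simp add: o_def)
  qed
  have "affine_symplectomorphism \<phi>"
    unfolding affine_symplectomorphism_def
  proof (intro conjI exI[of _ M] exI[of _ "- M p"] allI)
    show "omega (M u) (M w) = omega u w" for u w
      unfolding M_def L_symplectic by (simp only: symplectic_form_eq_inner J_inner_J)
  qed (use \<open>bij \<phi>\<close> linM in \<open>auto simp: \<phi>_def\<close>)
  moreover have "\<phi> ` K = cball 0 r"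
  proof (rule cball_if_frontier_subset_sphere)
    have img: "\<phi> ` A = (\<lambda>x. - M p + x) ` (M ` A)" for A by (auto simp: \<phi>_def image_image)
    have contM: "continuous_on A \<phi>" for A
      unfolding \<phi>_def using linM
      by (intro continuous_intros linear_continuous_on) (simp add: linear_conv_bounded_linear)
    show cpt: "compact (\<phi> ` K)" by (intro compact_continuous_image contM K_props(1))
    have opn: "open (\<phi> ` A)" if "open A" for A
      unfolding img
      by (intro open_translation open_surjective_linear_image that linM) (use bijM in \<open>simp add: bij_def\<close>)
    have int: "\<phi> ` interior K \<subseteq> interior (\<phi> ` K)"
      by (rule interior_maximal) (auto intro: opn interior_subset[THEN subsetD])
    then show "interior (\<phi> ` K) \<noteq> {}" using K_props(4) by blast
    show "frontier (\<phi> ` K) \<subseteq> sphere 0 r"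
    proof
      fix y assume y: "y \<in> frontier (\<phi> ` K)"
      then have "y \<in> \<phi> ` K" using cpt by (metis compact_imp_closed frontier_subset_closed subsetD)
      then obtain x where x: "x \<in> K" "y = \<phi> x" by blast
      have "x \<notin> interior K" using int y x(2) by (auto simp: frontier_def)
      then have xF: "x \<in> frontier K" using x(1) K_props(2) by (simp add: frontier_def)
      define u where "u = outer_normal K x"
      have u: "u \<noteq> 0" using outer_normal_supports(1)[OF xF] by (auto simp: u_def)
      have "x = support_point u" using support_point_outer_normal[OF xF] by (simp add: u_def)
      then have xp: "x - p = (1 / 2) *\<^sub>R J (width_field u)" using sp[OF u] by simp
      define H where "H = omega (width_field u) u"
      have H: "H > 0" using width_field_positive[OF u] by (simp add: H_def)
      have fY: "width_field u = (1 / H) *\<^sub>R energy_field u" using H by (simp add: energy_field_def H_def)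
      have "J (x - p) = (- (1 / (2 * H))) *\<^sub>R energy_field u" by (simp add: xp J_scale fY)
      then have y': "y = L ((- (1 / (2 * H))) *\<^sub>R energy_field u)"
        using linear_diff[OF linM, of x p] by (simp add: x(2) \<phi>_def M_def)
      have "I (energy_field u) = (- s) *\<^sub>R u"
      proof -
        have "(1 / s) * - k = - s" using s(1) unfolding s(2)[symmetric] by simp
        then show ?thesis by (simp add: I_def k(3))
      qed
      then have "omega (I (energy_field u)) (energy_field u) = s * omega (energy_field u) u"
        using symplectic_skew[of u "energy_field u"] by (simp add: symplectic_simps)
      also have "\<dots> = s * (H * H)" by (simp add: energy_field_def symplectic_simps flip: H_def)
      finally have e: "omega (I (energy_field u)) (energy_field u) = s * (H * H)" .
      have "(norm y)\<^sup>2 = (1 / (2 * H)) * (1 / (2 * H)) * omega (I (energy_field u)) (energy_field u)"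
        unfolding y' norm_L linear_scale[OF linI] by (simp add: symplectic_simps)
      also have "\<dots> = s / 4" using H by (simp add: e)
      finally have "(norm y)\<^sup>2 = r\<^sup>2" by (simp add: r(2))
      then show "y \<in> sphere 0 r" using r(1) by (simp add: power2_eq_iff_nonneg)
    qed
    show "2 \<le> DIM('n phase_space)" using dim by simp
  qed
  ultimately show ?thesis using r(1) by blast
qed

end

section \<open>Bodies that are balls up to a symplectomorphism\<close>

context billiard_table
begin

text \<open>The linear part \<open>L\<close> maps the tangent direction \<open>J u\<close> at \<open>z(u)\<close> to a positive multiple of \<open>J a\<close>, where
  \<open>a\<close> is the image of \<open>z(u)\<close> on the sphere. Hence the images of consecutive points of a trajectory are
  \<open>a - t J a\<close> and \<open>a + t J a\<close>, and each lies in the complex line of the other.\<close>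

theorem planar_if_ball_up_to_symplectomorphism:
  assumes phi: "affine_symplectomorphism \<phi>" and r: "r > 0" and ball: "\<phi> ` K = cball 0 r" and x: "x \<notin> K"
  shows "planar (outer_billiard_trajectory K x)"
proof -
  obtain L b where L: "linear L" "\<And>x. \<phi> x = L x + b" "\<And>u w. omega (L u) (L w) = omega u w" and "bij \<phi>"
    using phi unfolding affine_symplectomorphism_def by blast
  have inj: "inj \<phi>" using \<open>bij \<phi>\<close> by (rule bij_is_inj)
  have injL: "inj L"
    using inj L(2) unfolding inj_def by (metis add_right_cancel)
  then obtain M where M: "linear M" "\<And>x. M (L x) = x" "\<And>x. L (M x) = x"
    using linear_injective_isomorphism[OF L(1)] by blast
  have phiM: "\<phi> (M (y - b)) = y" for y by (simp add: L(2) M(3))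
  have mem: "x \<in> K \<longleftrightarrow> norm (\<phi> x) \<le> r" for x
    using inj_image_mem_iff[OF inj, of x K] by (simp add: ball)
  have sphere: "norm (\<phi> z) = r" if z: "z \<in> frontier K" for z
  proof (rule ccontr)
    assume "norm (\<phi> z) \<noteq> r"
    moreover have "norm (\<phi> z) \<le> r" using z frontier_subset mem by blast
    ultimately have lt: "norm (\<phi> z) < r" by linarith
    have "continuous_on UNIV \<phi>" unfolding L(2) using L(1)
      by (intro continuous_intros linear_continuous_on) (simp add: linear_conv_bounded_linear)
    then have "open {x. norm (\<phi> x) < r}" by (intro open_Collect_less continuous_intros)
    moreover have "{x. norm (\<phi> x) < r} \<subseteq> K" using mem by auto
    ultimately have "z \<in> interior K" using lt interior_maximal by blast
    then show False using z by (simp add: frontier_def)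
  qed
  have rotate: "\<exists>t>0. L (J u) = t *\<^sub>R J (\<phi> (support_point u))" if u: "u \<noteq> 0" for u
  proof -
    let ?z = "support_point u" let ?a = "\<phi> ?z"
    define v where "v = M (J ?a)"
    define n where "n = - J v"
    have a: "norm ?a = r" by (rule sphere[OF support_point_frontier[OF u]])
    have "v \<noteq> 0"
    proof
      assume "v = 0"
      then have "J ?a = 0" using M(3)[of "J ?a"] linear_0[OF L(1)] by (simp add: v_def)
      then show False using a r by simp
    qed
    then have n0: "n \<noteq> 0" by (simp add: n_def)
    have "supports K ?z n"
      unfolding supports_def
    proof
      fix x assume "x \<in> K"
      then have xr: "norm (\<phi> x) \<le> r" using mem by blast
      have "n \<bullet> (x - ?z) = - omega (L v) (L (x - ?z))"
        unfolding L(3) by (simp add: n_def symplectic_form_eq_inner)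
      also have "L v = J ?a" by (simp add: v_def M(3))
      also have "L (x - ?z) = \<phi> x - ?a" by (simp add: L(2) linear_diff[OF L(1)])
      also have "- omega (J ?a) (\<phi> x - ?a) = ?a \<bullet> \<phi> x - r\<^sup>2"
        by (simp add: symplectic_form_eq_inner inner_diff_right dot_square_norm a)
      finally have e: "n \<bullet> (x - ?z) = ?a \<bullet> \<phi> x - r\<^sup>2" .
      have "?a \<bullet> \<phi> x \<le> r * norm (\<phi> x)" using norm_cauchy_schwarz[of ?a "\<phi> x"] a by simp
      also have "\<dots> \<le> r * r" using mult_left_mono[OF xr, of r] r by simp
      finally have "n \<bullet> (x - ?z) \<le> 0" unfolding e by (simp add: power2_eq_square)
      then show "n \<bullet> x \<le> n \<bullet> ?z" by (simp add: inner_diff_right)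
    qed
    then have "support_point n = ?z" by (intro support_point_eqI n0 support_point)
    then have eq: "(1 / norm n) *\<^sub>R n = (1 / norm u) *\<^sub>R u" by (rule support_point_injective[OF n0 u])
    define t where "t = norm u / norm n"
    have t: "t > 0" using u n0 by (simp add: t_def)
    have "u = norm u *\<^sub>R ((1 / norm u) *\<^sub>R u)" using u by simp
    also have "\<dots> = t *\<^sub>R n" unfolding eq[symmetric] by (simp add: t_def)
    finally have "J u = t *\<^sub>R v" by (simp add: n_def J_scale J_minus)
    then have "L (J u) = t *\<^sub>R J ?a" by (simp add: linear_scale[OF L(1)] v_def M(3))
    then show ?thesis using t by blast
  qed
  define y where "y = \<phi> x"
  have y0: "y \<noteq> 0" using x r mem by (auto simp: y_def)
  let ?V = "span {y, J y}"
  have JV: "J w \<in> ?V" if w: "w \<in> ?V" for w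
  proof -
    obtain c d where "w = c *\<^sub>R y + d *\<^sub>R J y" using w span_pair by blast
    then have "J w = (- d) *\<^sub>R y + c *\<^sub>R J y" by (simp add: J_add J_scale)
    then show ?thesis using span_pair by blast
  qed
  obtain u0 where u0: "u0 \<noteq> 0" "x = support_point u0 - J u0" by (rule exists_tangent_line[OF x])
  obtain u where u: "u 0 = u0" "\<And>k. u k \<noteq> 0"
    "\<And>k. outer_billiard_trajectory K x k = support_point (u k) - J (u k)"
    "\<And>k. support_point (u (Suc k)) - J (u (Suc k)) = support_point (u k) + J (u k)"
    unfolding u0(2) by (rule trajectory_normals[OF u0(1)]) blast
  have inV: "\<phi> (outer_billiard_trajectory K x k) \<in> ?V" for k
  proof (induction k)
    case 0
    then show ?case by (simp add: outer_billiard_trajectory_def span_base flip: y_def)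
  next
    case (Suc k)
    obtain t where t: "t > 0" "L (J (u k)) = t *\<^sub>R J (\<phi> (support_point (u k)))" using rotate[OF u(2)] by blast
    define a where "a = \<phi> (support_point (u k))"
    define w where "w = \<phi> (outer_billiard_trajectory K x k)"
    have w: "w = a - t *\<^sub>R J a"
      using t(2) by (simp add: w_def u(3) L(2) linear_diff[OF L(1)] a_def)
    have "outer_billiard_trajectory K x (Suc k) = support_point (u k) + J (u k)" by (simp only: u(3,4))
    then have w': "\<phi> (outer_billiard_trajectory K x (Suc k)) = a + t *\<^sub>R J a"
      using t(2) by (simp add: L(2) linear_add[OF L(1)] a_def)
    have "1 + t * t > 0" using t(1) by (simp add: add_pos_pos)
    then have tt: "1 + t * t \<noteq> 0" by linarith
    have "w + t *\<^sub>R J w = (1 + t * t) *\<^sub>R a"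
      by (simp add: w J_diff J_scale algebra_simps)
    then have "a = (1 / (1 + t * t)) *\<^sub>R (w + t *\<^sub>R J w)" using tt by simp
    moreover have "w \<in> ?V" using Suc.IH by (simp add: w_def)
    ultimately have "a \<in> ?V" by (simp only:) (intro span_scale span_add JV)
    then show ?case unfolding w' by (intro span_add span_scale JV)
  qed
  let ?P = "(\<lambda>w. - M b + w) ` (M ` ?V)"
  have injM: "inj M" by (rule injI) (metis M(3))
  have "y \<notin> span {J y}"
  proof
    assume "y \<in> span {J y}"
    then obtain c where "y = c *\<^sub>R J y" by (auto simp: span_singleton)
    then have "y \<bullet> y = c * (y \<bullet> J y)" by (metis inner_scaleR_right)
    then show False using y0 by simp
  qed
  moreover have "y \<noteq> J y" using y0 by (metis J_inner_self(2) inner_eq_zero_iff)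
  ultimately have "dim {y, J y} = card {y, J y}" using y0
    by (intro dim_eq_card_independent) (auto simp: independent_insert)
  then have "dim ?V = 2" using \<open>y \<noteq> J y\<close> by simp
  then have "aff_dim ?V = 2" by (simp add: aff_dim_subspace)
  then have "aff_dim ?P = 2" by (simp only: aff_dim_translation_eq aff_dim_injective_linear_image[OF M(1) injM])
  moreover have "affine ?P"
    by (simp only: affine_translation[symmetric])
      (intro subspace_imp_affine linear_subspace_image M(1) subspace_span)
  moreover have "range (outer_billiard_trajectory K x) \<subseteq> ?P"
  proof
    fix w assume "w \<in> range (outer_billiard_trajectory K x)"
    then have "\<phi> w \<in> ?V" using inV by blast
    moreover have "w = - M b + M (\<phi> w)" by (simp add: L(2) linear_add[OF M(1)] M(2))
    ultimately show "w \<in> ?P" by blast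
  qed
  ultimately show ?thesis unfolding planar_def by blast
qed

end

theorem corollary1p6:
  fixes K :: "'n::finite phase_space set"
  assumes "CARD('n) \<ge> 2"
    and "convex_body K"
    and "smooth_hypersurface (frontier K)"
    and "strongly_convex K"
  shows "(\<forall>x. x \<notin> K \<longrightarrow> planar (outer_billiard_trajectory K x)) \<longleftrightarrow>
    (\<exists>\<phi> r. affine_symplectomorphism \<phi> \<and> r > 0 \<and> \<phi> ` K = cball 0 r)"
proof -
  interpret billiard_table K
    by unfold_locales (fact assms(2-4))+
  show ?thesis
  proof
    assume "\<forall>x. x \<notin> K \<longrightarrow> planar (outer_billiard_trajectory K x)"
    then interpret planar_billiard K by unfold_locales blast
    show "\<exists>\<phi> r. affine_symplectomorphism \<phi> \<and> r > 0 \<and> \<phi> ` K = cball 0 r"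
      by (rule ball_up_to_symplectomorphism[OF assms(1)])
  next
    assume "\<exists>\<phi> r. affine_symplectomorphism \<phi> \<and> r > 0 \<and> \<phi> ` K = cball 0 r"
    then show "\<forall>x. x \<notin> K \<longrightarrow> planar (outer_billiard_trajectory K x)"
      using planar_if_ball_up_to_symplectomorphism by blast
  qed
qed

end
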